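(* Suppose the heat source is uniform, $f(\mathbf{x}) = f_0$ with $f_0>0$ a constant, and let $\chi>0$. For heat capacity rate $\chi$, let $\vartheta^{(f)}(\mathbf{x}) = \vartheta(\mathbf{x};\chi)$ be the solution of the forward flow problem and $\vartheta^{(r)}(\mathbf{x})$ the solution of the reverse flow problem (both stated in the context). Let $\Phi[\chi] = \int_{\Omega}\vartheta(\mathbf{x};\chi)\,\mathrm{d}\Omega$, i.e. $\Phi[\chi]=\mathrm{meas}(\Omega)\,\overline{\vartheta}$, where $\overline{\vartheta}$ is the mean surface temperature, and let $D\Phi[\chi]$ be the derivative of $\Phi$ with respect to $\chi$. Then the sensitivity of the mean surface temperature to the heat capacity rate is non-positive; that is, $$D\Phi[\chi] = -\frac{1}{f_0}\int_{\Sigma}\left(\vartheta^{(r)}(\mathbf{x})-\vartheta_{\mathrm{amb}}\right)\,\mathrm{grad}\left[\vartheta^{(f)}(\mathbf{x})\right]\cdot\widehat{\mathbf{t}}(\mathbf{x})\,\mathrm{d}\Gamma \;\leq\; 0 .$$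
   Context: **Geometry.** $\Omega\subset\mathbb{R}^2$ is an open bounded domain with piecewise smooth boundary $\partial\Omega$ and outward unit normal $\widehat{\mathbf{n}}(\mathbf{x})$; it is the mid-surface of a thin body of constant thickness $d>0$. $\Sigma$ is a curve in the domain (the vasculature), with its inlet and outlet on the lateral boundary, parameterized by normalized arc-length $s\in[0,1]$. Under forward flow, $s=0$ is the inlet and $s=1$ the outlet. $\widehat{\mathbf{t}}(\mathbf{x})$ is the unit tangent vector to $\Sigma$ in the direction of increasing $s$ (the same $s$ and $\widehat{\mathbf t}$ are used for forward and reverse flow). $\mathrm{d}\Gamma$ is arc-length measure. **Data.** $\kappa(\mathbf{x})>0$ is the scalar thermal conductivity field of the host material, $h_T>0$ the constant heat transfer coefficient, $\vartheta_{\mathrm{amb}}$ the constant ambient temperature, and the inlet temperature satisfies $\vartheta_{\mathrm{inlet}}=\vartheta_{\mathrm{amb}}$. $\chi$ is a constant (the heat capacity rate of the fluid, i.e. mass flow rate times specific heat capacity). $d,\kappa,h_T,\vartheta_{\mathrm{amb}},f_0$ do not depend on $\chi$. **Jumps and averages.** $\widehat{\mathbf{n}}^{+}$ and $\widehat{\mathbf{n}}^{-}$ are the outward unit normals on the two sides of $\Sigma$, so $\widehat{\mathbf{n}}^{+}+\widehat{\mathbf{n}}^{-}=\mathbf{0}$ and $\widehat{\mathbf{n}}^{\pm}\cdot\widehat{\mathbf{t}}=0$ on $\Sigma$. For a field $\gamma$, the limiting values on $\Sigma$ are $\gamma^{\pm}(\mathbf{x})=\lim_{\epsilon\to0}\gamma(\mathbf{x}-|\epsilon|\,\widehat{\mathbf{n}}^{\pm}(\mathbf{x}))$.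 For a scalar or vector field $\gamma$, the average is $\langle\!\langle\gamma\rangle\!\rangle=\tfrac12(\gamma^{+}+\gamma^{-})$. The jump of a scalar field $\alpha$ is $[\![\alpha]\!]=\alpha^{+}\widehat{\mathbf{n}}^{+}+\alpha^{-}\widehat{\mathbf{n}}^{-}$, and the jump of a vector field $\mathbf{a}$ is $[\![\mathbf{a}]\!]=\mathbf{a}^{+}\cdot\widehat{\mathbf{n}}^{+}+\mathbf{a}^{-}\cdot\widehat{\mathbf{n}}^{-}$. **Forward flow problem** (solution $\vartheta^{(f)}=\vartheta(\cdot;\chi)$): - $-d\,\mathrm{div}[\kappa\,\mathrm{grad}[\vartheta]] = f-h_T(\vartheta-\vartheta_{\mathrm{amb}})$ in $\Omega\setminus\Sigma$; - $-d\,[\![\kappa\,\mathrm{grad}[\vartheta]]\!] = \chi\,\langle\!\langle\mathrm{grad}[\vartheta]\cdot\widehat{\mathbf{t}}\rangle\!\rangle$ on $\Sigma$; - $[\![\vartheta]\!]=\mathbf{0}$ on $\Sigma$; - $-d\,\widehat{\mathbf{n}}\cdot\kappa\,\mathrm{grad}[\vartheta]=0$ on $\partial\Omega$; - $\langle\!\langle\vartheta\rangle\!\rangle=\vartheta_{\mathrm{inlet}}=\vartheta_{\mathrm{amb}}$ at $s=0$ on $\Sigma$. **Reverse flow problem** (solution $\vartheta^{(r)}$; inlet and outlet swapped): - $-d\,\mathrm{div}[\kappa\,\mathrm{grad}[\vartheta^{(r)}]] = f-h_T(\vartheta^{(r)}-\vartheta_{\mathrm{amb}})$ in $\Omega\setminus\Sigma$;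 - $-d\,[\![\kappa\,\mathrm{grad}[\vartheta^{(r)}]]\!] = -\chi\,\langle\!\langle\mathrm{grad}[\vartheta^{(r)}]\cdot\widehat{\mathbf{t}}\rangle\!\rangle$ on $\Sigma$; - $[\![\vartheta^{(r)}]\!]=\mathbf{0}$ on $\Sigma$; - $-d\,\widehat{\mathbf{n}}\cdot\kappa\,\mathrm{grad}[\vartheta^{(r)}]=0$ on $\partial\Omega$; - $\langle\!\langle\vartheta^{(r)}\rangle\!\rangle=\vartheta_{\mathrm{inlet}}=\vartheta_{\mathrm{amb}}$ at $s=1$ on $\Sigma$. Since temperature is continuous across $\Sigma$ and $\widehat{\mathbf{t}}$ is the same on both sides, the tangential derivative $\mathrm{grad}[\vartheta]\cdot\widehat{\mathbf{t}}$ is single-valued on $\Sigma$. **Standing conventions.** Both problems are taken to be well posed (each has a unique solution), with solutions regular enough for the quantities above to make sense; $\vartheta(\cdot;\chi)$ is differentiable with respect to $\chi$, and this derivative commutes with the spatial derivatives and with the integral over $\Omega$. The mean surface temperature is $\overline{\vartheta}=\frac{1}{\mathrm{meas}(\Omega)}\int_{\Omega}\vartheta\,\mathrm{d}\Omega$, where $\mathrm{meas}(\Omega)$ is the area of $\Omega$. *)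

theory Defs
  imports "HOL-Analysis.Analysis"
begin

section \<open>Classical vector calculus\<close>

definition grad :: "('a::euclidean_space \<Rightarrow> real) \<Rightarrow> 'a \<Rightarrow> 'a" where
  "grad f x = (\<Sum>b\<in>Basis. frechet_derivative f (at x) b *\<^sub>R b)"

definition divergence :: "('a::euclidean_space \<Rightarrow> 'a) \<Rightarrow> 'a \<Rightarrow> real" where
  "divergence F x = (\<Sum>b\<in>Basis. frechet_derivative F (at x) b \<bullet> b)"

definition C1_field :: "('a::real_normed_vector \<Rightarrow> 'b::real_normed_vector) \<Rightarrow> 'a set \<Rightarrow> bool" where
  "C1_field F S \<longleftrightarrow> (\<forall>x\<in>S. F differentiable (at x)) \<and>
     (\<forall>h. continuous_on S (\<lambda>x. frechet_derivative F (at x) h))"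

lemma grad_eq: "GDERIV f x :> D \<Longrightarrow> grad f x = D"
  by (simp add: grad_def gderiv_def frechet_derivative_at[symmetric]
      inner_commute[of _ D] euclidean_representation)


section \<open>Geometry\<close>

text \<open>Near a smooth boundary point \<open>x\<close> the domain is a sublevel set \<open>\<psi> < 0\<close> of a continuously
  differentiable function with nonvanishing gradient; \<open>n\<close> is then the outward unit normal.\<close>

definition outward_normal :: "(real^2) set \<Rightarrow> real^2 \<Rightarrow> real^2 \<Rightarrow> bool" where
  "outward_normal \<Omega> x n \<longleftrightarrow>
     (\<exists>U \<psi>. open U \<and> x \<in> U \<and> C1_field \<psi> U \<and> \<Omega> \<inter> U = {y \<in> U. \<psi> y < (0::real)} \<and>
        \<psi> x = 0 \<and> grad \<psi> x \<noteq> 0 \<and> n = sgn (grad \<psi> x))"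

text \<open>The finitely many exceptional points are the corners. Only continuously differentiable
  smoothness is asked for, and corners may be of any shape.\<close>

definition piecewise_smooth_boundary :: "(real^2) set \<Rightarrow> bool" where
  "piecewise_smooth_boundary \<Omega> \<longleftrightarrow> finite {x \<in> frontier \<Omega>. \<nexists>n. outward_normal \<Omega> x n}"

text \<open>The vasculature \<open>\<Sigma>\<close> is \<open>path_image \<gamma>\<close>. Constant speed expresses that the parameter is the
  normalized arc length; the speed is the length of \<open>\<Sigma>\<close>. Differentiability at the ends is two-sided,
  i.e. \<open>\<gamma>\<close> is taken to be extended beyond \<open>{0..1}\<close>; the extension is not used otherwise.\<close>

definition vasculature :: "(real^2) set \<Rightarrow> (real \<Rightarrow> real^2) \<Rightarrow> bool" where
  "vasculature \<Omega> \<gamma> \<longleftrightarrow> arc \<gamma> \<and> \<gamma> C1_differentiable_on {0..1} \<and>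
     (\<exists>L>0. \<forall>s\<in>{0..1}. norm (vector_derivative \<gamma> (at s)) = L) \<and>
     \<gamma> 0 \<in> frontier \<Omega> \<and> \<gamma> 1 \<in> frontier \<Omega> \<and> \<gamma> ` {0<..<1} \<subseteq> \<Omega>"

definition unit_tangent :: "(real \<Rightarrow> real^2) \<Rightarrow> real \<Rightarrow> real^2" where
  "unit_tangent \<gamma> s = sgn (vector_derivative \<gamma> (at s))"

text \<open>Outward unit normals on the two sides of \<open>\<Sigma>\<close>; which side is called plus is immaterial for
  jumps and averages.\<close>

definition normal_plus :: "(real \<Rightarrow> real^2) \<Rightarrow> real \<Rightarrow> real^2" where
  "normal_plus \<gamma> s = vector [- (unit_tangent \<gamma> s $ 2), unit_tangent \<gamma> s $ 1]"

definition normal_minus :: "(real \<Rightarrow> real^2) \<Rightarrow> real \<Rightarrow> real^2" where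
  "normal_minus \<gamma> s = - normal_plus \<gamma> s"

definition curve_integral :: "(real \<Rightarrow> real^2) \<Rightarrow> (real \<Rightarrow> real) \<Rightarrow> real" where
  "curve_integral \<gamma> g = integral {0..1} (\<lambda>s. g s * norm (vector_derivative \<gamma> (at s)))"


section \<open>Limiting values, jumps and averages\<close>

text \<open>Quantities living on \<open>\<Sigma>\<close> are written as functions of the parameter \<open>s\<close>.\<close>

definition side_value :: "real^2 \<Rightarrow> real^2 \<Rightarrow> (real^2 \<Rightarrow> 'b::t2_space) \<Rightarrow> 'b" where
  "side_value x n g = Lim (at 0) (\<lambda>\<epsilon>::real. g (x - \<bar>\<epsilon>\<bar> *\<^sub>R n))"

definition average :: "(real \<Rightarrow> real^2) \<Rightarrow> (real^2 \<Rightarrow> 'b::real_normed_vector) \<Rightarrow> real \<Rightarrow> 'b" where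
  "average \<gamma> g s = (1/2) *\<^sub>R (side_value (\<gamma> s) (normal_plus \<gamma> s) g
                             + side_value (\<gamma> s) (normal_minus \<gamma> s) g)"

definition jump_scalar :: "(real \<Rightarrow> real^2) \<Rightarrow> (real^2 \<Rightarrow> real) \<Rightarrow> real \<Rightarrow> real^2" where
  "jump_scalar \<gamma> a s = side_value (\<gamma> s) (normal_plus \<gamma> s) a *\<^sub>R normal_plus \<gamma> s
                     + side_value (\<gamma> s) (normal_minus \<gamma> s) a *\<^sub>R normal_minus \<gamma> s"

definition jump_vector :: "(real \<Rightarrow> real^2) \<Rightarrow> (real^2 \<Rightarrow> real^2) \<Rightarrow> real \<Rightarrow> real" where
  "jump_vector \<gamma> a s = side_value (\<gamma> s) (normal_plus \<gamma> s) a \<bullet> normal_plus \<gamma> s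
                     + side_value (\<gamma> s) (normal_minus \<gamma> s) a \<bullet> normal_minus \<gamma> s"

text \<open>The gradient is in general discontinuous across \<open>\<Sigma>\<close>; its tangential component on \<open>\<Sigma>\<close> is
  understood through the average.\<close>

definition tangential_derivative :: "(real \<Rightarrow> real^2) \<Rightarrow> (real^2 \<Rightarrow> real) \<Rightarrow> real \<Rightarrow> real" where
  "tangential_derivative \<gamma> \<theta> s = average \<gamma> (\<lambda>x. grad \<theta> x \<bullet> unit_tangent \<gamma> s) s"

definition boundary_value :: "(real^2) set \<Rightarrow> (real \<Rightarrow> real^2) \<Rightarrow> real^2 \<Rightarrow> (real^2 \<Rightarrow> 'b::t2_space) \<Rightarrow> 'b" where
  "boundary_value \<Omega> \<gamma> x g = Lim (at x within \<Omega> - path_image \<gamma>) g"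


section \<open>Regularity\<close>

text \<open>\<open>g\<close> extends continuously up to \<open>\<Sigma>\<close> from each side, away from the inlet and the outlet: the
  limits along the normals exist locally uniformly in \<open>s\<close>.\<close>

definition has_side_values :: "(real \<Rightarrow> real^2) \<Rightarrow> (real^2 \<Rightarrow> 'b::topological_space) \<Rightarrow> bool" where
  "has_side_values \<gamma> g \<longleftrightarrow> (\<forall>\<nu>\<in>{normal_plus \<gamma>, normal_minus \<gamma>}. \<forall>s\<in>{0<..<1}. \<exists>l.
     ((\<lambda>(\<sigma>, \<epsilon>). g (\<gamma> \<sigma> - \<epsilon> *\<^sub>R \<nu> \<sigma>)) \<longlongrightarrow> l) (at (s, 0) within UNIV \<times> {0<..}))"

text \<open>Boundary points that are neither corners nor an inlet or outlet, with their normals.\<close>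

definition smooth_boundary :: "(real^2) set \<Rightarrow> (real \<Rightarrow> real^2) \<Rightarrow> ((real^2) \<times> (real^2)) set" where
  "smooth_boundary \<Omega> \<gamma> = {(x, n). x \<in> frontier \<Omega> - {\<gamma> 0, \<gamma> 1} \<and> outward_normal \<Omega> x n}"

text \<open>Classical regularity away from finitely many points. The gradient must be allowed to blow up
  at corners and at the two ends of \<open>\<Sigma>\<close>: the jump condition and the insulated boundary force the
  solution to behave like a power of the distance to the inlet, with exponent less than one,
  already for a straight \<open>\<Sigma>\<close> meeting a straight boundary perpendicularly.
  Finite energy and an integrable tangential derivative on \<open>\<Sigma>\<close> are compatible with this.
  Continuity across \<open>\<Sigma>\<close> is not part of the definition.\<close>

definition regular_field ::
  "(real^2) set \<Rightarrow> (real \<Rightarrow> real^2) \<Rightarrow> (real^2 \<Rightarrow> real) \<Rightarrow> (real^2 \<Rightarrow> real) \<Rightarrow> bool" where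
  "regular_field \<Omega> \<gamma> \<kappa> \<theta> \<longleftrightarrow>
     continuous_on (closure \<Omega> - \<gamma> ` {0<..<1}) \<theta> \<and>
     C1_field \<theta> (\<Omega> - path_image \<gamma>) \<and>
     C1_field (\<lambda>x. \<kappa> x *\<^sub>R grad \<theta> x) (\<Omega> - path_image \<gamma>) \<and>
     has_side_values \<gamma> \<theta> \<and> has_side_values \<gamma> (grad \<theta>) \<and>
     (\<forall>(x, n)\<in>smooth_boundary \<Omega> \<gamma>. \<exists>l. (grad \<theta> \<longlongrightarrow> l) (at x within \<Omega> - path_image \<gamma>)) \<and>
     (\<lambda>x. (norm (grad \<theta> x))\<^sup>2) integrable_on (\<Omega> - path_image \<gamma>) \<and>
     (\<lambda>s. tangential_derivative \<gamma> \<theta> s * norm (vector_derivative \<gamma> (at s)))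
       absolutely_integrable_on {0..1}"


section \<open>The two flow problems\<close>

text \<open>The inlet condition is read as the limit of the average along \<open>\<Sigma>\<close>, since the normal line to
  \<open>\<Sigma>\<close> at its end need not meet the domain.\<close>

definition forward_solution ::
  "(real^2) set \<Rightarrow> (real \<Rightarrow> real^2) \<Rightarrow> real \<Rightarrow> (real^2 \<Rightarrow> real) \<Rightarrow> real \<Rightarrow> real \<Rightarrow> real \<Rightarrow>
   (real^2 \<Rightarrow> real) \<Rightarrow> real \<Rightarrow> (real^2 \<Rightarrow> real) \<Rightarrow> bool" where
  "forward_solution \<Omega> \<gamma> d \<kappa> h\<^sub>T \<theta>amb \<theta>inlet f c \<theta> \<longleftrightarrow>
     regular_field \<Omega> \<gamma> \<kappa> \<theta> \<and>
     (\<forall>x\<in>\<Omega> - path_image \<gamma>.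
        - d * divergence (\<lambda>y. \<kappa> y *\<^sub>R grad \<theta> y) x = f x - h\<^sub>T * (\<theta> x - \<theta>amb)) \<and>
     (\<forall>s\<in>{0<..<1}.
        - d * jump_vector \<gamma> (\<lambda>y. \<kappa> y *\<^sub>R grad \<theta> y) s = c * tangential_derivative \<gamma> \<theta> s) \<and>
     (\<forall>s\<in>{0<..<1}. jump_scalar \<gamma> \<theta> s = 0) \<and>
     (\<forall>(x, n)\<in>smooth_boundary \<Omega> \<gamma>.
        - d * (n \<bullet> boundary_value \<Omega> \<gamma> x (\<lambda>y. \<kappa> y *\<^sub>R grad \<theta> y)) = 0) \<and>
     (average \<gamma> \<theta> \<longlongrightarrow> \<theta>inlet) (at_right 0)"

definition reverse_solution ::
  "(real^2) set \<Rightarrow> (real \<Rightarrow> real^2) \<Rightarrow> real \<Rightarrow> (real^2 \<Rightarrow> real) \<Rightarrow> real \<Rightarrow> real \<Rightarrow> real \<Rightarrow>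
   (real^2 \<Rightarrow> real) \<Rightarrow> real \<Rightarrow> (real^2 \<Rightarrow> real) \<Rightarrow> bool" where
  "reverse_solution \<Omega> \<gamma> d \<kappa> h\<^sub>T \<theta>amb \<theta>inlet f c \<theta> \<longleftrightarrow>
     regular_field \<Omega> \<gamma> \<kappa> \<theta> \<and>
     (\<forall>x\<in>\<Omega> - path_image \<gamma>.
        - d * divergence (\<lambda>y. \<kappa> y *\<^sub>R grad \<theta> y) x = f x - h\<^sub>T * (\<theta> x - \<theta>amb)) \<and>
     (\<forall>s\<in>{0<..<1}.
        - d * jump_vector \<gamma> (\<lambda>y. \<kappa> y *\<^sub>R grad \<theta> y) s = - c * tangential_derivative \<gamma> \<theta> s) \<and>
     (\<forall>s\<in>{0<..<1}. jump_scalar \<gamma> \<theta> s = 0) \<and>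
     (\<forall>(x, n)\<in>smooth_boundary \<Omega> \<gamma>.
        - d * (n \<bullet> boundary_value \<Omega> \<gamma> x (\<lambda>y. \<kappa> y *\<^sub>R grad \<theta> y)) = 0) \<and>
     (average \<gamma> \<theta> \<longlongrightarrow> \<theta>inlet) (at_left 1)"


section \<open>Dependence on the heat capacity rate\<close>

text \<open>At the rate \<open>c\<close> the family \<open>\<theta>\<close> has a regular derivative field \<open>u\<close>, and differentiation in
  the rate commutes with the spatial derivatives (in the interior and in their limiting values on
  \<open>\<Sigma>\<close> and on the boundary) and with the integral over \<open>\<Omega>\<close>.\<close>

definition rate_differentiable ::
  "(real^2) set \<Rightarrow> (real \<Rightarrow> real^2) \<Rightarrow> (real^2 \<Rightarrow> real) \<Rightarrow> (real \<Rightarrow> real^2 \<Rightarrow> real) \<Rightarrow> real \<Rightarrow> bool" where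
  "rate_differentiable \<Omega> \<gamma> \<kappa> \<theta> c \<longleftrightarrow> (\<exists>u. regular_field \<Omega> \<gamma> \<kappa> u \<and>
     (\<forall>x\<in>closure \<Omega> - \<gamma> ` {0<..<1}. ((\<lambda>a. \<theta> a x) has_real_derivative u x) (at c)) \<and>
     (\<forall>x\<in>\<Omega> - path_image \<gamma>.
        ((\<lambda>a. grad (\<theta> a) x) has_vector_derivative grad u x) (at c) \<and>
        ((\<lambda>a. divergence (\<lambda>y. \<kappa> y *\<^sub>R grad (\<theta> a) y) x) has_real_derivative
           divergence (\<lambda>y. \<kappa> y *\<^sub>R grad u y) x) (at c)) \<and>
     (\<forall>s\<in>{0<..<1}. \<forall>n\<in>{normal_plus \<gamma> s, normal_minus \<gamma> s}.
        ((\<lambda>a. side_value (\<gamma> s) n (\<theta> a)) has_real_derivative side_value (\<gamma> s) n u) (at c) \<and>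
        ((\<lambda>a. side_value (\<gamma> s) n (grad (\<theta> a))) has_vector_derivative
           side_value (\<gamma> s) n (grad u)) (at c)) \<and>
     (\<forall>(x, n)\<in>smooth_boundary \<Omega> \<gamma>.
        ((\<lambda>a. boundary_value \<Omega> \<gamma> x (grad (\<theta> a))) has_vector_derivative
           boundary_value \<Omega> \<gamma> x (grad u)) (at c)) \<and>
     ((\<lambda>a. integral \<Omega> (\<theta> a)) has_real_derivative integral \<Omega> u) (at c))"

end

theory Submission
  imports Defs
begin

text \<open>Write \<open>\<psi>\<close> and \<open>\<phi>\<close> for the excess over the ambient temperature of the forward and of the reverse
solution, \<open>u\<close> for the derivative of the forward solution in the rate \<open>c\<close>, and
\<open>a(v, w) = \<integral> d \<kappa> (grad v \<bullet> grad w) + h v w\<close> for the symmetric form of conduction and surface loss. Below, a dash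
is the tangential derivative on \<open>\<Sigma>\<close>. Green's identity turns the three boundary value problems into
\<open>a(v, \<psi>) + c \<integral> v \<psi>' = f \<integral> v\<close>, \<open>a(v, \<phi>) - c \<integral> v \<phi>' = f \<integral> v\<close> and
\<open>a(v, u) + c \<integral> v u' = - \<integral> v \<psi>'\<close>, for every regular \<open>v\<close> that is continuous across \<open>\<Sigma>\<close>.

Testing the reverse problem with \<open>u\<close>, the sensitivity problem with \<open>\<phi>\<close>, and subtracting,
the symmetric form cancels and \<open>f \<integral> u = - \<integral> \<phi> \<psi>' - c \<integral> (\<phi> u)'\<close>. The last integral vanishes because
\<open>u = 0\<close> at the inlet and \<open>\<phi> = 0\<close> at the outlet.

As for the sign, the integrand \<open>\<phi> \<psi>'\<close> need not be non-negative pointwise: the fluid may cool down where \<open>\<Sigma>\<close> passes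
near its own inlet. Put \<open>\<delta> = \<psi> - \<phi>\<close> and \<open>m = \<psi> + \<phi>\<close>. Subtracting the first two weak forms and testing with \<open>\<delta>\<close>
gives \<open>a(\<delta>, \<delta>) = - c \<integral> \<delta> m'\<close>. Integration by parts, with \<open>\<psi> = 0\<close> at the inlet and \<open>\<phi> = 0\<close> at the outlet,
then yields \<open>4 \<integral> \<phi> \<psi>' = (2/c) a(\<delta>, \<delta>) + \<psi>(1)^2 + \<phi>(0)^2\<close>, where 0 and 1 are the ends of \<open>\<Sigma>\<close>. Every term on the right is
non-negative; see \<open>sensitivity\<close>.

The analytic work is Green's identity, \<open>green_identity\<close>, since gradients may blow up at the corners and at the
ends of \<open>\<Sigma>\<close>, and only the divergence of the flux, not each of its partial derivatives, is controlled near \<open>\<Sigma>\<close>.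
The identity \<open>\<integral> (\<eta> div F + grad \<eta> \<bullet> F) = \<integral> \<eta> [[F]]\<close>, with the second integral over \<open>\<Sigma>\<close>, is shown first for test
functions \<open>\<eta>\<close> supported near one point. Inside the domain it is translation invariance of the integral. Near
\<open>\<Sigma>\<close> or a smooth boundary point, \<open>\<eta>\<close> is cut off in a layer of thickness \<open>1/n\<close> (\<open>layer_limit\<close>), and the gradient of the
cutoff reproduces the flux through the layer. At \<open>\<Sigma>\<close> this tends to the jump (\<open>slit_flux_identity\<close>). At the insulated
boundary it tends to zero, because the normal flux does and the layer has area \<open>O(1/n)\<close> (\<open>boundary_flux_identity\<close>).
Smooth bumps over a finite cover glue the local identities together, and the finitely many exceptional points are
removed by cutoffs whose gradients stay bounded in \<open>L^2\<close>, which suffices for fields in \<open>L^2\<close>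
(\<open>flux_identity_local_to_global\<close>).\<close>

section \<open>Cutoff functions and compactly supported fields\<close>

lemma has_derivative_pos_part_square:
  "((\<lambda>x::real. (max 0 x)\<^sup>2) has_real_derivative 2 * max 0 x) (at x)"
proof -
  consider "x > 0" | "x < 0" | "x = 0" by linarith
  then show ?thesis
  proof cases
    case 1
    have "((\<lambda>x::real. x\<^sup>2) has_real_derivative 2 * max 0 x) (at x)"
      using 1 by (auto intro!: derivative_eq_intros)
    then show ?thesis
      by (rule has_field_derivative_transform_within_open[where S="{0<..}"]) (use 1 in auto)
  next
    case 2
    have "((\<lambda>x::real. 0) has_real_derivative 2 * max 0 x) (at x)"
      using 2 by (auto intro!: derivative_eq_intros)
    then show ?thesis
      by (rule has_field_derivative_transform_within_open[where S="{..<0}"]) (use 2 in auto)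
  next
    case 3
    have "((\<lambda>y::real. (max 0 y)\<^sup>2 / y) \<longlongrightarrow> 0) (at 0)"
    proof (rule Lim_null_comparison)
      show "\<forall>\<^sub>F y::real in at 0. norm ((max 0 y)\<^sup>2 / y) \<le> \<bar>y\<bar>"
        by (rule always_eventually) (auto simp: max_def power2_eq_square)
      show "((\<lambda>y::real. \<bar>y\<bar>) \<longlongrightarrow> 0) (at 0)"
        by (auto intro!: tendsto_eq_intros)
    qed
    then show ?thesis using 3 by (simp add: has_field_derivative_iff)
  qed
qed

text \<open>The squares \<open>P x\<close> and \<open>P (1 - x)\<close> of the positive parts of \<open>x\<close> and \<open>1 - x\<close> are continuously differentiable
and never vanish together, so \<open>P x / (P x + P (1 - x))\<close> is a step.\<close>

lemma exists_smooth_step: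
  obtains S S' :: "real \<Rightarrow> real" where
    "\<And>x. (S has_real_derivative S' x) (at x)" "continuous_on UNIV S'"
    "\<And>x. x \<le> 0 \<Longrightarrow> S x = 0" "\<And>x. x \<ge> 1 \<Longrightarrow> S x = 1"
    "\<And>x. 0 \<le> S x" "\<And>x. S x \<le> 1"
    "\<And>x. x \<le> 0 \<Longrightarrow> S' x = 0" "\<And>x. x \<ge> 1 \<Longrightarrow> S' x = 0"
proof -
  define P where "P x = (max 0 x)\<^sup>2" for x :: real
  define Q where "Q x = P x + P (1 - x)" for x :: real
  have Q: "Q x > 0" for x
    unfolding Q_def P_def by (cases "x > 0") (auto intro: add_pos_nonneg)
  have dP: "(P has_real_derivative 2 * max 0 x) (at x)" for x
    unfolding P_def by (rule has_derivative_pos_part_square)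
  have dP1: "((\<lambda>x. P (1 - x)) has_real_derivative - (2 * max 0 (1 - x))) (at x)" for x
  proof -
    have "((\<lambda>x. 1 - x) has_real_derivative -1) (at x)" by (auto intro!: derivative_eq_intros)
    from DERIV_chain'[OF this dP] show ?thesis by simp
  qed
  define S where "S x = P x / Q x" for x
  define S' where "S' x = (2 * max 0 x * Q x - P x * (2 * max 0 x - 2 * max 0 (1 - x))) / (Q x * Q x)" for x
  have dQ: "(Q has_real_derivative 2 * max 0 x - 2 * max 0 (1 - x)) (at x)" for x
    unfolding Q_def using DERIV_add[OF dP dP1] by simp
  have "(S has_real_derivative S' x) (at x)" for x
    unfolding S_def S'_def using DERIV_divide[OF dP dQ] Q[of x] by simp
  moreover have "continuous_on UNIV P" "continuous_on UNIV Q"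
    by (rule DERIV_continuous_on, rule has_field_derivative_at_within, rule dP,
        rule DERIV_continuous_on, rule has_field_derivative_at_within, rule dQ)
  then have "continuous_on UNIV S'"
    unfolding S'_def using Q by (intro continuous_intros) (auto simp: less_imp_neq[symmetric] order.strict_implies_not_eq)
  moreover have "S x = 0" "S' x = 0" if "x \<le> 0" for x
    using that by (auto simp: S_def S'_def P_def)
  moreover have "S x = 1" if "x \<ge> 1" for x
    using that Q[of x] by (auto simp: S_def P_def Q_def)
  moreover have "S' x = 0" if "x \<ge> 1" for x
    using that by (auto simp: S'_def P_def Q_def algebra_simps)
  moreover have "0 \<le> S x" "S x \<le> 1" for x
    using Q[of x] by (auto simp: S_def Q_def P_def divide_simps)
  ultimately show thesis using that by blast
qed

text \<open>Test functions. The gradient is an argument, because cutoffs are built from products and compositions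
whose gradients have to be known explicitly.\<close>

definition C1_with_gradient :: "('a::euclidean_space \<Rightarrow> real) \<Rightarrow> ('a \<Rightarrow> 'a) \<Rightarrow> bool" where
  "C1_with_gradient \<eta> g \<longleftrightarrow> (\<forall>x. GDERIV \<eta> x :> g x) \<and> continuous_on UNIV g"

lemma C1_with_gradient_continuous: "C1_with_gradient \<eta> g \<Longrightarrow> continuous_on UNIV \<eta>"
  unfolding C1_with_gradient_def gderiv_def
  by (intro continuous_at_imp_continuous_on ballI has_derivative_continuous) auto

lemma C1_with_gradient_const: "C1_with_gradient (\<lambda>_. k) (\<lambda>_. 0)"
  by (auto simp: C1_with_gradient_def GDERIV_const)

lemma C1_with_gradient_diff:
  "C1_with_gradient \<eta> g \<Longrightarrow> C1_with_gradient \<eta>' g' \<Longrightarrow>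
   C1_with_gradient (\<lambda>x. \<eta> x - \<eta>' x) (\<lambda>x. g x - g' x)"
  by (auto simp: C1_with_gradient_def intro!: GDERIV_diff continuous_intros)

lemma C1_with_gradient_mult:
  assumes "C1_with_gradient \<eta> g" "C1_with_gradient \<eta>' g'"
  shows "C1_with_gradient (\<lambda>x. \<eta> x * \<eta>' x) (\<lambda>x. \<eta> x *\<^sub>R g' x + \<eta>' x *\<^sub>R g x)"
  using assms C1_with_gradient_continuous[OF assms(1)] C1_with_gradient_continuous[OF assms(2)]
  by (auto simp: C1_with_gradient_def intro!: GDERIV_mult continuous_intros)

lemma C1_with_gradient_compose:
  assumes "C1_with_gradient \<eta> g" "\<And>x. (S has_real_derivative S' x) (at x)" "continuous_on UNIV S'"
  shows "C1_with_gradient (\<lambda>x. S (\<eta> x)) (\<lambda>x. S' (\<eta> x) *\<^sub>R g x)"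
  unfolding C1_with_gradient_def
proof safe
  show "GDERIV (\<lambda>x. S (\<eta> x)) x :> S' (\<eta> x) *\<^sub>R g x" for x
    by (rule GDERIV_DERIV_compose) (use assms in \<open>auto simp: C1_with_gradient_def\<close>)
  show "continuous_on UNIV (\<lambda>x. S' (\<eta> x) *\<^sub>R g x)"
    using assms C1_with_gradient_continuous[OF assms(1)]
    by (auto simp: C1_with_gradient_def
        intro!: continuous_intros continuous_on_compose2[OF assms(3)])
qed

lemma C1_with_gradient_dist_square:
  "C1_with_gradient (\<lambda>x. (norm (x - p))\<^sup>2) (\<lambda>x. 2 *\<^sub>R (x - p))"
  unfolding C1_with_gradient_def gderiv_def power2_norm_eq_inner
  by (auto intro!: derivative_eq_intros continuous_intros simp: inner_commute algebra_simps fun_eq_iff)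

lemma C1_with_gradient_zero_outside:
  assumes "C1_with_gradient \<eta> g" "open U" "\<And>x. x \<in> U \<Longrightarrow> \<eta> x = 0" "x \<in> U"
  shows "g x = 0"
proof -
  have "GDERIV \<eta> x :> g x" using assms by (simp add: C1_with_gradient_def)
  moreover have "GDERIV \<eta> x :> 0"
    unfolding gderiv_def
    by (rule has_derivative_transform_within_open[of "\<lambda>_. 0" _ _ _ U]) (use assms in auto)
  ultimately show ?thesis by (metis grad_eq)
qed

text \<open>Translating a function does not change its integral. The difference quotients in a direction
  therefore have integral zero, and so has their limit.\<close>

lemma integral_partial_derivative_eq_0:
  fixes f :: "'a::euclidean_space \<Rightarrow> real"
  assumes C1: "C1_with_gradient f g" and supp: "\<And>x. norm x > R \<Longrightarrow> f x = 0"
  shows "((\<lambda>x. g x \<bullet> b) has_integral 0) UNIV"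
proof -
  have cf: "continuous_on UNIV f" using C1 by (rule C1_with_gradient_continuous)
  have cg: "continuous_on UNIV g" using C1 by (simp add: C1_with_gradient_def)
  have g0: "g x = 0" if "norm x > R" for x
    by (rule C1_with_gradient_zero_outside[OF C1, of "- cball 0 R"]) (use supp that in auto)
  have "compact (g ` cball 0 R)"
    by (rule compact_continuous_image[OF continuous_on_subset[OF cg]]) auto
  then obtain M0 where M0: "\<And>x. x \<in> cball 0 R \<Longrightarrow> norm (g x) \<le> M0"
    using compact_imp_bounded bounded_iff by (metis imageI)
  define M where "M = max M0 0"
  have M: "norm (g x) \<le> M" for x
    using M0[of x] g0[of x] by (cases "norm x > R") (auto simp: M_def)
  have M0: "M \<ge> 0" by (simp add: M_def)
  have lip: "norm (f x - f y) \<le> M * norm (x - y)" for x y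
  proof (rule differentiable_bound[of UNIV f "\<lambda>x h. h \<bullet> g x"])
    show "(f has_derivative (\<lambda>h. h \<bullet> g x)) (at x within UNIV)" for x
      using C1 by (simp add: C1_with_gradient_def gderiv_def)
    show "onorm (\<lambda>h. h \<bullet> g x) \<le> M" for x
    proof (rule onorm_le)
      fix h
      have "norm (h \<bullet> g x) \<le> norm h * norm (g x)" using Cauchy_Schwarz_ineq2 by auto
      also have "\<dots> \<le> norm h * M" using M[of x] by (intro mult_left_mono) auto
      finally show "norm (h \<bullet> g x) \<le> M * norm h" by (simp add: mult.commute)
    qed
  qed auto
  have intf: "integrable lborel f"
  proof -
    have "integrable lborel (\<lambda>x. indicator (cball 0 R) x *\<^sub>R f x)"
      by (rule borel_integrable_compact) (auto intro: continuous_on_subset[OF cf])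
    moreover have "(\<lambda>x. indicator (cball 0 R) x *\<^sub>R f x) = f"
      using supp by (force simp: fun_eq_iff indicator_def)
    ultimately show ?thesis by simp
  qed
  have bf: "f \<in> borel_measurable borel" using cf by (rule borel_measurable_continuous_onI)
  have trans: "integrable lborel (\<lambda>x. f (v + x))" "integral\<^sup>L lborel (\<lambda>x. f (v + x)) = integral\<^sup>L lborel f" for v
  proof -
    show "integrable lborel (\<lambda>x. f (v + x))"
      by (rule integrable_distr[of "(+) v" lborel borel f])
        (use intf in \<open>simp_all add: lborel_distr_plus\<close>)
    show "integral\<^sup>L lborel (\<lambda>x. f (v + x)) = integral\<^sup>L lborel f"
      using integral_distr[of "(+) v" lborel borel f] bf by (simp add: lborel_distr_plus)
  qed
  define q where "q n x = (f (inverse (real (Suc n)) *\<^sub>R b + x) - f x) * real (Suc n)" for n x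
  have q: "integrable lborel (q n)" "integral\<^sup>L lborel (q n) = 0" for n
    unfolding q_def using trans intf by auto
  define w where "w x = (M * norm b) * indicator (cball 0 (R + norm b)) x" for x :: 'a
  have w: "integrable lborel w"
    unfolding w_def by (intro integrable_mult_right integrable_real_indicator) (use emeasure_bounded_finite[OF bounded_cball[of "0::'a" "R + norm b"]] in \<open>auto simp: less_top\<close>)
  have qw: "norm (q n x) \<le> w x" for n x
  proof (cases "norm x \<le> R + norm b")
    case True
    have "norm (q n x) = norm (f (inverse (real (Suc n)) *\<^sub>R b + x) - f x) * real (Suc n)"
      by (simp add: q_def abs_mult)
    also have "\<dots> \<le> (M * norm (inverse (real (Suc n)) *\<^sub>R b)) * real (Suc n)"
      using lip[of "inverse (real (Suc n)) *\<^sub>R b + x" x] by (intro mult_right_mono) auto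
    also have "\<dots> = M * norm b" by (simp add: field_simps)
    finally show ?thesis using True by (simp add: w_def)
  next
    case False
    have "norm (inverse (real (Suc n)) *\<^sub>R b) \<le> norm b"
      by (simp add: field_simps mult_left_le)
    moreover have "norm x \<le> norm (inverse (real (Suc n)) *\<^sub>R b + x) + norm (inverse (real (Suc n)) *\<^sub>R b)"
      by (metis add.commute add_diff_cancel_right' norm_triangle_sub norm_triangle_ineq4)
    ultimately have "norm (inverse (real (Suc n)) *\<^sub>R b + x) > R" using False by linarith
    moreover have "norm x > R" using False by (metis add.commute add_increasing norm_ge_zero not_le)
    ultimately show ?thesis using False by (simp add: q_def w_def supp)
  qed
  have lim: "(\<lambda>n. q n x) \<longlonglongrightarrow> g x \<bullet> b" for x
  proof -
    have "(f has_derivative (\<lambda>h. h \<bullet> g x)) (at x)"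
      using C1 by (simp add: C1_with_gradient_def gderiv_def)
    moreover have "((\<lambda>t. x + t *\<^sub>R b) has_derivative (\<lambda>t. t *\<^sub>R b)) (at 0)"
      by (auto intro!: derivative_eq_intros)
    ultimately have "((\<lambda>t. f (x + t *\<^sub>R b)) has_derivative (\<lambda>t. (t *\<^sub>R b) \<bullet> g x)) (at 0)"
      using has_derivative_compose[of "\<lambda>t. x + t *\<^sub>R b" "\<lambda>t. t *\<^sub>R b" 0 UNIV f "\<lambda>h. h \<bullet> g x"] by simp
    then have "((\<lambda>t. f (x + t *\<^sub>R b)) has_real_derivative g x \<bullet> b) (at 0)"
      by (simp add: has_field_derivative_def inner_commute mult_commute_abs)
    then have "((\<lambda>t. (f (x + t *\<^sub>R b) - f x) / t) \<longlongrightarrow> g x \<bullet> b) (at 0)"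
      by (simp add: has_field_derivative_iff)
    moreover have "filterlim (\<lambda>n. inverse (real (Suc n))) (at 0) sequentially"
      unfolding filterlim_at using LIMSEQ_inverse_real_of_nat by auto
    ultimately have "(\<lambda>n. (f (x + inverse (real (Suc n)) *\<^sub>R b) - f x) / inverse (real (Suc n))) \<longlonglongrightarrow> g x \<bullet> b"
      by (rule filterlim_compose)
    then show ?thesis unfolding q_def by (simp add: field_simps add.commute)
  qed
  have bg: "(\<lambda>x. g x \<bullet> b) \<in> borel_measurable borel"
    using cg by (intro borel_measurable_continuous_onI continuous_intros)
  have bq: "q n \<in> borel_measurable lborel" for n
    using borel_measurable_integrable[OF q(1)] .
  have "integrable lborel (\<lambda>x. g x \<bullet> b)"
    by (rule integrable_dominated_convergence[where s=q and w=w])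
      (use bg bq lim w qw in auto)
  moreover have "(\<lambda>n. integral\<^sup>L lborel (q n)) \<longlonglongrightarrow> integral\<^sup>L lborel (\<lambda>x. g x \<bullet> b)"
    by (rule integral_dominated_convergence[where w=w])
      (use bg bq lim w qw in auto)
  then have "integral\<^sup>L lborel (\<lambda>x. g x \<bullet> b) = 0" using q LIMSEQ_unique tendsto_const by (metis (lifting) ext)
  ultimately show ?thesis by (metis has_integral_integral_lborel)
qed

section \<open>Integrable fluxes and cutoffs in thin layers\<close>

lemma C1_field_continuous: "C1_field F D \<Longrightarrow> continuous_on D F"
  unfolding C1_field_def
  by (meson continuous_at_imp_continuous_on differentiable_imp_continuous_within)

lemma C1_field_continuous_divergence: "C1_field F D \<Longrightarrow> continuous_on D (divergence F)"
  unfolding C1_field_def divergence_def by (intro continuous_intros) auto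

lemma C1_field_continuous_grad: "C1_field f D \<Longrightarrow> continuous_on D (grad f)"
  unfolding C1_field_def grad_def by (intro continuous_intros) auto

lemma GDERIV_grad:
  assumes "f differentiable (at x)"
  shows "GDERIV f x :> grad f x"
proof -
  interpret linear "frechet_derivative f (at x)"
    using assms frechet_derivative_works has_derivative_linear by blast
  have "frechet_derivative f (at x) h = h \<bullet> grad f x" for h
  proof -
    have "frechet_derivative f (at x) h = frechet_derivative f (at x) (\<Sum>b\<in>Basis. (h \<bullet> b) *\<^sub>R b)"
      by (simp add: euclidean_representation)
    also have "\<dots> = (\<Sum>b\<in>Basis. (h \<bullet> b) * frechet_derivative f (at x) b)"
      by (simp add: sum scale)
    finally show ?thesis by (simp add: grad_def inner_sum_right mult.commute)
  qed
  then have "frechet_derivative f (at x) = (\<lambda>h. h \<bullet> grad f x)" by blast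
  then show ?thesis
    using assms frechet_derivative_works unfolding gderiv_def by metis
qed

lemma GDERIV_imp_continuous_on: "(\<And>x. x \<in> A \<Longrightarrow> GDERIV f x :> g x) \<Longrightarrow> continuous_on A f"
  unfolding gderiv_def by (intro continuous_at_imp_continuous_on ballI has_derivative_continuous) auto

lemma has_derivative_scaleR_field:
  fixes F :: "'a::euclidean_space \<Rightarrow> 'a"
  assumes "GDERIV \<eta> x :> g" "F differentiable (at x)"
  shows "((\<lambda>y. \<eta> y *\<^sub>R F y) has_derivative
           (\<lambda>h. \<eta> x *\<^sub>R frechet_derivative F (at x) h + (h \<bullet> g) *\<^sub>R F x)) (at x)"
  using assms unfolding gderiv_def frechet_derivative_works
  by (rule has_derivative_scaleR)

lemma divergence_scaleR_field:
  fixes F :: "'a::euclidean_space \<Rightarrow> 'a"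
  assumes "GDERIV \<eta> x :> g" "F differentiable (at x)"
  shows "divergence (\<lambda>y. \<eta> y *\<^sub>R F y) x = \<eta> x * divergence F x + g \<bullet> F x"
proof -
  have "divergence (\<lambda>y. \<eta> y *\<^sub>R F y) x =
      (\<Sum>b\<in>Basis. (\<eta> x *\<^sub>R frechet_derivative F (at x) b + (b \<bullet> g) *\<^sub>R F x) \<bullet> b)"
    unfolding divergence_def
    using frechet_derivative_at[OF has_derivative_scaleR_field[OF assms], symmetric] by simp
  also have "\<dots> = \<eta> x * divergence F x + (\<Sum>b\<in>Basis. (g \<bullet> b) * (F x \<bullet> b))"
    by (simp add: divergence_def inner_add_left sum.distrib sum_distrib_left inner_commute[of _ g]
        inner_commute[of "F x"])
  also have "(\<Sum>b\<in>Basis. (g \<bullet> b) * (F x \<bullet> b)) = g \<bullet> F x"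
    by (rule euclidean_inner[symmetric])
  finally show ?thesis .
qed

lemma C1_field_scaleR:
  fixes F :: "'a::euclidean_space \<Rightarrow> 'a"
  assumes \<eta>: "\<And>x. x \<in> D \<Longrightarrow> GDERIV \<eta> x :> g x" "continuous_on D g" and F: "C1_field F D"
  shows "C1_field (\<lambda>y. \<eta> y *\<^sub>R F y) D"
  unfolding C1_field_def
proof (intro conjI ballI allI)
  note d = has_derivative_scaleR_field[OF \<eta>(1)]
  show "(\<lambda>y. \<eta> y *\<^sub>R F y) differentiable (at x)" if "x \<in> D" for x
    using d[OF that] F that unfolding C1_field_def by (meson differentiableI)
  have cF: "continuous_on D (\<lambda>x. frechet_derivative F (at x) h)" for h
    using F unfolding C1_field_def by blast
  have "continuous_on D \<eta>"
    by (rule GDERIV_imp_continuous_on) (rule \<eta>(1))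
  then have "continuous_on D (\<lambda>x. \<eta> x *\<^sub>R frechet_derivative F (at x) h + (h \<bullet> g x) *\<^sub>R F x)" for h
    by (intro continuous_on_add continuous_on_scaleR continuous_on_inner continuous_on_const
        C1_field_continuous[OF F] \<eta>(2) cF)
  moreover have "frechet_derivative (\<lambda>y. \<eta> y *\<^sub>R F y) (at x) h =
      \<eta> x *\<^sub>R frechet_derivative F (at x) h + (h \<bullet> g x) *\<^sub>R F x" if "x \<in> D" for x h
    by (rule fun_cong[OF frechet_derivative_at[OF d[OF that], symmetric]])
      (use F that in \<open>auto simp: C1_field_def\<close>)
  ultimately show "continuous_on D (\<lambda>x. frechet_derivative (\<lambda>y. \<eta> y *\<^sub>R F y) (at x) h)" for h
    by (simp cong: continuous_on_cong)
qed

text \<open>Extended by zero, the field is continuously differentiable on the whole space, and each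
term of the divergence is a partial derivative of a compactly supported function.\<close>

lemma integral_divergence_compact_support:
  fixes G :: "'a::euclidean_space \<Rightarrow> 'a"
  assumes D: "open D" and K: "compact K" "K \<subseteq> D" and G: "C1_field G D"
    and supp: "\<And>x. x \<in> D - K \<Longrightarrow> G x = 0"
  shows "(divergence G has_integral 0) D"
proof -
  define H where "H x = (if x \<in> D then G x else 0)" for x
  define H' where "H' x h = (if x \<in> D then frechet_derivative G (at x) h else 0)" for x h
  have U: "UNIV = D \<union> - K" "open (- K)" using K by (auto simp: compact_imp_closed open_Compl)
  have dH_D: "(H has_derivative H' x) (at x)" if "x \<in> D" for x
  proof (rule has_derivative_transform_within_open[OF _ D that])
    show "(G has_derivative H' x) (at x)"
      using G that unfolding C1_field_def frechet_derivative_works H'_def[abs_def] by auto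
  qed (simp add: H_def)
  have dH_K: "(H has_derivative (\<lambda>_. 0)) (at x)" if "x \<in> - K" for x
    by (rule has_derivative_transform_within_open[OF has_derivative_const U(2) that])
      (auto simp: H_def supp)
  have dH: "(H has_derivative H' x) (at x)" for x
  proof (cases "x \<in> D")
    case False
    then have "x \<in> - K" "H' x = (\<lambda>_. 0)" using K by (auto simp: H'_def)
    then show ?thesis using dH_K by simp
  qed (rule dH_D)
  have H'0: "H' x = (\<lambda>_. 0)" if "x \<in> - K" for x
    using dH dH_K[OF that] has_derivative_unique by blast
  have cH': "continuous_on UNIV (\<lambda>x. H' x h)" for h
    unfolding U(1)
  proof (rule continuous_on_open_Un[OF D U(2)])
    show "continuous_on D (\<lambda>x. H' x h)"
      using G unfolding C1_field_def by (simp add: H'_def cong: continuous_on_cong)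
    show "continuous_on (- K) (\<lambda>x. H' x h)"
      by (rule continuous_on_eq[of _ "\<lambda>_. 0"]) (simp_all add: H'0)
  qed
  obtain R where R: "\<And>x. x \<in> K \<Longrightarrow> norm x \<le> R"
    using compact_imp_bounded[OF K(1)] bounded_iff by blast
  have part: "((\<lambda>x. H' x b \<bullet> b) has_integral 0) UNIV" if "b \<in> Basis" for b :: 'a
  proof -
    define gb where "gb x = grad (\<lambda>y. H y \<bullet> b) x" for x
    have d: "((\<lambda>y. H y \<bullet> b) has_derivative (\<lambda>h. H' x h \<bullet> b)) (at x)" for x
      by (rule has_derivative_inner_left[OF dH])
    have gb_eq: "gb x = (\<Sum>c\<in>Basis. (H' x c \<bullet> b) *\<^sub>R c)" for x
      unfolding gb_def grad_def frechet_derivative_at[OF d, symmetric] ..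
    have "C1_with_gradient (\<lambda>y. H y \<bullet> b) gb"
      unfolding C1_with_gradient_def
    proof safe
      show "GDERIV (\<lambda>y. H y \<bullet> b) x :> gb x" for x
        unfolding gb_def using d GDERIV_grad differentiable_def by blast
      show "continuous_on UNIV gb"
        unfolding gb_eq[abs_def] by (intro continuous_intros cH')
    qed
    moreover have "H x \<bullet> b = 0" if "norm x > R" for x
      using R[of x] supp[of x] that by (cases "x \<in> K") (auto simp: H_def)
    ultimately have "((\<lambda>x. gb x \<bullet> b) has_integral 0) UNIV"
      by (rule integral_partial_derivative_eq_0)
    moreover have "gb x \<bullet> b = H' x b \<bullet> b" for x
      unfolding gb_eq using that
      by (simp add: inner_sum_left inner_Basis if_distrib sum.delta cong: if_cong)
    ultimately show ?thesis by simp
  qed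
  have "((\<lambda>x. \<Sum>b\<in>Basis. H' x b \<bullet> b) has_integral (\<Sum>b\<in>(Basis::'a set). 0)) UNIV"
    by (rule has_integral_sum) (use part in auto)
  moreover have "(\<lambda>x. \<Sum>b\<in>Basis. H' x b \<bullet> b) = (\<lambda>x. if x \<in> D then divergence G x else 0)"
    by (auto simp: H'_def divergence_def fun_eq_iff)
  ultimately show ?thesis by (simp add: has_integral_restrict_UNIV)
qed

text \<open>All integrands on the domain are continuous on an open set, so that a bound is enough for integrability.\<close>

lemma continuous_bounded_absolutely_integrable:
  fixes f :: "'a::euclidean_space \<Rightarrow> 'b::euclidean_space"
  assumes "open D" "continuous_on D f" "h integrable_on D" "\<And>x. x \<in> D \<Longrightarrow> norm (f x) \<le> h x"
  shows "f absolutely_integrable_on D"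
proof (rule measurable_bounded_by_integrable_imp_absolutely_integrable)
  show "f \<in> borel_measurable (lebesgue_on D)" "D \<in> sets lebesgue"
    using assms by (auto intro!: continuous_imp_measurable_on_sets_lebesgue)
qed (use assms in auto)

text \<open>Only the divergence is required to be integrable: near a slit the single partial derivatives of a
conductive flux need not be.\<close>

locale flux_field =
  fixes D :: "'a::euclidean_space set" and F :: "'a \<Rightarrow> 'a"
  assumes open_D: "open D" and bounded_D: "bounded D" and C1_F: "C1_field F D"
    and int_F: "F absolutely_integrable_on D"
    and int_div: "divergence F absolutely_integrable_on D"
begin

lemma test_bounded:
  assumes "C1_with_gradient \<eta> g"
  obtains B where "(B::real) \<ge> 0" "\<And>x. x \<in> closure D \<Longrightarrow> \<bar>\<eta> x\<bar> \<le> B" "\<And>x. x \<in> closure D \<Longrightarrow> norm (g x) \<le> B"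
proof -
  have c: "compact (closure D)" using bounded_D by (simp add: compact_closure)
  have "compact (\<eta> ` closure D)" "compact (g ` closure D)"
    using assms C1_with_gradient_continuous[OF assms] c
    unfolding C1_with_gradient_def
    by (metis compact_continuous_image continuous_on_subset subset_UNIV)+
  then obtain B1 B2 where "\<forall>x\<in>closure D. norm (\<eta> x) \<le> B1" "\<forall>x\<in>closure D. norm (g x) \<le> B2"
    using compact_imp_bounded by (metis bounded_iff imageI)
  then have "\<bar>\<eta> x\<bar> \<le> max 0 (max B1 B2)" "norm (g x) \<le> max 0 (max B1 B2)" if "x \<in> closure D" for x
    using that by (force simp: le_max_iff_disj)+
  then show thesis by (rule that[rotated]) auto
qed

lemma test_integrand_absolutely_integrable:
  assumes "C1_with_gradient \<eta> g"
  shows "(\<lambda>x. \<eta> x * divergence F x + g x \<bullet> F x) absolutely_integrable_on D"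
proof -
  obtain B where B: "B \<ge> 0" "\<And>x. x \<in> closure D \<Longrightarrow> \<bar>\<eta> x\<bar> \<le> B" "\<And>x. x \<in> closure D \<Longrightarrow> norm (g x) \<le> B"
    using test_bounded[OF assms] by metis
  have int: "(\<lambda>x. B * norm (divergence F x) + B * norm (F x)) integrable_on D"
    using int_F int_div unfolding absolutely_integrable_on_def
    by (intro integrable_add integrable_on_mult_right) auto
  show ?thesis
  proof (rule continuous_bounded_absolutely_integrable[OF open_D _ int])
    show "continuous_on D (\<lambda>x. \<eta> x * divergence F x + g x \<bullet> F x)"
      using assms C1_with_gradient_continuous[OF assms]
      by (intro continuous_on_add continuous_on_mult continuous_on_inner
            C1_field_continuous_divergence[OF C1_F] C1_field_continuous[OF C1_F])
        (auto simp: C1_with_gradient_def intro: continuous_on_subset)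
    fix x assume "x \<in> D"
    then have x: "x \<in> closure D" using closure_subset by blast
    have "norm (\<eta> x * divergence F x + g x \<bullet> F x) \<le> \<bar>\<eta> x\<bar> * norm (divergence F x) + norm (g x) * norm (F x)"
      using abs_triangle_ineq[of "\<eta> x * divergence F x" "g x \<bullet> F x"] Cauchy_Schwarz_ineq2[of "g x" "F x"]
      by (simp add: abs_mult)
    also have "\<dots> \<le> B * norm (divergence F x) + B * norm (F x)"
      using B x by (intro add_mono mult_right_mono) auto
    finally show "norm (\<eta> x * divergence F x + g x \<bullet> F x) \<le> B * norm (divergence F x) + B * norm (F x)" .
  qed
qed

lemma integral_test_compact_support:
  assumes \<eta>: "C1_with_gradient \<eta> g" and K: "compact K" "K \<subseteq> D" "\<And>x. x \<in> D - K \<Longrightarrow> \<eta> x = 0"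
  shows "((\<lambda>x. \<eta> x * divergence F x + g x \<bullet> F x) has_integral 0) D"
proof -
  have d: "\<And>x. x \<in> D \<Longrightarrow> GDERIV \<eta> x :> g x" "continuous_on D g"
    using \<eta> by (auto simp: C1_with_gradient_def intro: continuous_on_subset)
  have "(divergence (\<lambda>x. \<eta> x *\<^sub>R F x) has_integral 0) D"
    by (rule integral_divergence_compact_support[OF open_D K(1,2) C1_field_scaleR[OF d C1_F]])
      (use K(3) in auto)
  moreover have "divergence (\<lambda>x. \<eta> x *\<^sub>R F x) x = \<eta> x * divergence F x + g x \<bullet> F x" if "x \<in> D" for x
    using divergence_scaleR_field[OF d(1)[OF that]] C1_F that by (auto simp: C1_field_def)
  ultimately show ?thesis by (simp cong: has_integral_cong)
qed

text \<open>Cutting a test function off in a thin layer around the zero set of \<open>\<psi>\<close> leaves a compact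
  support in \<open>D\<close>. The gradient of the cutoff then accounts for the whole flux through the zero set.
  The two forms of \<open>T\<close> describe a slit, with \<open>D\<close> on both sides of it, and a boundary.\<close>

lemma layer_limit:
  assumes \<eta>: "C1_with_gradient \<eta> g" and supp: "\<And>x. norm (x - p) > r \<Longrightarrow> \<eta> x = 0" and r: "r < R"
    and \<psi>: "\<And>x. x \<in> ball p R \<Longrightarrow> GDERIV \<psi> x :> g\<psi> x" "continuous_on (ball p R) g\<psi>"
    and T: "T = - {0::real} \<or> T = {..<0}" "\<And>x. x \<in> ball p R \<Longrightarrow> x \<in> D \<longleftrightarrow> \<psi> x \<in> T"
    and S: "\<And>t. (S has_real_derivative S' t) (at t)" "continuous_on UNIV S'"
      "\<And>t. \<bar>t\<bar> \<le> 1 \<Longrightarrow> S t = 0" "\<And>t. \<bar>t\<bar> \<ge> 2 \<Longrightarrow> S t = 1" "\<And>t. \<bar>S t\<bar> \<le> 1"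
  defines "q \<equiv> \<lambda>n x. if x \<in> ball p R then \<eta> x * (real (Suc n) * S' (real (Suc n) * \<psi> x)) * (g\<psi> x \<bullet> F x) else 0"
  shows "q n integrable_on D"
    and "(\<lambda>n. integral D (q n)) \<longlonglongrightarrow> - integral D (\<lambda>x. \<eta> x * divergence F x + g x \<bullet> F x)"
proof -
  define A where "A x = \<eta> x * divergence F x + g x \<bullet> F x" for x
  define s where "s n x = (if x \<in> ball p R then S (real (Suc n) * \<psi> x) else 0)" for n x
  define \<eta>s where "\<eta>s n x = \<eta> x * s n x" for n x
  define gs where "gs n x = (if x \<in> ball p R then s n x *\<^sub>R g x
      + (\<eta> x * (real (Suc n) * S' (real (Suc n) * \<psi> x))) *\<^sub>R g\<psi> x else 0)" for n x
  have gx: "GDERIV \<eta> x :> g x" for x using \<eta> by (simp add: C1_with_gradient_def)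
  have c\<psi>: "continuous_on (ball p R) \<psi>"
    by (rule GDERIV_imp_continuous_on) (rule \<psi>(1))
  have cS: "continuous_on UNIV S"
    by (intro continuous_at_imp_continuous_on ballI DERIV_isCont[OF S(1)])
  have U: "UNIV = ball p R \<union> - cball p r" "open (- cball p r)"
    using r by auto
  have g0: "g x = 0" if "x \<in> - cball p r" for x
    by (rule C1_with_gradient_zero_outside[OF \<eta> U(2) _ that])
      (auto intro!: supp simp: dist_norm norm_minus_commute)
  have e0: "\<eta> x = 0" if "x \<in> - cball p r" for x
    using that by (auto intro!: supp simp: dist_norm norm_minus_commute)
  have C1: "C1_with_gradient (\<eta>s n) (gs n)" for n
    unfolding C1_with_gradient_def
  proof safe
    fix x
    show "GDERIV (\<eta>s n) x :> gs n x"
    proof (cases "x \<in> ball p R")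
      case True
      have "GDERIV (\<lambda>y. real (Suc n) * \<psi> y) x :> real (Suc n) *\<^sub>R g\<psi> x"
        using GDERIV_mult[OF GDERIV_const \<psi>(1)[OF True]] by simp
      from GDERIV_mult[OF gx GDERIV_DERIV_compose[OF this S(1)]]
      have "GDERIV (\<lambda>y. \<eta> y * S (real (Suc n) * \<psi> y)) x :> gs n x"
        using True by (simp add: gs_def s_def algebra_simps)
      then show ?thesis
        unfolding gderiv_def
        by (rule has_derivative_transform_within_open[of _ _ _ _ "ball p R"])
          (use True in \<open>auto simp: \<eta>s_def s_def\<close>)
    next
      case False
      then have x: "x \<in> - cball p r" using U(1) by blast
      have "gs n x = 0" using False by (simp add: gs_def)
      then show ?thesis
        unfolding gderiv_def using e0
        by (auto intro: has_derivative_transform_within_open[OF has_derivative_const U(2) x, of 0] simp: \<eta>s_def)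
    qed
  next
    show "continuous_on UNIV (gs n)"
      unfolding U(1)
    proof (rule continuous_on_open_Un[OF _ U(2)])
      have "continuous_on (ball p R) (\<lambda>x. S (real (Suc n) * \<psi> x) *\<^sub>R g x
          + (\<eta> x * (real (Suc n) * S' (real (Suc n) * \<psi> x))) *\<^sub>R g\<psi> x)"
        using \<eta> C1_with_gradient_continuous[OF \<eta>]
        by (intro continuous_intros \<psi>(2) continuous_on_compose2[OF cS] continuous_on_compose2[OF S(2)] c\<psi>)
          (auto simp: C1_with_gradient_def intro: continuous_on_subset)
      then show "continuous_on (ball p R) (gs n)"
        by (rule continuous_on_eq) (simp add: gs_def s_def)
      show "continuous_on (- cball p r) (gs n)"
        by (rule continuous_on_eq[of _ "\<lambda>_. 0"]) (simp_all add: gs_def g0 e0)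
    qed simp
  qed
  have zero: "((\<lambda>x. \<eta>s n x * divergence F x + gs n x \<bullet> F x) has_integral 0) D" for n
  proof (rule integral_test_compact_support[OF C1])
    define T' where "T' = T \<inter> {t. \<bar>t\<bar> \<ge> inverse (real (Suc n))}"
    have ip: "inverse (real (Suc n)) > 0" by simp
    have "T' = {inverse (real (Suc n))..} \<union> {..- inverse (real (Suc n))}" if "T = - {0}"
      using that ip unfolding T'_def by (auto simp: abs_if)
    moreover have "T' = {..- inverse (real (Suc n))}" if "T = {..<0}"
    proof (intro equalityI subsetI)
      fix t assume "t \<in> {..- inverse (real (Suc n))}"
      then have "t \<le> - inverse (real (Suc n))" by simp
      moreover from this have "t < 0" using ip by linarith
      ultimately show "t \<in> T'" using that by (simp add: T'_def)
    qed (use that in \<open>auto simp: T'_def\<close>)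
    ultimately have T'c: "closed T'" using T(1) by (auto intro: closed_Un)
    define K where "K = {x \<in> cball p r. \<psi> x \<in> T'}"
    have sub: "cball p r \<subseteq> ball p R" using r by auto
    have "closed K"
      unfolding K_def using continuous_closed_preimage[OF continuous_on_subset[OF c\<psi> sub] closed_cball T'c]
      by (simp add: vimage_def Int_def)
    then show "compact K"
      using bounded_subset[OF bounded_cball, of K p r] unfolding compact_eq_bounded_closed
      by (auto simp: K_def subset_eq)
    show "K \<subseteq> D" unfolding K_def T'_def using T(2) sub by blast
    fix x assume x: "x \<in> D - K"
    show "\<eta>s n x = 0"
    proof (cases "x \<in> cball p r")
      case True
      then have "\<psi> x \<in> T" "\<psi> x \<notin> T'" using x T(2)[of x] sub by (auto simp: K_def)
      then have "\<bar>\<psi> x\<bar> < inverse (real (Suc n))" by (auto simp: T'_def)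
      then have "real (Suc n) * \<bar>\<psi> x\<bar> < 1" by (simp add: field_simps)
      then have "\<bar>real (Suc n) * \<psi> x\<bar> \<le> 1"
        by (simp add: abs_mult del: of_nat_Suc)
      then show ?thesis using S(3) by (simp add: \<eta>s_def s_def)
    qed (use e0 in \<open>auto simp: \<eta>s_def\<close>)
  qed
  have eq: "\<eta>s n x * divergence F x + gs n x \<bullet> F x = s n x * A x + q n x" for n x
    by (auto simp: \<eta>s_def gs_def s_def A_def q_def algebra_simps inner_add_left)
  have A: "A absolutely_integrable_on D"
    unfolding A_def by (rule test_integrand_absolutely_integrable[OF \<eta>])
  have A0: "A x = 0" if "x \<notin> ball p R" for x
    using that U(1) g0[of x] e0[of x] unfolding A_def by auto
  have cA: "continuous_on D A"
    unfolding A_def using \<eta> C1_with_gradient_continuous[OF \<eta>]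
    by (intro continuous_on_add continuous_on_mult continuous_on_inner
            C1_field_continuous_divergence[OF C1_F] C1_field_continuous[OF C1_F])
      (auto simp: C1_with_gradient_def intro: continuous_on_subset)
  have sA: "(\<lambda>x. s n x * A x) integrable_on D" for n
  proof -
    have "(\<lambda>x. s n x * A x) absolutely_integrable_on D"
    proof (rule continuous_bounded_absolutely_integrable[OF open_D])
      show "(\<lambda>x. norm (A x)) integrable_on D" using A by (simp add: absolutely_integrable_on_def)
      show "norm (s n x * A x) \<le> norm (A x)" for x
        using S(5) by (auto simp: s_def abs_mult mult_left_le_one_le)
      have "continuous_on (ball p R \<inter> D \<union> - cball p r \<inter> D) (\<lambda>x. s n x * A x)"
      proof (rule continuous_on_open_Un)
        have "continuous_on (ball p R \<inter> D) (\<lambda>x. S (real (Suc n) * \<psi> x) * A x)"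
          by (intro continuous_intros continuous_on_subset[OF cA] continuous_on_compose2[OF cS]
              continuous_on_subset[OF c\<psi>]) auto
        then show "continuous_on (ball p R \<inter> D) (\<lambda>x. s n x * A x)"
          by (rule continuous_on_eq) (simp add: s_def)
        show "continuous_on (- cball p r \<inter> D) (\<lambda>x. s n x * A x)"
          by (rule continuous_on_eq[of _ "\<lambda>_. 0"]) (simp_all add: A_def g0 e0)
      qed (use open_D in auto)
      moreover have "ball p R \<inter> D \<union> - cball p r \<inter> D = D" using U(1) by blast
      ultimately show "continuous_on D (\<lambda>x. s n x * A x)" by simp
    qed
    then show ?thesis by (simp add: absolutely_integrable_on_def)
  qed
  have "((\<lambda>x. (\<eta>s n x * divergence F x + gs n x \<bullet> F x) - s n x * A x) has_integral
      0 - integral D (\<lambda>x. s n x * A x)) D" for n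
    by (rule has_integral_diff[OF zero integrable_integral[OF sA]])
  then have q: "(q n has_integral - integral D (\<lambda>x. s n x * A x)) D" for n
    unfolding eq by simp
  then show "q n integrable_on D" by blast
  have "(\<lambda>n. integral D (\<lambda>x. s n x * A x)) \<longlonglongrightarrow> integral D A"
  proof (rule dominated_convergence(2)[OF sA])
    show "(\<lambda>x. norm (A x)) integrable_on D" using A by (simp add: absolutely_integrable_on_def)
    show "norm (s n x * A x) \<le> norm (A x)" for n x
      using S(5) by (auto simp: s_def abs_mult mult_left_le_one_le)
    fix x assume x: "x \<in> D"
    show "(\<lambda>n. s n x * A x) \<longlonglongrightarrow> A x"
    proof (cases "x \<in> ball p R")
      case True
      then have "\<psi> x \<noteq> 0" using T x by auto
      then obtain N where N: "real N > 2 / \<bar>\<psi> x\<bar>" using reals_Archimedean2 by blast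
      have "s n x = 1" if "n \<ge> N" for n
      proof -
        have "2 / \<bar>\<psi> x\<bar> \<le> real (Suc n)" using N that by linarith
        then have "\<bar>real (Suc n) * \<psi> x\<bar> \<ge> 2" using \<open>\<psi> x \<noteq> 0\<close> by (simp add: abs_mult field_simps)
        then show ?thesis using S(4) True by (simp add: s_def)
      qed
      then have "\<forall>\<^sub>F n in sequentially. s n x * A x = A x"
        using eventually_sequentially by force
      then show ?thesis by (rule tendsto_eventually)
    qed (simp add: A0)
  qed
  then have "(\<lambda>n. - integral D (\<lambda>x. s n x * A x)) \<longlonglongrightarrow> - integral D A" by (rule tendsto_minus)
  then show "(\<lambda>n. integral D (q n)) \<longlonglongrightarrow> - integral D (\<lambda>x. \<eta> x * divergence F x + g x \<bullet> F x)"
    unfolding integral_unique[OF q] by (simp add: A_def[abs_def])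
qed

end

section \<open>The slit and its charts\<close>

text \<open>Rotation by a right angle; it carries the tangent to \<open>normal_plus\<close>.\<close>

definition rot :: "real^2 \<Rightarrow> real^2" where
  "rot v = vector [- (v $ 2), v $ 1]"

lemma rot_nth [simp]: "rot v $ 1 = - (v $ 2)" "rot v $ 2 = v $ 1"
  by (simp_all add: rot_def)

lemma inner_real2: "(v::real^2) \<bullet> w = v $ 1 * w $ 1 + v $ 2 * w $ 2"
  by (simp add: inner_vec_def sum_2)

lemma rot_simps:
  "rot (v + w) = rot v + rot w" "rot (v - w) = rot v - rot w" "rot (c *\<^sub>R v) = c *\<^sub>R rot v"
  "rot v \<bullet> rot w = v \<bullet> w" "v \<bullet> rot v = 0" "rot v \<bullet> v = 0" "norm (rot v) = norm v"
  by (simp_all add: vec_eq_iff forall_2 inner_real2 norm_eq_sqrt_inner)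

lemma orthonormal_decomposition:
  fixes t :: "real^2"
  assumes "norm t = 1"
  shows "x = (x \<bullet> t) *\<^sub>R t + (x \<bullet> rot t) *\<^sub>R rot t"
proof -
  have 1: "t $ 1 * t $ 1 + t $ 2 * t $ 2 = 1"
    using assms by (simp add: norm_eq_sqrt_inner inner_real2)
  have "x $ 1 * (t $ 1 * t $ 1 + t $ 2 * t $ 2) = (x \<bullet> t) * t $ 1 - (x \<bullet> rot t) * t $ 2"
    "x $ 2 * (t $ 1 * t $ 1 + t $ 2 * t $ 2) = (x \<bullet> t) * t $ 2 + (x \<bullet> rot t) * t $ 1"
    by (simp_all add: inner_real2 algebra_simps)
  then show ?thesis unfolding 1 by (simp add: vec_eq_iff forall_2)
qed

lemma continuous_on_rot: "continuous_on A f \<Longrightarrow> continuous_on A (\<lambda>x. rot (f x))"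
proof -
  assume "continuous_on A f"
  moreover have "linear rot" by (rule linearI) (simp_all add: rot_simps)
  then have "continuous_on UNIV rot" by (simp add: linear_continuous_on linear_conv_bounded_linear)
  ultimately show ?thesis by (intro continuous_on_compose2[of UNIV rot A f]) auto
qed

lemma normal_plus_eq_rot: "normal_plus \<gamma> s = rot (unit_tangent \<gamma> s)"
  by (simp add: normal_plus_def rot_def)

text \<open>The two sides of the slit are told apart by a sign: the side \<open>\<sigma> = 1\<close> is the one to which the
  normal \<open>normal_plus\<close> points.\<close>

definition one_sided_value :: "(real \<Rightarrow> real^2) \<Rightarrow> (real^2 \<Rightarrow> 'b::t2_space) \<Rightarrow> real \<Rightarrow> real \<Rightarrow> 'b" where
  "one_sided_value \<gamma> g \<sigma> s = side_value (\<gamma> s) (- (\<sigma> *\<^sub>R normal_plus \<gamma> s)) g"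

lemma one_sided_value_plus_minus:
  "side_value (\<gamma> s) (normal_plus \<gamma> s) g = one_sided_value \<gamma> g (-1) s"
  "side_value (\<gamma> s) (normal_minus \<gamma> s) g = one_sided_value \<gamma> g 1 s"
  by (simp_all add: one_sided_value_def normal_minus_def)

text \<open>The limit along the normals is joint in the parameter and the distance, which makes one-sided values
  continuous along the slit.\<close>

definition side_limit :: "(real \<Rightarrow> real^2) \<Rightarrow> (real^2 \<Rightarrow> 'b::topological_space) \<Rightarrow> real \<Rightarrow> real \<Rightarrow> 'b \<Rightarrow> bool" where
  "side_limit \<gamma> g \<sigma> s l \<longleftrightarrow>
     ((\<lambda>(s, \<epsilon>). g (\<gamma> s + \<epsilon> *\<^sub>R \<sigma> *\<^sub>R normal_plus \<gamma> s)) \<longlongrightarrow> l) (at (s, 0) within UNIV \<times> {0<..})"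

lemma one_sided_value_eqI:
  fixes g :: "real^2 \<Rightarrow> 'b::t2_space"
  assumes "side_limit \<gamma> g \<sigma> s l"
  shows "one_sided_value \<gamma> g \<sigma> s = l"
proof -
  have "filterlim (\<lambda>\<epsilon>::real. (s, \<bar>\<epsilon>\<bar>)) (at (s, 0) within UNIV \<times> {0<..}) (at 0)"
    unfolding filterlim_at
  proof
    show "\<forall>\<^sub>F \<epsilon> in at (0::real). (s, \<bar>\<epsilon>\<bar>) \<in> UNIV \<times> {0<..} \<and> (s, \<bar>\<epsilon>\<bar>) \<noteq> (s, 0)"
      by (auto simp: eventually_at intro: exI[of _ 1])
    show "((\<lambda>\<epsilon>. (s, \<bar>\<epsilon>\<bar>)) \<longlongrightarrow> (s, 0)) (at (0::real))"
      by (auto intro!: tendsto_eq_intros)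
  qed
  from filterlim_compose[OF assms[unfolded side_limit_def] this]
  have "((\<lambda>\<epsilon>. g (\<gamma> s - \<bar>\<epsilon>\<bar> *\<^sub>R (- (\<sigma> *\<^sub>R normal_plus \<gamma> s)))) \<longlongrightarrow> l) (at (0::real))" by simp
  then show ?thesis
    unfolding one_sided_value_def side_value_def by (intro tendsto_Lim) simp_all
qed

lemma has_side_valuesI:
  assumes "\<And>\<sigma> s. \<sigma> = 1 \<or> \<sigma> = -1 \<Longrightarrow> s \<in> {0<..<1} \<Longrightarrow> \<exists>l. side_limit \<gamma> g \<sigma> s l"
  shows "has_side_values \<gamma> g"
  using assms[of "-1"] assms[of 1] unfolding has_side_values_def side_limit_def normal_minus_def
  by auto

lemma side_limit_one_sided_value:
  fixes g :: "real^2 \<Rightarrow> 'b::t2_space"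
  assumes "has_side_values \<gamma> g" "\<sigma> = 1 \<or> \<sigma> = -1" "s \<in> {0<..<1}"
  shows "side_limit \<gamma> g \<sigma> s (one_sided_value \<gamma> g \<sigma> s)"
proof -
  define \<nu> where "\<nu> s = - (\<sigma> *\<^sub>R normal_plus \<gamma> s)" for s
  have "\<nu> \<in> {normal_plus \<gamma>, normal_minus \<gamma>}"
    using assms(2) by (auto simp: \<nu>_def normal_minus_def fun_eq_iff)
  then obtain l where "((\<lambda>(s, \<epsilon>). g (\<gamma> s - \<epsilon> *\<^sub>R \<nu> s)) \<longlongrightarrow> l) (at (s, 0) within UNIV \<times> {0<..})"
    using assms(1,3) unfolding has_side_values_def by meson
  then have "side_limit \<gamma> g \<sigma> s l" by (simp add: side_limit_def \<nu>_def)
  then show ?thesis using one_sided_value_eqI by metis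
qed

lemmas one_sided_limit_joint = side_limit_one_sided_value[unfolded side_limit_def]

text \<open>The value at \<open>s'\<close> is approximated by points whose distance to the slit is as small as desired; these
points are also close to \<open>(s, 0)\<close>, where the joint limit controls the field.\<close>

lemma one_sided_value_continuous:
  fixes g :: "real^2 \<Rightarrow> 'b::real_normed_vector"
  assumes g: "has_side_values \<gamma> g" and \<sigma>: "\<sigma> = 1 \<or> \<sigma> = -1"
  shows "continuous_on {0<..<1} (one_sided_value \<gamma> g \<sigma>)"
  unfolding continuous_on_iff
proof (intro ballI allI impI)
  fix s e :: real assume s: "s \<in> {0<..<1}" and e: "e > 0"
  let ?G = "\<lambda>s \<epsilon>. g (\<gamma> s + \<epsilon> *\<^sub>R \<sigma> *\<^sub>R normal_plus \<gamma> s)"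
  from tendstoD[OF one_sided_limit_joint[OF g \<sigma> s], of "e/2"] e
  obtain d where d: "d > 0" "\<And>y. y \<in> UNIV \<times> {0<..} \<Longrightarrow> 0 < dist y (s, 0) \<Longrightarrow> dist y (s, 0) < d \<Longrightarrow>
      dist (?G (fst y) (snd y)) (one_sided_value \<gamma> g \<sigma> s) < e / 2"
    unfolding eventually_at by (auto simp: case_prod_beta)
  show "\<exists>d>0. \<forall>s'\<in>{0<..<1}. dist s' s < d \<longrightarrow> dist (one_sided_value \<gamma> g \<sigma> s') (one_sided_value \<gamma> g \<sigma> s) < e"
  proof (intro exI conjI ballI impI)
    show "d / 2 > 0" using d by simp
    fix s' assume s': "s' \<in> {0<..<1}" "dist s' s < d / 2"
    from tendstoD[OF one_sided_limit_joint[OF g \<sigma> s'(1)], of "e/2"] e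
    obtain d' where d': "d' > 0" "\<And>y. y \<in> UNIV \<times> {0<..} \<Longrightarrow> 0 < dist y (s', 0) \<Longrightarrow> dist y (s', 0) < d' \<Longrightarrow>
      dist (?G (fst y) (snd y)) (one_sided_value \<gamma> g \<sigma> s') < e / 2"
      unfolding eventually_at by (auto simp: case_prod_beta)
    define \<epsilon> where "\<epsilon> = min (d / 2) (d' / 2)"
    have \<epsilon>: "\<epsilon> > 0" "\<epsilon> \<le> d / 2" "\<epsilon> < d'" using d(1) d'(1) by (auto simp: \<epsilon>_def)
    have 1: "dist (?G s' \<epsilon>) (one_sided_value \<gamma> g \<sigma> s') < e / 2"
      using d'(2)[of "(s', \<epsilon>)"] \<epsilon> by (simp add: dist_Pair_Pair)
    have "dist (s', \<epsilon>) (s, 0) \<le> dist s' s + \<epsilon>"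
      using sqrt_sum_squares_le_sum_abs[of "dist s' s" \<epsilon>] \<epsilon> by (simp add: dist_Pair_Pair)
    moreover have "dist (s', \<epsilon>) (s, 0) > 0" using \<epsilon> by simp
    ultimately have 2: "dist (?G s' \<epsilon>) (one_sided_value \<gamma> g \<sigma> s) < e / 2"
      using d(2)[of "(s', \<epsilon>)"] \<epsilon> s' by simp
    show "dist (one_sided_value \<gamma> g \<sigma> s') (one_sided_value \<gamma> g \<sigma> s) < e"
      using 1 2 dist_triangle_half_r[of "?G s' \<epsilon>" "one_sided_value \<gamma> g \<sigma> s'" e] by blast
  qed
qed

locale slit =
  fixes \<Omega> :: "(real^2) set" and \<gamma> :: "real \<Rightarrow> real^2"
  assumes open_\<Omega>: "open \<Omega>" and vasculature: "vasculature \<Omega> \<gamma>"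
begin

abbreviation "\<gamma>' s \<equiv> vector_derivative \<gamma> (at s)"
abbreviation "tangent \<equiv> unit_tangent \<gamma>"
abbreviation "normal \<equiv> normal_plus \<gamma>"
abbreviation "osv \<equiv> one_sided_value \<gamma>"

definition len :: real where "len = norm (\<gamma>' 0)"

lemma len: "len > 0" "s \<in> {0..1} \<Longrightarrow> norm (\<gamma>' s) = len"
proof -
  obtain L where "L > 0" "\<forall>s\<in>{0..1}. norm (\<gamma>' s) = L"
    using vasculature unfolding vasculature_def by blast
  moreover from this have "len = L" unfolding len_def by auto
  ultimately show "len > 0" "s \<in> {0..1} \<Longrightarrow> norm (\<gamma>' s) = len" by auto
qed

lemma curve_deriv: "s \<in> {0..1} \<Longrightarrow> (\<gamma> has_vector_derivative \<gamma>' s) (at s)"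
  using vasculature unfolding vasculature_def C1_differentiable_on_eq
  by (auto simp: vector_derivative_works)

lemma curve_deriv_continuous: "continuous_on {0..1} \<gamma>'"
  using vasculature unfolding vasculature_def C1_differentiable_on_eq by auto

lemma curve_continuous: "continuous_on {0..1} \<gamma>"
  using vasculature unfolding vasculature_def arc_def path_def by auto

lemma curve_inj: "inj_on \<gamma> {0..1}"
  using vasculature unfolding vasculature_def arc_def by auto

lemma curve_interior: "s \<in> {0<..<1} \<Longrightarrow> \<gamma> s \<in> \<Omega>"
  using vasculature unfolding vasculature_def by auto

lemma tangent_eq: "s \<in> {0..1} \<Longrightarrow> tangent s = (1 / len) *\<^sub>R \<gamma>' s"
  using len by (simp add: unit_tangent_def sgn_div_norm inverse_eq_divide)

lemma curve_deriv_eq: "s \<in> {0..1} \<Longrightarrow> \<gamma>' s = len *\<^sub>R tangent s"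
  using len by (simp add: tangent_eq)

lemma norm_tangent: "s \<in> {0..1} \<Longrightarrow> norm (tangent s) = 1"
  using len by (simp add: tangent_eq)

lemma norm_normal: "s \<in> {0..1} \<Longrightarrow> norm (normal s) = 1"
  by (simp add: normal_plus_eq_rot rot_simps norm_tangent)

lemma tangent_continuous: "continuous_on {0..1} tangent"
proof -
  have "continuous_on {0..1} (\<lambda>s. (1 / len) *\<^sub>R \<gamma>' s)"
    by (intro continuous_intros curve_deriv_continuous)
  then show ?thesis by (rule continuous_on_eq) (simp add: tangent_eq)
qed

lemma normal_continuous: "continuous_on {0..1} normal"
  unfolding normal_plus_eq_rot[abs_def] by (rule continuous_on_rot[OF tangent_continuous])

end

text \<open>Near an interior point of the slit, \<open>\<psi>\<close> is the height above the slit in the direction of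
  the normal at the base point, and \<open>\<tau>\<close> is the parameter of the point of the slit below.\<close>

locale slit_chart = slit +
  fixes s\<^sub>0 a b R :: real and \<psi> \<tau> :: "real^2 \<Rightarrow> real"
  assumes ab: "0 < a" "a < s\<^sub>0" "s\<^sub>0 < b" "b < 1" and R: "R > 0"
    and tangents: "s \<in> {a..b} \<Longrightarrow> s' \<in> {a..b} \<Longrightarrow> tangent s \<bullet> tangent s' \<ge> 1 / 2"
    and ball_sub: "ball (\<gamma> s\<^sub>0) R \<subseteq> \<Omega>"
    and in_chart: "s \<in> {0..1} \<Longrightarrow> \<gamma> s \<in> ball (\<gamma> s\<^sub>0) R \<Longrightarrow> s \<in> {a<..<b}"
    and \<tau>: "x \<in> ball (\<gamma> s\<^sub>0) R \<Longrightarrow> \<tau> x \<in> {a<..<b}"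
    and height: "x \<in> ball (\<gamma> s\<^sub>0) R \<Longrightarrow> x = \<gamma> (\<tau> x) + \<psi> x *\<^sub>R normal s\<^sub>0"
    and \<psi>_deriv: "x \<in> ball (\<gamma> s\<^sub>0) R \<Longrightarrow>
        GDERIV \<psi> x :> (1 / (tangent (\<tau> x) \<bullet> tangent s\<^sub>0)) *\<^sub>R normal (\<tau> x)"
    and \<tau>_continuous: "continuous_on (ball (\<gamma> s\<^sub>0) R) \<tau>"

context slit
begin

lemma abscissa_strict_mono:
  assumes "0 \<le> a" "b \<le> 1" "\<And>s. s \<in> {a..b} \<Longrightarrow> tangent s \<bullet> tangent s\<^sub>0 > 0"
    and "s \<in> {a..b}" "s' \<in> {a..b}" "s < s'"
  shows "(\<gamma> s - p) \<bullet> tangent s\<^sub>0 < (\<gamma> s' - p) \<bullet> tangent s\<^sub>0"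
proof (rule DERIV_pos_imp_increasing[OF assms(6)])
  fix x assume x: "s \<le> x" "x \<le> s'"
  then have x: "x \<in> {a..b}" "x \<in> {0..1}" using assms by auto
  have "((\<lambda>s. (\<gamma> s - p) \<bullet> tangent s\<^sub>0) has_vector_derivative \<gamma>' x \<bullet> tangent s\<^sub>0) (at x)"
    using curve_deriv[OF x(2)] unfolding has_vector_derivative_def
    by (auto intro!: derivative_eq_intros)
  moreover have "\<gamma>' x \<bullet> tangent s\<^sub>0 > 0" using assms(3)[OF x(1)] len by (simp add: curve_deriv_eq[OF x(2)])
  ultimately show "\<exists>y. DERIV (\<lambda>s. (\<gamma> s - p) \<bullet> tangent s\<^sub>0) x :> y \<and> y > 0"
    by (auto simp: has_real_derivative_iff_has_vector_derivative)
qed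

text \<open>Near \<open>s\<^sub>0\<close> the tangent turns by little, so the abscissa in the direction of the tangent at \<open>s\<^sub>0\<close> is a
strictly increasing function of the parameter with continuously differentiable inverse \<open>S\<close>: the slit is a graph. The
arc is injective and compact, so its remaining part keeps a positive distance from the base point.\<close>

lemma exists_chart:
  assumes s0: "s\<^sub>0 \<in> {0<..<1}"
  obtains a b R \<psi> \<tau> where "slit_chart \<Omega> \<gamma> s\<^sub>0 a b R \<psi> \<tau>"
proof -
  have s01: "s\<^sub>0 \<in> {0..1}" using s0 by auto
  define p where "p = \<gamma> s\<^sub>0"
  define t0 where "t0 = tangent s\<^sub>0"
  define n0 where "n0 = normal s\<^sub>0"
  have n0: "n0 = rot t0" by (simp add: n0_def t0_def normal_plus_eq_rot)
  have nt0: "norm t0 = 1" using norm_tangent[OF s01] by (simp add: t0_def)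
  obtain \<delta> where \<delta>: "\<delta> > 0" "\<And>s. s \<in> {0..1} \<Longrightarrow> dist s s\<^sub>0 < \<delta> \<Longrightarrow> dist (tangent s) t0 < 1 / 4"
    using tangent_continuous s01 unfolding continuous_on_iff t0_def
    by (metis zero_less_divide_1_iff zero_less_numeral)
  define \<delta>' where "\<delta>' = min (\<delta> / 2) (min (s\<^sub>0 / 2) ((1 - s\<^sub>0) / 2))"
  define a b where "a = s\<^sub>0 - \<delta>'" and "b = s\<^sub>0 + \<delta>'"
  have \<delta>': "\<delta>' > 0" "\<delta>' < \<delta>" "\<delta>' < s\<^sub>0" "\<delta>' < 1 - s\<^sub>0" using \<delta> s0 by (auto simp: \<delta>'_def min_def)
  have ab: "0 < a" "a < s\<^sub>0" "s\<^sub>0 < b" "b < 1" using \<delta>' by (auto simp: a_def b_def)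
  have sub: "s \<in> {0..1}" if "s \<in> {a..b}" for s using that ab by auto
  have near: "dist (tangent s) t0 < 1 / 4" if "s \<in> {a..b}" for s
    using \<delta>(2)[of s] sub[OF that] that \<delta>' by (auto simp: a_def b_def dist_real_def)
  have tangents: "tangent s \<bullet> tangent s' \<ge> 1 / 2" if "s \<in> {a..b}" "s' \<in> {a..b}" for s s'
  proof -
    have "dist (tangent s) (tangent s') < 1 / 2"
      using near[OF that(1)] near[OF that(2)] dist_triangle2[of "tangent s" "tangent s'" t0] by linarith
    then have "(norm (tangent s - tangent s'))\<^sup>2 \<le> (1 / 2)\<^sup>2"
      by (intro power_mono) (auto simp: dist_norm)
    moreover have "(norm (tangent s - tangent s'))\<^sup>2 = 2 - 2 * (tangent s \<bullet> tangent s')"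
      using norm_tangent[OF sub[OF that(1)]] norm_tangent[OF sub[OF that(2)]]
      by (simp add: power2_norm_eq_inner inner_diff_left inner_diff_right norm_eq_1
          inner_commute[of "tangent s'" "tangent s"])
    ultimately show ?thesis by (simp add: power2_eq_square)
  qed
  have pos: "tangent s \<bullet> t0 > 0" if "s \<in> {a..b}" for s
  proof -
    have "tangent s \<bullet> t0 \<ge> 1 / 2" unfolding t0_def by (rule tangents[OF that]) (use ab in simp)
    then show ?thesis by linarith
  qed
  define f where "f s = (\<gamma> s - p) \<bullet> t0" for s
  have f_mono: "f s < f s'" if "s \<in> {a..b}" "s' \<in> {a..b}" "s < s'" for s s'
    unfolding f_def t0_def
    by (rule abscissa_strict_mono[of a b]) (use ab pos that in \<open>auto simp: t0_def\<close>)
  have f_inj: "inj_on f {a..b}"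
    by (rule inj_onI) (metis f_mono less_irrefl linorder_neqE)
  have f_cont: "continuous_on {a..b} f"
    unfolding f_def using sub by (intro continuous_intros continuous_on_subset[OF curve_continuous]) auto
  have f_deriv: "DERIV f s :> \<gamma>' s \<bullet> t0" if "s \<in> {a..b}" for s
  proof -
    have "(f has_vector_derivative \<gamma>' s \<bullet> t0) (at s)"
      using curve_deriv[OF sub[OF that]] unfolding has_vector_derivative_def f_def[abs_def]
      by (auto intro!: derivative_eq_intros)
    then show ?thesis by (simp add: has_real_derivative_iff_has_vector_derivative)
  qed
  have f0: "f s\<^sub>0 = 0" by (simp add: f_def p_def)
  have fab: "f a < 0" "f b > 0" using f_mono[of a s\<^sub>0] f_mono[of s\<^sub>0 b] ab by (auto simp: f0)
  define S where "S = the_inv_into {a..b} f"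
  have S_f: "S (f s) = s" if "s \<in> {a..b}" for s
    unfolding S_def by (rule the_inv_into_f_f[OF f_inj that])
  have S: "f (S y) = y" "S y \<in> {a<..<b}" if y: "f a < y" "y < f b" for y
  proof -
    obtain s where s: "s \<in> {a..b}" "f s = y"
      using IVT'[of f a y b] f_cont ab y by auto
    then show "f (S y) = y" by (metis S_f)
    show "S y \<in> {a<..<b}" using s S_f[OF s(1)] y by (cases "s = a"; cases "s = b") auto
  qed
  have S_cont: "isCont S y" if "f a < y" "y < f b" for y
  proof -
    have "continuous_on (f ` {a..b}) S"
      by (rule continuous_on_inv[OF f_cont]) (auto simp: S_f)
    moreover have "{f a<..<f b} \<subseteq> f ` {a..b}"
    proof
      fix y assume "y \<in> {f a<..<f b}"
      then show "y \<in> f ` {a..b}" using S[of y] by (intro image_eqI[of _ _ "S y"]) auto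
    qed
    ultimately have "continuous_on {f a<..<f b} S" by (rule continuous_on_subset)
    then show ?thesis using that by (simp add: continuous_on_eq_continuous_at)
  qed
  have S_deriv: "DERIV S y :> inverse (\<gamma>' (S y) \<bullet> t0)" if y: "f a < y" "y < f b" for y
  proof (rule DERIV_inverse_function[OF _ _ y])
    show "DERIV f (S y) :> \<gamma>' (S y) \<bullet> t0" using f_deriv S(2)[OF y] by auto
    show "\<gamma>' (S y) \<bullet> t0 \<noteq> 0"
      using pos[of "S y"] S(2)[OF y] len sub by (auto simp: curve_deriv_eq)
  qed (use S S_cont y in auto)
  define \<tau> where "\<tau> x = S ((x - p) \<bullet> t0)" for x
  define \<psi> where "\<psi> x = (x - \<gamma> (\<tau> x)) \<bullet> n0" for x
  have "compact (\<gamma> ` ({0..a} \<union> {b..1}))"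
    by (intro compact_continuous_image continuous_on_subset[OF curve_continuous]) (use ab in auto)
  moreover have "p \<notin> \<gamma> ` ({0..a} \<union> {b..1})"
    using curve_inj s0 ab unfolding p_def inj_on_def by force
  ultimately obtain R1 where R1: "R1 > 0" "\<And>s. s \<in> {0..a} \<union> {b..1} \<Longrightarrow> R1 \<le> dist p (\<gamma> s)"
    using separate_point_closed[of "\<gamma> ` ({0..a} \<union> {b..1})" p] by (auto simp: compact_imp_closed)
  obtain R2 where R2: "R2 > 0" "ball p R2 \<subseteq> \<Omega>"
    using open_\<Omega> curve_interior[OF s0] unfolding p_def open_contains_ball by blast
  \<comment> \<open>within this radius the abscissa stays in the range of the graph, and no other part of the arc is met\<close>
  define R where "R = min (min R1 R2) (min (- f a) (f b))"
  have R: "R > 0" "R \<le> R1" "R \<le> R2" "R \<le> - f a" "R \<le> f b" using R1 R2 fab by (auto simp: R_def)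
  have rng: "f a < (x - p) \<bullet> t0" "(x - p) \<bullet> t0 < f b" if "x \<in> ball p R" for x
  proof -
    have "\<bar>(x - p) \<bullet> t0\<bar> \<le> norm (x - p) * norm t0" by (rule Cauchy_Schwarz_ineq2)
    also have "\<dots> < R" using that by (simp add: nt0 dist_norm norm_minus_commute)
    finally show "f a < (x - p) \<bullet> t0" "(x - p) \<bullet> t0 < f b" using R by auto
  qed
  have \<tau>_in: "\<tau> x \<in> {a<..<b}" if "x \<in> ball p R" for x
    unfolding \<tau>_def using S(2) rng[OF that] by blast
  have "slit_chart \<Omega> \<gamma> s\<^sub>0 a b R \<psi> \<tau>"
  proof (unfold_locales; (fold p_def t0_def n0_def)?)
    show "0 < a" "a < s\<^sub>0" "s\<^sub>0 < b" "b < 1" "R > 0" using ab R by auto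
    show "tangent s \<bullet> tangent s' \<ge> 1 / 2" if "s \<in> {a..b}" "s' \<in> {a..b}" for s s'
      using tangents that by blast
    show "ball p R \<subseteq> \<Omega>" using R R2 by (auto simp: subset_eq)
    show "s \<in> {a<..<b}" if "s \<in> {0..1}" "\<gamma> s \<in> ball p R" for s
      using R1(2)[of s] R that by force
    show "\<tau> x \<in> {a<..<b}" if "x \<in> ball p R" for x using \<tau>_in that .
    show "x = \<gamma> (\<tau> x) + \<psi> x *\<^sub>R n0" if "x \<in> ball p R" for x
    proof -
      have "(x - \<gamma> (\<tau> x)) \<bullet> t0 = (x - p) \<bullet> t0 - f (\<tau> x)" by (simp add: f_def inner_diff_left)
      also have "\<dots> = 0" unfolding \<tau>_def using S(1)[OF rng[OF that]] by simp
      finally have "x - \<gamma> (\<tau> x) = \<psi> x *\<^sub>R n0"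
        using orthonormal_decomposition[OF nt0, of "x - \<gamma> (\<tau> x)"] by (simp add: \<psi>_def n0)
      then show ?thesis by (metis add.commute diff_add_cancel)
    qed
    show "GDERIV \<psi> x :> (1 / (tangent (\<tau> x) \<bullet> t0)) *\<^sub>R normal (\<tau> x)" if x: "x \<in> ball p R" for x
    proof -
      have \<tau>x: "\<tau> x \<in> {a..b}" "\<tau> x \<in> {0..1}" using \<tau>_in[OF x] ab by auto
      define v where "v = tangent (\<tau> x)"
      have v: "v \<bullet> t0 > 0" using pos \<tau>x by (simp add: v_def)
      have d\<gamma>: "(\<gamma> has_derivative (\<lambda>h. h *\<^sub>R \<gamma>' (\<tau> x))) (at (S ((x - p) \<bullet> t0)))"
        using curve_deriv[OF \<tau>x(2)] by (simp add: has_vector_derivative_def \<tau>_def)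
      have dS: "(S has_derivative (\<lambda>h. h * inverse (\<gamma>' (\<tau> x) \<bullet> t0))) (at ((x - p) \<bullet> t0))"
        using S_deriv[OF rng[OF x]] by (simp add: has_field_derivative_def \<tau>_def mult_commute_abs)
      have d1: "((\<lambda>x. (x - p) \<bullet> t0) has_derivative (\<lambda>h. h \<bullet> t0)) (at x)"
        by (auto intro!: derivative_eq_intros)
      have eq: "(h \<bullet> t0 * inverse ((len *\<^sub>R v) \<bullet> t0)) *\<^sub>R (len *\<^sub>R v) = (h \<bullet> t0 / (v \<bullet> t0)) *\<^sub>R v" for h
        using len(1) v by (simp add: field_simps)
      from has_derivative_compose[OF has_derivative_compose[OF d1 dS] d\<gamma>]
      have "((\<lambda>x. \<gamma> (\<tau> x)) has_derivative (\<lambda>h. (h \<bullet> t0 * inverse (\<gamma>' (\<tau> x) \<bullet> t0)) *\<^sub>R \<gamma>' (\<tau> x))) (at x)"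
        by (simp add: \<tau>_def)
      also have "\<gamma>' (\<tau> x) = len *\<^sub>R v" using \<tau>x by (simp add: curve_deriv_eq v_def)
      finally have "((\<lambda>x. \<gamma> (\<tau> x)) has_derivative (\<lambda>h. (h \<bullet> t0 / (v \<bullet> t0)) *\<^sub>R v)) (at x)"
        unfolding eq .
      then have "(\<psi> has_derivative (\<lambda>h. (h - (h \<bullet> t0 / (v \<bullet> t0)) *\<^sub>R v) \<bullet> n0)) (at x)"
        unfolding \<psi>_def by (auto intro!: derivative_eq_intros)
      moreover have "(h - (h \<bullet> t0 / (v \<bullet> t0)) *\<^sub>R v) \<bullet> n0 = h \<bullet> ((1 / (v \<bullet> t0)) *\<^sub>R rot v)" for h
      proof -
        have "(v \<bullet> t0) * (h \<bullet> n0) - (h \<bullet> t0) * (v \<bullet> n0) = (h \<bullet> rot v) * (t0 \<bullet> t0)"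
          by (simp add: n0 inner_real2 algebra_simps)
        moreover have "t0 \<bullet> t0 = 1" using nt0 by (simp add: norm_eq_sqrt_inner)
        ultimately show ?thesis using v by (simp add: inner_diff_left field_simps)
      qed
      ultimately show ?thesis by (simp add: gderiv_def v_def normal_plus_eq_rot)
    qed
    show "continuous_on (ball p R) \<tau>"
      unfolding \<tau>_def
    proof (rule continuous_on_compose2[of "{f a<..<f b}" S _ "\<lambda>x. (x - p) \<bullet> t0"])
      show "continuous_on {f a<..<f b} S"
        using S_cont by (simp add: continuous_on_eq_continuous_at)
    qed (use rng in \<open>auto intro!: continuous_intros\<close>)
  qed
  then show thesis by (rule that)
qed

end

section \<open>One-sided limits at the slit\<close>

text \<open>Identifies the plane with a product of two lines, for the sake of Fubini's theorem.\<close>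

lemma lborel_real2: "(lborel :: (real^2) measure) = distr (lborel \<Otimes>\<^sub>M lborel) borel (\<lambda>(x, y). vector [x, y])"
proof (rule lborel_eqI)
  have eq: "(\<lambda>(x, y). vector [x, y] :: real^2) = (\<lambda>z. fst z *\<^sub>R axis 1 1 + snd z *\<^sub>R axis 2 1)"
    by (auto simp: fun_eq_iff vec_eq_iff forall_2 axis_def)
  have meas: "(\<lambda>(x, y). vector [x, y] :: real^2) \<in> lborel \<Otimes>\<^sub>M lborel \<rightarrow>\<^sub>M borel"
    unfolding eq by measurable
  fix l u :: "real^2" assume le: "\<And>b. b \<in> Basis \<Longrightarrow> l \<bullet> b \<le> u \<bullet> b"
  have B: "(Basis :: (real^2) set) = {axis 1 1, axis 2 1}" "axis 1 1 \<noteq> (axis 2 1 :: real^2)"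
    by (auto simp: Basis_vec_def UNIV_2 axis_eq_axis)
  have le': "l $ 1 \<le> u $ 1" "l $ 2 \<le> u $ 2"
    using le[of "axis 1 1"] le[of "axis 2 1"] by (auto simp: B inner_axis)
  have pre: "(\<lambda>(x, y). vector [x, y]) -` box l u \<inter> space (lborel \<Otimes>\<^sub>M lborel)
      = {l $ 1 <..< u $ 1} \<times> {l $ 2 <..< u $ 2}"
    by (auto simp: box_def B inner_axis space_pair_measure)
  have "emeasure (distr (lborel \<Otimes>\<^sub>M lborel) borel (\<lambda>(x, y). vector [x, y] :: real^2)) (box l u)
      = emeasure (lborel \<Otimes>\<^sub>M lborel) ({l $ 1 <..< u $ 1} \<times> {l $ 2 <..< u $ 2})"
    by (subst emeasure_distr[OF meas]) (simp_all only: pre box_borel)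
  also have "\<dots> = ennreal (u $ 1 - l $ 1) * ennreal (u $ 2 - l $ 2)"
    using le' by (subst lborel.emeasure_pair_measure_Times) auto
  also have "\<dots> = ennreal (\<Prod>b\<in>Basis. (u - l) \<bullet> b)"
    using le' by (simp add: B inner_axis ennreal_mult)
  finally show "emeasure (distr (lborel \<Otimes>\<^sub>M lborel) borel (\<lambda>(x, y). vector [x, y])) (box l u)
      = ennreal (\<Prod>b\<in>Basis. (u - l) \<bullet> b)" .
qed simp

lemma has_integral_real2_product:
  fixes A C :: "real \<Rightarrow> real"
  assumes A: "continuous_on {c..d} A" and C: "continuous_on {a..b} C"
  shows "((\<lambda>v::real^2. A (v $ 2) * C (v $ 1)) has_integral integral {c..d} A * integral {a..b} C)
          (cbox (vector [a, c]) (vector [b, d]))"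
proof -
  define A' where "A' t = indicator {c..d} t *\<^sub>R A t" for t
  define C' where "C' t = indicator {a..b} t *\<^sub>R C t" for t
  have i: "integrable lborel A'" "integrable lborel C'"
    unfolding A'_def C'_def by (intro borel_integrable_compact A C compact_Icc)+
  have e: "integral\<^sup>L lborel A' = integral {c..d} A" "integral\<^sup>L lborel C' = integral {a..b} C"
  proof -
    have "A' = (\<lambda>t. if t \<in> {c..d} then A t else 0)" "C' = (\<lambda>t. if t \<in> {a..b} then C t else 0)"
      by (auto simp: A'_def C'_def)
    then show "integral\<^sup>L lborel A' = integral {c..d} A" "integral\<^sup>L lborel C' = integral {a..b} C"
      using integral_lborel[OF i(1)] integral_lborel[OF i(2)] by (metis integral_restrict_UNIV)+
  qed
  define f :: "real^2 \<Rightarrow> real" where "f v = C' (v $ 1) * A' (v $ 2)" for v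
  have m: "C' \<in> borel_measurable borel" "A' \<in> borel_measurable borel" using i by auto
  have mf: "f \<in> borel_measurable borel"
    unfolding f_def by (intro borel_measurable_times measurable_compose[OF _ m(1)] measurable_compose[OF _ m(2)]) auto
  have eq: "(\<lambda>(x, y). vector [x, y] :: real^2) = (\<lambda>z. fst z *\<^sub>R axis 1 1 + snd z *\<^sub>R axis 2 1)"
    by (auto simp: fun_eq_iff vec_eq_iff forall_2 axis_def)
  have meas: "(\<lambda>(x, y). vector [x, y] :: real^2) \<in> lborel \<Otimes>\<^sub>M lborel \<rightarrow>\<^sub>M borel"
    unfolding eq by measurable
  have pair: "integrable (lborel \<Otimes>\<^sub>M lborel) (\<lambda>(x, y). C' x * A' y)"
  proof (rule lborel_pair.Fubini_integrable)
    show "(\<lambda>(x, y). C' x * A' y) \<in> borel_measurable (lborel \<Otimes>\<^sub>M lborel)"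
      using m by measurable
    show "integrable lborel (\<lambda>x. LINT y|lborel. norm (case (x, y) of (x, y) \<Rightarrow> C' x * A' y))"
      using i by (simp add: abs_mult)
    show "AE x in lborel. integrable lborel (\<lambda>y. case (x, y) of (x, y) \<Rightarrow> C' x * A' y)"
      using i by simp
  qed
  have fp: "f (case z of (x, y) \<Rightarrow> vector [x, y]) = (case z of (x, y) \<Rightarrow> C' x * A' y)" for z
    by (simp add: f_def split: prod.split)
  have int: "integrable lborel f"
    unfolding lborel_real2 by (subst integrable_distr_eq[OF meas mf]) (use pair in \<open>simp add: fp\<close>)
  have "integral\<^sup>L lborel f = integral\<^sup>L (lborel \<Otimes>\<^sub>M lborel) (\<lambda>(x, y). C' x * A' y)"
    unfolding lborel_real2 by (subst integral_distr[OF meas mf]) (simp add: fp)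
  also have "\<dots> = (LINT x|lborel. LINT y|lborel. C' x * A' y)"
    using lborel_pair.integral_fst'[OF pair] by simp
  also have "\<dots> = integral {c..d} A * integral {a..b} C" by (simp add: e)
  finally have "(f has_integral integral {c..d} A * integral {a..b} C) UNIV"
    using has_integral_integral_lborel[OF int] by simp
  moreover have "f = (\<lambda>v. if v \<in> cbox (vector [a, c]) (vector [b, d]) then A (v $ 2) * C (v $ 1) else 0)"
    by (auto simp: f_def A'_def C'_def fun_eq_iff mem_box_cart forall_2 indicator_def)
  ultimately show ?thesis by (simp add: has_integral_restrict_UNIV)
qed

context slit
begin

text \<open>A nearest point of the arc need not be unique, but every choice is continuous at the points of the arc.\<close>

lemma exists_foot:
  obtains \<phi> where "\<And>x. \<phi> x \<in> {0..1}" "\<And>x s. s \<in> {0..1} \<Longrightarrow> dist x (\<gamma> (\<phi> x)) \<le> dist x (\<gamma> s)"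
proof -
  have "\<exists>\<sigma>\<in>{0..1}. \<forall>s\<in>{0..1}. dist x (\<gamma> \<sigma>) \<le> dist x (\<gamma> s)" for x
    by (rule continuous_attains_inf) (auto intro!: continuous_intros curve_continuous)
  then show thesis using that by metis
qed

lemma foot_tendsto:
  assumes \<phi>: "\<And>x. \<phi> x \<in> {0..1}" "\<And>x s. s \<in> {0..1} \<Longrightarrow> dist x (\<gamma> (\<phi> x)) \<le> dist x (\<gamma> s)"
    and s: "s \<in> {0..1}"
  shows "((\<lambda>x. \<gamma> (\<phi> x)) \<longlongrightarrow> \<gamma> s) (at (\<gamma> s) within A)" "(\<phi> \<longlongrightarrow> s) (at (\<gamma> s) within A)"
proof -
  have d: "dist (\<gamma> (\<phi> x)) (\<gamma> s) \<le> 2 * dist x (\<gamma> s)" for x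
    using \<phi>(2)[OF s, of x] dist_triangle[of "\<gamma> (\<phi> x)" "\<gamma> s" x] by (simp add: dist_commute)
  show 1: "((\<lambda>x. \<gamma> (\<phi> x)) \<longlongrightarrow> \<gamma> s) (at (\<gamma> s) within A)"
    unfolding tendsto_iff eventually_at
  proof (intro allI impI)
    fix e :: real assume "e > 0"
    then show "\<exists>d>0. \<forall>x\<in>A. x \<noteq> \<gamma> s \<and> dist x (\<gamma> s) < d \<longrightarrow> dist (\<gamma> (\<phi> x)) (\<gamma> s) < e"
      by (intro exI[of _ "e/2"]) (auto intro!: le_less_trans[OF d])
  qed
  obtain h where h: "homeomorphism {0..1} (path_image \<gamma>) \<gamma> h"
    using vasculature homeomorphism_arc unfolding vasculature_def by blast
  have "continuous_on (path_image \<gamma>) h" using h by (simp add: homeomorphism_def)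
  then have "((\<lambda>x. h (\<gamma> (\<phi> x))) \<longlongrightarrow> h (\<gamma> s)) (at (\<gamma> s) within A)"
    by (rule continuous_on_tendsto_compose[OF _ 1]) (use \<phi>(1) s in \<open>auto simp: path_image_def\<close>)
  then show "(\<phi> \<longlongrightarrow> s) (at (\<gamma> s) within A)"
    using h \<phi>(1) s by (simp add: homeomorphism_def)
qed

lemma foot_orthogonal:
  assumes \<phi>: "\<phi> \<in> {0<..<1}" "\<And>s. s \<in> {0..1} \<Longrightarrow> dist x (\<gamma> \<phi>) \<le> dist x (\<gamma> s)"
  shows "(x - \<gamma> \<phi>) \<bullet> tangent \<phi> = 0"
proof -
  have \<phi>01: "\<phi> \<in> {0..1}" using \<phi> by auto
  have "((\<lambda>s. (x - \<gamma> s) \<bullet> (x - \<gamma> s)) has_vector_derivative - 2 * ((x - \<gamma> \<phi>) \<bullet> \<gamma>' \<phi>)) (at \<phi>)"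
    using curve_deriv[OF \<phi>01] unfolding has_vector_derivative_def
    by (auto intro!: derivative_eq_intros simp: fun_eq_iff algebra_simps inner_commute)
  then have d: "DERIV (\<lambda>s. (x - \<gamma> s) \<bullet> (x - \<gamma> s)) \<phi> :> - 2 * ((x - \<gamma> \<phi>) \<bullet> \<gamma>' \<phi>)"
    by (simp add: has_real_derivative_iff_has_vector_derivative)
  have "- 2 * ((x - \<gamma> \<phi>) \<bullet> \<gamma>' \<phi>) = 0"
  proof (rule DERIV_local_min[OF d])
    show "min \<phi> (1 - \<phi>) > 0" using \<phi> by auto
    show "\<forall>s. \<bar>\<phi> - s\<bar> < min \<phi> (1 - \<phi>) \<longrightarrow> (x - \<gamma> \<phi>) \<bullet> (x - \<gamma> \<phi>) \<le> (x - \<gamma> s) \<bullet> (x - \<gamma> s)"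
    proof (intro allI impI)
      fix s assume "\<bar>\<phi> - s\<bar> < min \<phi> (1 - \<phi>)"
      then have "dist x (\<gamma> \<phi>) \<le> dist x (\<gamma> s)" by (intro \<phi>(2)) auto
      then show "(x - \<gamma> \<phi>) \<bullet> (x - \<gamma> \<phi>) \<le> (x - \<gamma> s) \<bullet> (x - \<gamma> s)"
        by (simp add: dist_norm norm_eq_sqrt_inner)
    qed
  qed
  then show ?thesis using len by (simp add: curve_deriv_eq[OF \<phi>01])
qed

end

context slit_chart
begin

abbreviation "B \<equiv> ball (\<gamma> s\<^sub>0) R"
abbreviation "N\<^sub>0 \<equiv> normal s\<^sub>0"

lemma chart_param: "s \<in> {a..b} \<Longrightarrow> s \<in> {0<..<1}" "s \<in> {a..b} \<Longrightarrow> s \<in> {0..1}"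
  using ab by auto

lemma s0_in: "s\<^sub>0 \<in> {a..b}" "s\<^sub>0 \<in> {0..1}" "\<gamma> s\<^sub>0 \<in> B"
  using ab R by auto

lemma tangent_pos: "s \<in> {a..b} \<Longrightarrow> tangent s \<bullet> tangent s\<^sub>0 \<ge> 1/2"
  using tangents s0_in by blast

lemma chart_inj:
  assumes "s \<in> {a..b}" "s' \<in> {a..b}" "\<gamma> s + t *\<^sub>R N\<^sub>0 = \<gamma> s' + t' *\<^sub>R N\<^sub>0"
  shows "s = s'" "t = t'"
proof -
  have "(\<gamma> s + t *\<^sub>R N\<^sub>0) \<bullet> tangent s\<^sub>0 = (\<gamma> s' + t' *\<^sub>R N\<^sub>0) \<bullet> tangent s\<^sub>0" using assms(3) by simp
  then have e: "(\<gamma> s - 0) \<bullet> tangent s\<^sub>0 = (\<gamma> s' - 0) \<bullet> tangent s\<^sub>0"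
    by (simp add: inner_add_left normal_plus_eq_rot rot_simps)
  have pos: "tangent s \<bullet> tangent s\<^sub>0 > 0" if "s \<in> {a..b}" for s using tangent_pos[OF that] by linarith
  have mono: "(\<gamma> s - 0) \<bullet> tangent s\<^sub>0 < (\<gamma> s' - 0) \<bullet> tangent s\<^sub>0" if "s \<in> {a..b}" "s' \<in> {a..b}" "s < s'" for s s'
    by (rule abscissa_strict_mono[of a b]) (use ab pos that in auto)
  show "s = s'" using mono[OF assms(1,2)] mono[OF assms(2,1)] e by (metis less_irrefl linorder_neqE)
  moreover have "N\<^sub>0 \<noteq> 0" using norm_normal[OF s0_in(2)] by force
  ultimately show "t = t'" using assms(3) by simp
qed

lemma chart_unique:
  assumes "s \<in> {a..b}" "\<gamma> s + t *\<^sub>R N\<^sub>0 \<in> B"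
  shows "\<tau> (\<gamma> s + t *\<^sub>R N\<^sub>0) = s" "\<psi> (\<gamma> s + t *\<^sub>R N\<^sub>0) = t"
proof -
  have "\<tau> (\<gamma> s + t *\<^sub>R N\<^sub>0) \<in> {a..b}" using \<tau>[OF assms(2)] by auto
  from chart_inj[OF assms(1) this height[OF assms(2)]]
  show "\<tau> (\<gamma> s + t *\<^sub>R N\<^sub>0) = s" "\<psi> (\<gamma> s + t *\<^sub>R N\<^sub>0) = t" by auto
qed

lemma mem_slit_iff: "x \<in> B \<Longrightarrow> x \<in> path_image \<gamma> \<longleftrightarrow> \<psi> x = 0"
proof
  assume x: "x \<in> B" "x \<in> path_image \<gamma>"
  then obtain s where s: "s \<in> {0..1}" "x = \<gamma> s" by (auto simp: path_image_def)
  then have "s \<in> {a..b}" using in_chart[of s] x by auto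
  then show "\<psi> x = 0" using chart_unique(2)[of s 0] s x by simp
next
  assume x: "x \<in> B" "\<psi> x = 0"
  then have "x = \<gamma> (\<tau> x)" using height[OF x(1)] by simp
  moreover have "\<tau> x \<in> {0..1}" using \<tau>[OF x(1)] ab by auto
  ultimately show "x \<in> path_image \<gamma>" unfolding path_image_def by blast
qed

lemma \<psi>_gradient_inner_normal:
  assumes "x \<in> B" "s \<in> {a..b}"
  shows "((1 / (tangent (\<tau> x) \<bullet> tangent s\<^sub>0)) *\<^sub>R normal (\<tau> x)) \<bullet> normal s > 0"
proof -
  have t: "\<tau> x \<in> {a..b}" using \<tau>[OF assms(1)] by auto
  have "tangent (\<tau> x) \<bullet> tangent s > 0" using tangents[OF t assms(2)] by linarith
  moreover have "tangent (\<tau> x) \<bullet> tangent s\<^sub>0 > 0" using tangent_pos[OF t] by linarith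
  ultimately show ?thesis by (simp add: normal_plus_eq_rot rot_simps)
qed

text \<open>Every point near the slit lies on the normal through its nearest point of the slit. Limits along
  the normals, locally uniform in the foot point, are therefore unrestricted limits from one side.\<close>

lemma one_sided_limit:
  fixes g :: "real^2 \<Rightarrow> 'b::t2_space"
  assumes g: "has_side_values \<gamma> g" and \<sigma>: "\<sigma> = 1 \<or> \<sigma> = -1" and s: "s \<in> {0..1}" "\<gamma> s \<in> B"
  shows "(g \<longlongrightarrow> osv g \<sigma> s) (at (\<gamma> s) within {x \<in> B. \<sigma> * \<psi> x > 0})"
proof -
  let ?A = "{x \<in> B. \<sigma> * \<psi> x > 0}"
  obtain \<phi> where \<phi>: "\<And>x. \<phi> x \<in> {0..1}" "\<And>x s. s \<in> {0..1} \<Longrightarrow> dist x (\<gamma> (\<phi> x)) \<le> dist x (\<gamma> s)"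
    using exists_foot by blast
  have sab: "s \<in> {a<..<b}" by (rule in_chart[OF s])
  have s01: "s \<in> {0<..<1}" using sab ab by auto
  note lim = foot_tendsto[OF \<phi> s(1), of ?A]
  have ev: "\<forall>\<^sub>F x in at (\<gamma> s) within ?A.
      x = \<gamma> (\<phi> x) + dist x (\<gamma> (\<phi> x)) *\<^sub>R \<sigma> *\<^sub>R normal (\<phi> x) \<and> dist x (\<gamma> (\<phi> x)) > 0"
  proof -
    have "\<forall>\<^sub>F x in at (\<gamma> s) within ?A. \<phi> x \<in> {a<..<b}"
      by (rule topological_tendstoD[OF lim(2)]) (use sab in auto)
    moreover have "\<forall>\<^sub>F x in at (\<gamma> s) within ?A. \<gamma> (\<phi> x) \<in> B"
      by (rule topological_tendstoD[OF lim(1)]) (use s in auto)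
    moreover have "\<forall>\<^sub>F x in at (\<gamma> s) within ?A. x \<in> ?A"
      by (auto simp: eventually_at intro: exI[of _ 1])
    ultimately show ?thesis
    proof eventually_elim
      case (elim x)
      define u where "u = \<phi> x"
      have u: "u \<in> {a..b}" "u \<in> {0..1}" "u \<in> {0<..<1}" "\<gamma> u \<in> B" using elim ab by (auto simp: u_def)
      have x: "x \<in> B" "\<sigma> * \<psi> x > 0" using elim by auto
      define e where "e = (x - \<gamma> u) \<bullet> normal u"
      have orth: "(x - \<gamma> u) \<bullet> tangent u = 0"
        by (rule foot_orthogonal[OF u(3)]) (use \<phi>(2) in \<open>auto simp: u_def\<close>)
      have xe: "x - \<gamma> u = e *\<^sub>R normal u"
        using orthonormal_decomposition[OF norm_tangent[OF u(2)], of "x - \<gamma> u"] orth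
        by (simp add: e_def normal_plus_eq_rot)
      have dist_e: "dist x (\<gamma> u) = \<bar>e\<bar>"
        using norm_normal[OF u(2)] by (simp add: dist_norm xe)
      define k where "k t = \<psi> (\<gamma> u + t *\<^sub>R (x - \<gamma> u))" for t
      define c where "c y = ((1 / (tangent (\<tau> y) \<bullet> tangent s\<^sub>0)) *\<^sub>R normal (\<tau> y)) \<bullet> normal u" for y
      have inB: "\<gamma> u + t *\<^sub>R (x - \<gamma> u) \<in> B" if "0 \<le> t" "t \<le> 1" for t
      proof -
        have "(1 - t) *\<^sub>R \<gamma> u + t *\<^sub>R x \<in> B"
          by (rule convexD_alt[OF convex_ball u(4) x(1) that])
        then show ?thesis by (simp add: algebra_simps)
      qed
      have dk: "DERIV k t :> e * c (\<gamma> u + t *\<^sub>R (x - \<gamma> u))" if "0 \<le> t" "t \<le> 1" for t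
      proof -
        have 1: "((\<lambda>t. \<gamma> u + t *\<^sub>R (x - \<gamma> u)) has_derivative (\<lambda>h. h *\<^sub>R (x - \<gamma> u))) (at t)"
          by (auto intro!: derivative_eq_intros)
        from has_derivative_compose[OF 1 \<psi>_deriv[OF inB[OF that], unfolded gderiv_def]]
        have "(k has_derivative (\<lambda>h. h * (e * c (\<gamma> u + t *\<^sub>R (x - \<gamma> u))))) (at t)"
          unfolding k_def c_def xe by (simp add: inner_commute mult.assoc algebra_simps)
        then show ?thesis by (simp add: has_field_derivative_def mult_commute_abs)
      qed
      obtain z where z: "0 < z" "z < 1" "k 1 - k 0 = (1 - 0) * (e * c (\<gamma> u + z *\<^sub>R (x - \<gamma> u)))"
        using MVT2[of 0 1 k "\<lambda>t. e * c (\<gamma> u + t *\<^sub>R (x - \<gamma> u))"] dk by auto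
      have "k 0 = 0" using mem_slit_iff[OF u(4)] u(2) by (simp add: k_def path_image_def)
      moreover have "k 1 = \<psi> x" by (simp add: k_def)
      \<comment> \<open>the height grows along the normal at the foot, so it has the sign of \<open>e\<close>\<close>
      ultimately have "\<psi> x = e * c (\<gamma> u + z *\<^sub>R (x - \<gamma> u))" using z by simp
      moreover have "c (\<gamma> u + z *\<^sub>R (x - \<gamma> u)) > 0"
        unfolding c_def by (rule \<psi>_gradient_inner_normal) (use inB z u in auto)
      ultimately have "\<sigma> * e > 0" using x(2) by (simp add: mult.assoc[symmetric] zero_less_mult_iff)
      then have e: "e = \<bar>e\<bar> * \<sigma>" "\<bar>e\<bar> > 0" using \<sigma> by (auto simp: abs_if)
      have "x = \<gamma> u + e *\<^sub>R normal u" using xe by (metis add.commute diff_add_cancel)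
      also have "e *\<^sub>R normal u = \<bar>e\<bar> *\<^sub>R \<sigma> *\<^sub>R normal u" using e(1) by (metis scaleR_scaleR)
      finally show ?case using e(2) dist_e unfolding u_def by simp
    qed
  qed
  have "filterlim (\<lambda>x. (\<phi> x, dist x (\<gamma> (\<phi> x)))) (at (s, 0) within UNIV \<times> {0<..}) (at (\<gamma> s) within ?A)"
    unfolding filterlim_at
  proof
    show "\<forall>\<^sub>F x in at (\<gamma> s) within ?A. (\<phi> x, dist x (\<gamma> (\<phi> x))) \<in> UNIV \<times> {0<..}
        \<and> (\<phi> x, dist x (\<gamma> (\<phi> x))) \<noteq> (s, 0)"
      using ev by eventually_elim auto
    have "((\<lambda>x. dist x (\<gamma> (\<phi> x))) \<longlongrightarrow> dist (\<gamma> s) (\<gamma> s)) (at (\<gamma> s) within ?A)"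
      by (intro tendsto_dist tendsto_ident_at lim)
    then show "((\<lambda>x. (\<phi> x, dist x (\<gamma> (\<phi> x)))) \<longlongrightarrow> (s, 0)) (at (\<gamma> s) within ?A)"
      unfolding dist_self by (intro tendsto_Pair lim)
  qed
  from filterlim_compose[OF one_sided_limit_joint[OF g \<sigma> s01] this]
  have "((\<lambda>x. g (\<gamma> (\<phi> x) + dist x (\<gamma> (\<phi> x)) *\<^sub>R \<sigma> *\<^sub>R normal (\<phi> x))) \<longlongrightarrow> osv g \<sigma> s) (at (\<gamma> s) within ?A)"
    by simp
  then show ?thesis
    by (rule Lim_transform_eventually) (use ev in eventually_elim, auto)
qed

lemma one_sided_limit_vertical:
  fixes g :: "real^2 \<Rightarrow> 'b::t2_space"
  assumes g: "has_side_values \<gamma> g" and \<sigma>: "\<sigma> = 1 \<or> \<sigma> = -1" and s: "s \<in> {0..1}" "\<gamma> s \<in> B"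
    and h: "(h \<longlongrightarrow> 0) F" "\<forall>\<^sub>F n in F. h n > 0"
  shows "((\<lambda>n. g (\<gamma> s + (\<sigma> * h n) *\<^sub>R N\<^sub>0)) \<longlongrightarrow> osv g \<sigma> s) F"
proof (rule filterlim_compose[OF one_sided_limit[OF g \<sigma> s]])
  have N0: "N\<^sub>0 \<noteq> 0" using norm_normal[OF s0_in(2)] by force
  have lim: "((\<lambda>n. \<gamma> s + (\<sigma> * h n) *\<^sub>R N\<^sub>0) \<longlongrightarrow> \<gamma> s + (\<sigma> * 0) *\<^sub>R N\<^sub>0) F"
    by (intro tendsto_intros h)
  then have "\<forall>\<^sub>F n in F. \<gamma> s + (\<sigma> * h n) *\<^sub>R N\<^sub>0 \<in> B"
    by (rule topological_tendstoD) (use s in auto)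
  then have "\<forall>\<^sub>F n in F. \<gamma> s + (\<sigma> * h n) *\<^sub>R N\<^sub>0 \<in> {x \<in> B. \<sigma> * \<psi> x > 0} \<and> \<gamma> s + (\<sigma> * h n) *\<^sub>R N\<^sub>0 \<noteq> \<gamma> s"
    using h(2)
  proof eventually_elim
    case (elim n)
    have "s \<in> {a..b}" using in_chart[OF s] by auto
    from chart_unique(2)[OF this elim(1)] show ?case using elim \<sigma> N0 by auto
  qed
  then show "filterlim (\<lambda>n. \<gamma> s + (\<sigma> * h n) *\<^sub>R N\<^sub>0) (at (\<gamma> s) within {x \<in> B. \<sigma> * \<psi> x > 0}) F"
    using lim by (simp add: filterlim_at)
qed

end

section \<open>Flux through the slit\<close>

lemma change_of_variables_scalar:
  fixes f :: "real^'m::{finite,wellorder} \<Rightarrow> real" and \<Phi> :: "real^'m::_ \<Rightarrow> real^'m::_"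
  assumes "S \<in> sets lebesgue" "\<And>x. x \<in> S \<Longrightarrow> (\<Phi> has_derivative \<Phi>' x) (at x within S)" "inj_on \<Phi> S"
    and int: "(\<lambda>x. \<bar>det (matrix (\<Phi>' x))\<bar> * f (\<Phi> x)) absolutely_integrable_on S"
  shows "(f has_integral integral S (\<lambda>x. \<bar>det (matrix (\<Phi>' x))\<bar> * f (\<Phi> x))) (\<Phi> ` S)"
proof -
  let ?J = "\<lambda>x. \<bar>det (matrix (\<Phi>' x))\<bar>"
  have "(\<lambda>x. ?J x *\<^sub>R (vec (f (\<Phi> x)) :: real^1)) absolutely_integrable_on S"
    using int by (simp add: absolutely_integrable_on_1_iff)
  then have 1: "(\<lambda>x. vec (f x) :: real^1) absolutely_integrable_on \<Phi> ` S"
    and 2: "integral (\<Phi> ` S) (\<lambda>x. vec (f x) :: real^1) = integral S (\<lambda>x. ?J x *\<^sub>R vec (f (\<Phi> x)))"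
    using has_absolute_integral_change_of_variables[OF assms(1-3), of "\<lambda>x. vec (f x) :: real^1"] by blast+
  have "f integrable_on \<Phi> ` S"
    using 1 by (simp add: absolutely_integrable_on_1_iff absolutely_integrable_on_def)
  moreover have "integral (\<Phi> ` S) f = integral S (\<lambda>x. ?J x * f (\<Phi> x))"
    using 2 by (simp add: integral_on_1_eq vec_eq_iff)
  ultimately show ?thesis by (simp add: has_integral_iff)
qed

lemma exists_layer_profile:
  obtains S S' :: "real \<Rightarrow> real" where
    "\<And>t. (S has_real_derivative S' t) (at t)" "continuous_on UNIV S'"
    "\<And>t. \<bar>t\<bar> \<le> 1 \<Longrightarrow> S t = 0" "\<And>t. \<bar>t\<bar> \<ge> 2 \<Longrightarrow> S t = 1" "\<And>t. \<bar>S t\<bar> \<le> 1"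
    "\<And>t. \<bar>t\<bar> \<le> 1 \<Longrightarrow> S' t = 0" "\<And>t. \<bar>t\<bar> \<ge> 2 \<Longrightarrow> S' t = 0"
proof -
  obtain S S' :: "real \<Rightarrow> real" where
    S: "\<And>x. (S has_real_derivative S' x) (at x)" "continuous_on UNIV S'"
    "\<And>x. x \<le> 0 \<Longrightarrow> S x = 0" "\<And>x. x \<ge> 1 \<Longrightarrow> S x = 1"
    "\<And>x. 0 \<le> S x" "\<And>x. S x \<le> 1"
    "\<And>x. x \<le> 0 \<Longrightarrow> S' x = 0" "\<And>x. x \<ge> 1 \<Longrightarrow> S' x = 0"
    using exists_smooth_step by blast
  have d: "((\<lambda>t::real. t\<^sup>2 - 1) has_real_derivative 2 * t) (at t)" for t
    by (auto intro!: derivative_eq_intros)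
  have le: "t\<^sup>2 - 1 \<le> 0" if "\<bar>t\<bar> \<le> 1" for t :: real
    using that by (simp add: abs_square_le_1)
  have ge: "t\<^sup>2 - 1 \<ge> 1" if "\<bar>t\<bar> \<ge> 2" for t :: real
    using power_mono[of 2 "\<bar>t\<bar>" 2] that by simp
  show thesis
  proof (rule that[of "\<lambda>t. S (t\<^sup>2 - 1)" "\<lambda>t. S' (t\<^sup>2 - 1) * (2 * t)"])
    show "((\<lambda>t. S (t\<^sup>2 - 1)) has_real_derivative S' (t\<^sup>2 - 1) * (2 * t)) (at t)" for t
      by (rule DERIV_chain2[OF S(1) d])
    show "continuous_on UNIV (\<lambda>t. S' (t\<^sup>2 - 1) * (2 * t))"
      by (intro continuous_intros continuous_on_compose2[OF S(2)]) auto
  qed (use S le ge in \<open>auto simp: abs_le_iff\<close>)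
qed

context slit_chart
begin

text \<open>The substitution \<open>(s, t) \<mapsto> \<gamma> s + (\<sigma> t / n) N\<^sub>0\<close> maps the fixed box \<open>[a, b] \<times> [1, 2]\<close> onto the layer of
thickness of order \<open>1/n\<close> on the side \<open>\<sigma>\<close>. Its Jacobian cancels both the factor \<open>n\<close> of the cutoff and the slope of the chart.
What remains converges boundedly to the one-sided flux times the derivative of the profile, whose integral is \<open>\<sigma>\<close>.\<close>

lemma slit_flux_identity:
  assumes "flux_field (\<Omega> - path_image \<gamma>) F"
    and side: "has_side_values \<gamma> F"
    and \<eta>: "C1_with_gradient \<eta> g" and supp: "\<And>x. norm (x - \<gamma> s\<^sub>0) > r \<Longrightarrow> \<eta> x = 0" and r: "r < R"
    and M: "\<And>x. x \<in> B \<Longrightarrow> norm (x - \<gamma> s\<^sub>0) \<le> r \<Longrightarrow> \<psi> x \<noteq> 0 \<Longrightarrow> norm (F x) \<le> M"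
  shows "((\<lambda>s. \<eta> (\<gamma> s) * (jump_vector \<gamma> F s * norm (\<gamma>' s))) has_integral
           integral (\<Omega> - path_image \<gamma>) (\<lambda>x. \<eta> x * divergence F x + g x \<bullet> F x)) {0..1}"
proof -
  define D where "D = \<Omega> - path_image \<gamma>"
  interpret flux_field D F using assms(1) by (simp add: D_def)
  obtain S S' :: "real \<Rightarrow> real" where
    S: "\<And>t. (S has_real_derivative S' t) (at t)" "continuous_on UNIV S'"
    "\<And>t. \<bar>t\<bar> \<le> 1 \<Longrightarrow> S t = 0" "\<And>t. \<bar>t\<bar> \<ge> 2 \<Longrightarrow> S t = 1" "\<And>t. \<bar>S t\<bar> \<le> 1"
    "\<And>t. \<bar>t\<bar> \<le> 1 \<Longrightarrow> S' t = 0" "\<And>t. \<bar>t\<bar> \<ge> 2 \<Longrightarrow> S' t = 0"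
    using exists_layer_profile by blast
  define g\<psi> where "g\<psi> x = (1 / (tangent (\<tau> x) \<bullet> tangent s\<^sub>0)) *\<^sub>R normal (\<tau> x)" for x
  define q where "q n x = (if x \<in> B then \<eta> x * (real (Suc n) * S' (real (Suc n) * \<psi> x)) * (g\<psi> x \<bullet> F x) else 0)" for n x
  have c\<eta>: "continuous_on UNIV \<eta>" using C1_with_gradient_continuous[OF \<eta>] .
  have cF: "continuous_on D F" using C1_field_continuous[OF C1_F] .
  have D_iff: "x \<in> D \<longleftrightarrow> \<psi> x \<noteq> 0" if "x \<in> B" for x
    using mem_slit_iff[OF that] ball_sub that by (auto simp: D_def)
  have \<tau>01: "\<tau> x \<in> {0..1}" "\<tau> x \<in> {a..b}" if "x \<in> B" for x using \<tau>[OF that] ab by auto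
  have cg\<psi>: "continuous_on B g\<psi>"
    unfolding g\<psi>_def
    by (intro continuous_intros continuous_on_compose2[OF tangent_continuous \<tau>_continuous]
        continuous_on_compose2[OF normal_continuous \<tau>_continuous])
      (use \<tau>01 tangent_pos in fastforce)+
  have layer: "(\<lambda>n. integral D (q n)) \<longlonglongrightarrow> - integral D (\<lambda>x. \<eta> x * divergence F x + g x \<bullet> F x)"
    unfolding q_def
    by (rule layer_limit(2)[where S=S and T="-{0}", OF \<eta> supp r _ cg\<psi>])
      (use D_iff \<psi>_deriv S in \<open>auto simp: g\<psi>_def\<close>)
  define Box :: "(real^2) set" where "Box = cbox (vector [a, 1]) (vector [b, 2])"
  have Box: "v \<in> Box \<longleftrightarrow> v $ 1 \<in> {a..b} \<and> v $ 2 \<in> {1..2}" for v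
    by (auto simp: Box_def mem_box_cart forall_2)
  define \<Phi> where "\<Phi> \<sigma> n v = \<gamma> (v $ 1) + (\<sigma> * (v $ 2 / real (Suc n))) *\<^sub>R N\<^sub>0" for \<sigma> n and v :: "real^2"
  \<comment> \<open>the integrand of the layer flux in the coordinates of the box, Jacobian included\<close>
  define G where "G \<sigma> n v = len * \<eta> (\<Phi> \<sigma> n v) * S' (\<sigma> * v $ 2) * (normal (v $ 1) \<bullet> F (\<Phi> \<sigma> n v))" for \<sigma> n v
  define E where "E \<sigma> = {x \<in> B. \<sigma> * \<psi> x > 0}" for \<sigma>
  \<comment> \<open>the limiting flux density through the side \<open>\<sigma>\<close>\<close>
  define L where "L \<sigma> s = len * \<eta> (\<gamma> s) * (normal s \<bullet> osv F \<sigma> s)" for \<sigma> s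
  have cL: "continuous_on {a..b} (L \<sigma>)" if \<sigma>: "\<sigma> = 1 \<or> \<sigma> = -1" for \<sigma>
    unfolding L_def using chart_param
    by (intro continuous_intros continuous_on_compose2[OF c\<eta>] continuous_on_subset[OF normal_continuous]
        continuous_on_subset[OF one_sided_value_continuous[OF side \<sigma>]] continuous_on_subset[OF curve_continuous]) auto
  have cS': "\<exists>Smax. \<forall>t\<in>{-2..2}. \<bar>S' t\<bar> \<le> Smax"
  proof -
    have "compact (S' ` {-2..2})" by (intro compact_continuous_image continuous_on_subset[OF S(2)]) auto
    from compact_imp_bounded[OF this] show ?thesis unfolding bounded_iff by auto
  qed
  then obtain Smax where Smax: "\<And>t. t \<in> {-2..2} \<Longrightarrow> \<bar>S' t\<bar> \<le> Smax" by blast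
  obtain Emax where Emax: "\<And>x. x \<in> cball (\<gamma> s\<^sub>0) r \<Longrightarrow> \<bar>\<eta> x\<bar> \<le> Emax"
  proof -
    have "compact (\<eta> ` cball (\<gamma> s\<^sub>0) r)" by (intro compact_continuous_image continuous_on_subset[OF c\<eta>]) auto
    from compact_imp_bounded[OF this] obtain e where "\<forall>y\<in>\<eta> ` cball (\<gamma> s\<^sub>0) r. norm y \<le> e"
      unfolding bounded_iff by blast
    then show thesis by (intro that[of e]) auto
  qed
  have e0: "\<eta> x = 0" if "x \<notin> cball (\<gamma> s\<^sub>0) r" for x
    using that by (intro supp) (auto simp: dist_norm norm_minus_commute)
  have sub: "cball (\<gamma> s\<^sub>0) r \<subseteq> B" using r by auto
  have \<Phi>_chart: "\<tau> (\<Phi> \<sigma> n v) = v $ 1" "\<psi> (\<Phi> \<sigma> n v) = \<sigma> * (v $ 2 / real (Suc n))" "\<Phi> \<sigma> n v \<in> D" "\<Phi> \<sigma> n v \<in> E \<sigma>"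
    if "v \<in> Box" "\<Phi> \<sigma> n v \<in> B" "\<sigma> = 1 \<or> \<sigma> = -1" for \<sigma> n v
  proof -
    show 1: "\<tau> (\<Phi> \<sigma> n v) = v $ 1" "\<psi> (\<Phi> \<sigma> n v) = \<sigma> * (v $ 2 / real (Suc n))"
      using chart_unique[of "v $ 1" "\<sigma> * (v $ 2 / real (Suc n))"] that by (auto simp: Box \<Phi>_def)
    have "v $ 2 > 0" using that(1) by (simp add: Box)
    then show "\<Phi> \<sigma> n v \<in> D" "\<Phi> \<sigma> n v \<in> E \<sigma>"
      unfolding D_iff[OF that(2)] E_def using that 1 by auto
  qed
  have c\<Phi>: "continuous_on Box (\<Phi> \<sigma> n)" for \<sigma> n
    unfolding \<Phi>_def
    by (intro continuous_intros continuous_on_compose2[OF curve_continuous])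
      (use chart_param in \<open>auto simp: Box\<close>)
  \<comment> \<open>the box may leave the chart, but there the test function vanishes\<close>
  have cG: "continuous_on Box (G \<sigma> n)" if \<sigma>: "\<sigma> = 1 \<or> \<sigma> = -1" for \<sigma> n
  proof -
    let ?U = "Box \<inter> \<Phi> \<sigma> n -` B" and ?V = "Box \<inter> \<Phi> \<sigma> n -` (- cball (\<gamma> s\<^sub>0) r)"
    have UV: "?U \<union> ?V = Box" using sub by blast
    have "continuous_on (?U \<union> ?V) (G \<sigma> n)"
    proof (rule continuous_on_Un_local_open; (unfold UV)?)
      show "openin (top_of_set Box) ?U" "openin (top_of_set Box) ?V"
        by (auto intro!: continuous_openin_preimage_gen[OF c\<Phi>])
      show "continuous_on ?U (G \<sigma> n)"
        unfolding G_def
        by (intro continuous_intros continuous_on_compose2[OF c\<eta>] continuous_on_compose2[OF S(2)]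
            continuous_on_compose2[OF normal_continuous] continuous_on_compose2[OF cF]
            continuous_on_subset[OF c\<Phi>])
          (use chart_param \<Phi>_chart(3)[OF _ _ \<sigma>] in \<open>auto simp: Box\<close>)
      show "continuous_on ?V (G \<sigma> n)"
        by (rule continuous_on_eq[of _ "\<lambda>_. 0"]) (use e0 in \<open>auto simp: G_def\<close>)
    qed
    then show ?thesis unfolding UV .
  qed
  have iG: "G \<sigma> n absolutely_integrable_on Box" if \<sigma>: "\<sigma> = 1 \<or> \<sigma> = -1" for \<sigma> n
    unfolding Box_def
    by (rule absolutely_integrable_continuous) (use cG[OF \<sigma>] in \<open>simp add: Box_def\<close>)
  have half: "((\<lambda>x. if x \<in> E \<sigma> then q n x else 0) has_integral integral Box (G \<sigma> n)) UNIV"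
    if \<sigma>: "\<sigma> = 1 \<or> \<sigma> = -1" for \<sigma> n
  proof -
    define \<Phi>' where "\<Phi>' v h = (h $ 1) *\<^sub>R \<gamma>' (v $ 1) + (\<sigma> * (h $ 2 / real (Suc n))) *\<^sub>R N\<^sub>0" for v h :: "real^2"
    have d\<Phi>: "(\<Phi> \<sigma> n has_derivative \<Phi>' v) (at v within Box)" if "v \<in> Box" for v
    proof -
      have v1: "v $ 1 \<in> {0..1}" using that chart_param by (auto simp: Box)
      have "((\<lambda>v. v $ 1) has_derivative (\<lambda>h. h $ 1)) (at v within Box)"
        by (rule bounded_linear_imp_has_derivative[OF bounded_linear_vec_nth])
      from has_derivative_compose[OF this curve_deriv[OF v1, unfolded has_vector_derivative_def]]
      have 1: "((\<lambda>v. \<gamma> (v $ 1)) has_derivative (\<lambda>h. h $ 1 *\<^sub>R \<gamma>' (v $ 1))) (at v within Box)" .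
      have 2: "((\<lambda>v. v $ 2) has_derivative (\<lambda>h. h $ 2)) (at v within Box)"
        by (rule bounded_linear_imp_has_derivative[OF bounded_linear_vec_nth])
      show ?thesis
        unfolding \<Phi>_def \<Phi>'_def by (auto intro!: derivative_eq_intros 1 2)
    qed
    have inj: "inj_on (\<Phi> \<sigma> n) Box"
    proof (rule inj_onI)
      fix v w assume "v \<in> Box" "w \<in> Box" "\<Phi> \<sigma> n v = \<Phi> \<sigma> n w"
      then have "v $ 1 = w $ 1" "\<sigma> * (v $ 2 / real (Suc n)) = \<sigma> * (w $ 2 / real (Suc n))"
        using chart_inj[of "v $ 1" "w $ 1"] unfolding \<Phi>_def Box by blast+
      then show "v = w" using \<sigma> by (auto simp: vec_eq_iff forall_2)
    qed
    have J: "\<bar>det (matrix (\<Phi>' v))\<bar> * q n (\<Phi> \<sigma> n v) = G \<sigma> n v" if v: "v \<in> Box" for v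
    proof (cases "\<Phi> \<sigma> n v \<in> B")
      case True
      have v1: "v $ 1 \<in> {0..1}" "v $ 1 \<in> {a..b}" using v chart_param by (auto simp: Box)
      define t where "t = tangent (v $ 1)"
      have tp: "t \<bullet> tangent s\<^sub>0 > 0" using tangent_pos[OF v1(2)] by (simp add: t_def)
      have "det (matrix (\<Phi>' v)) = (\<sigma> / real (Suc n)) * (len * (t \<bullet> tangent s\<^sub>0))"
        unfolding det_2 matrix_def \<Phi>'_def curve_deriv_eq[OF v1(1)] t_def[symmetric]
        by (simp add: axis_def normal_plus_eq_rot inner_real2 algebra_simps)
      then have det: "\<bar>det (matrix (\<Phi>' v))\<bar> = len * (t \<bullet> tangent s\<^sub>0) / real (Suc n)"
        using \<sigma> tp len by (auto simp: abs_mult)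
      have q: "q n (\<Phi> \<sigma> n v) = \<eta> (\<Phi> \<sigma> n v) * (real (Suc n) * S' (\<sigma> * v $ 2)) *
          ((normal (v $ 1) \<bullet> F (\<Phi> \<sigma> n v)) / (t \<bullet> tangent s\<^sub>0))"
        using True \<Phi>_chart(1,2)[OF v True \<sigma>] by (simp add: q_def g\<psi>_def t_def)
      show ?thesis unfolding det q G_def using tp by (simp add: field_simps del: of_nat_Suc)
    next
      case False
      then have "\<eta> (\<Phi> \<sigma> n v) = 0" using sub by (intro e0) blast
      then show ?thesis using False by (simp add: q_def G_def)
    qed
    have int: "(\<lambda>v. \<bar>det (matrix (\<Phi>' v))\<bar> * q n (\<Phi> \<sigma> n v)) absolutely_integrable_on Box"
      using iG[OF \<sigma>, of n] by (subst set_integrable_cong[OF refl refl J]) auto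
    have "Box \<in> sets lebesgue" by (simp add: Box_def)
    from change_of_variables_scalar[OF this d\<Phi> inj int]
    have "(q n has_integral integral Box (G \<sigma> n)) (\<Phi> \<sigma> n ` Box)"
      using J by (simp cong: integral_cong)
    then have "((\<lambda>x. if x \<in> \<Phi> \<sigma> n ` Box then q n x else 0) has_integral integral Box (G \<sigma> n)) UNIV"
      by (simp add: has_integral_restrict_UNIV)
    moreover have "(if x \<in> \<Phi> \<sigma> n ` Box then q n x else 0) = (if x \<in> E \<sigma> then q n x else 0)" for x
    proof (cases "q n x = 0")
      case False
      then have x: "x \<in> B" by (auto simp: q_def split: if_splits)
      have "x \<in> E \<sigma> \<Longrightarrow> x \<in> \<Phi> \<sigma> n ` Box"
      proof -
        assume "x \<in> E \<sigma>"
        then have pos: "\<sigma> * \<psi> x > 0" by (simp add: E_def)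
        define v :: "real^2" where "v = vector [\<tau> x, real (Suc n) * (\<sigma> * \<psi> x)]"
        have "\<not> \<bar>real (Suc n) * \<psi> x\<bar> \<le> 1" "\<not> \<bar>real (Suc n) * \<psi> x\<bar> \<ge> 2"
          using False S(6,7) x by (auto simp: q_def)
        moreover have "\<bar>real (Suc n) * \<psi> x\<bar> = v $ 2" using \<sigma> pos by (auto simp: v_def abs_mult)
        ultimately have "v \<in> Box" using \<tau>01(2)[OF x] by (simp add: Box v_def)
        moreover have "\<Phi> \<sigma> n v = \<gamma> (\<tau> x) + (\<sigma> * \<sigma> * \<psi> x) *\<^sub>R N\<^sub>0" by (simp add: \<Phi>_def v_def)
        then have "\<Phi> \<sigma> n v = x" using height[OF x] \<sigma> by auto
        ultimately show "x \<in> \<Phi> \<sigma> n ` Box" by blast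
      qed
      moreover have "x \<in> \<Phi> \<sigma> n ` Box \<Longrightarrow> x \<in> E \<sigma>" using \<Phi>_chart(4)[OF _ _ \<sigma>] x by auto
      ultimately show ?thesis by auto
    qed simp
    ultimately show ?thesis by (simp only:)
  qed
  have "integral D (q n) = integral Box (G 1 n) + integral Box (G (-1) n)" for n
  proof -
    have "((\<lambda>x. (if x \<in> E 1 then q n x else 0) + (if x \<in> E (-1) then q n x else 0)) has_integral
        integral Box (G 1 n) + integral Box (G (-1) n)) UNIV"
      by (intro has_integral_add half) auto
    moreover have "(if x \<in> E 1 then q n x else 0) + (if x \<in> E (-1) then q n x else 0)
        = (if x \<in> D then q n x else 0)" for x
      using D_iff[of x] by (cases "x \<in> B") (auto simp: E_def q_def)
    ultimately have "((\<lambda>x. if x \<in> D then q n x else 0) has_integral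
        integral Box (G 1 n) + integral Box (G (-1) n)) UNIV" by (simp only:)
    then have "(q n has_integral integral Box (G 1 n) + integral Box (G (-1) n)) D"
      by (simp add: has_integral_restrict_UNIV)
    then show ?thesis by (rule integral_unique)
  qed
  moreover have lim: "(\<lambda>n. integral Box (G \<sigma> n)) \<longlonglongrightarrow> \<sigma> * integral {a..b} (L \<sigma>)" if \<sigma>: "\<sigma> = 1 \<or> \<sigma> = -1" for \<sigma>
  proof -
    have "(\<lambda>n. integral Box (G \<sigma> n)) \<longlonglongrightarrow> integral Box (\<lambda>v. S' (\<sigma> * v $ 2) * L \<sigma> (v $ 1))"
    proof (rule dominated_convergence(2))
      show "G \<sigma> n integrable_on Box" for n using iG[OF \<sigma>] by (simp add: absolutely_integrable_on_def)
      show "(\<lambda>_. len * \<bar>Emax\<bar> * \<bar>Smax\<bar> * \<bar>M\<bar>) integrable_on Box"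
        unfolding Box_def by (rule integrable_const)
      fix n v assume v: "v \<in> Box"
      have v1: "v $ 1 \<in> {0..1}" "v $ 1 \<in> {a..b}" "v $ 2 \<in> {1..2}" using v chart_param by (auto simp: Box)
      show "norm (G \<sigma> n v) \<le> len * \<bar>Emax\<bar> * \<bar>Smax\<bar> * \<bar>M\<bar>"
      proof (cases "\<Phi> \<sigma> n v \<in> cball (\<gamma> s\<^sub>0) r")
        case True
        then have inB: "\<Phi> \<sigma> n v \<in> B" using sub by blast
        have "\<psi> (\<Phi> \<sigma> n v) \<noteq> 0" using \<Phi>_chart(3)[OF v inB \<sigma>] D_iff[OF inB] by simp
        then have FM: "norm (F (\<Phi> \<sigma> n v)) \<le> \<bar>M\<bar>"
          using M[OF inB] True by (fastforce simp: dist_norm norm_minus_commute)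
        have "\<bar>normal (v $ 1) \<bullet> F (\<Phi> \<sigma> n v)\<bar> \<le> norm (normal (v $ 1)) * norm (F (\<Phi> \<sigma> n v))"
          by (rule Cauchy_Schwarz_ineq2)
        then have 1: "\<bar>normal (v $ 1) \<bullet> F (\<Phi> \<sigma> n v)\<bar> \<le> \<bar>M\<bar>" using FM norm_normal[OF v1(1)] by simp
        have 2: "\<bar>S' (\<sigma> * v $ 2)\<bar> \<le> \<bar>Smax\<bar>" using Smax[of "\<sigma> * v $ 2"] v1 \<sigma> by auto
        have 3: "\<bar>\<eta> (\<Phi> \<sigma> n v)\<bar> \<le> \<bar>Emax\<bar>" using Emax[OF True] by simp
        show ?thesis unfolding G_def real_norm_def abs_mult using len(1) 1 2 3
          by (intro mult_mono mult_nonneg_nonneg) auto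
      next
        case False
        then show ?thesis using e0 len(1) by (simp add: G_def)
      qed
    next
      fix v assume v: "v \<in> Box"
      have v1: "v $ 1 \<in> {0..1}" "v $ 1 \<in> {a..b}" "v $ 2 \<in> {1..2}" using v chart_param by (auto simp: Box)
      define h where "h n = v $ 2 / real (Suc n)" for n
      have h: "h \<longlonglongrightarrow> 0" "\<forall>\<^sub>F n in sequentially. h n > 0"
        unfolding h_def using v1 LIMSEQ_Suc[OF lim_const_over_n[of "v $ 2"]] by auto
      have \<Phi>h: "\<Phi> \<sigma> n v = \<gamma> (v $ 1) + (\<sigma> * h n) *\<^sub>R N\<^sub>0" for n by (simp add: \<Phi>_def h_def)
      have l\<Phi>: "(\<lambda>n. \<Phi> \<sigma> n v) \<longlonglongrightarrow> \<gamma> (v $ 1)"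
        unfolding \<Phi>h using h(1) by (auto intro!: tendsto_eq_intros)
      show "(\<lambda>n. G \<sigma> n v) \<longlonglongrightarrow> S' (\<sigma> * v $ 2) * L \<sigma> (v $ 1)"
      proof (cases "\<gamma> (v $ 1) \<in> B")
        case True
        have lF: "(\<lambda>n. F (\<Phi> \<sigma> n v)) \<longlonglongrightarrow> osv F \<sigma> (v $ 1)"
          unfolding \<Phi>h by (rule one_sided_limit_vertical[OF side \<sigma> v1(1) True h])
        have l\<eta>: "(\<lambda>n. \<eta> (\<Phi> \<sigma> n v)) \<longlonglongrightarrow> \<eta> (\<gamma> (v $ 1))"
          by (rule continuous_on_tendsto_compose[OF c\<eta> l\<Phi>]) auto
        have "(\<lambda>n. G \<sigma> n v) \<longlonglongrightarrow> len * \<eta> (\<gamma> (v $ 1)) * S' (\<sigma> * v $ 2) * (normal (v $ 1) \<bullet> osv F \<sigma> (v $ 1))"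
          unfolding G_def by (intro tendsto_intros lF l\<eta>)
        then show ?thesis by (simp add: L_def mult.commute mult.left_commute)
      next
        case False
        then have out: "\<gamma> (v $ 1) \<in> - cball (\<gamma> s\<^sub>0) r" using sub by blast
        then have "\<forall>\<^sub>F n in sequentially. \<Phi> \<sigma> n v \<in> - cball (\<gamma> s\<^sub>0) r"
          by (intro topological_tendstoD[OF l\<Phi>]) auto
        then have "\<forall>\<^sub>F n in sequentially. G \<sigma> n v = 0"
          by eventually_elim (use e0 in \<open>auto simp: G_def\<close>)
        moreover have "L \<sigma> (v $ 1) = 0" using out e0 by (auto simp: L_def)
        ultimately show ?thesis by (simp add: tendsto_eventually)
      qed
    qed
    moreover have "((\<lambda>v. S' (\<sigma> * v $ 2) * L \<sigma> (v $ 1)) has_integral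
        integral {1..2} (\<lambda>t. S' (\<sigma> * t)) * integral {a..b} (L \<sigma>)) Box"
      unfolding Box_def
      by (rule has_integral_real2_product[OF _ cL[OF \<sigma>]])
        (auto intro!: continuous_intros continuous_on_compose2[OF S(2)])
    moreover have "integral {1..2} (\<lambda>t. S' (\<sigma> * t)) = \<sigma>"
    proof -
      have "((\<lambda>t. S' (\<sigma> * t)) has_integral \<sigma> * S (\<sigma> * 2) - \<sigma> * S (\<sigma> * 1)) {1..2}"
      proof (rule fundamental_theorem_of_calculus)
        fix t :: real
        have "((\<lambda>t. \<sigma> * t) has_real_derivative \<sigma>) (at t)" by (auto intro!: derivative_eq_intros)
        from DERIV_chain2[OF S(1) this]
        have "((\<lambda>t. \<sigma> * S (\<sigma> * t)) has_real_derivative \<sigma> * (S' (\<sigma> * t) * \<sigma>)) (at t)"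
          by (rule DERIV_cmult)
        then have "((\<lambda>t. \<sigma> * S (\<sigma> * t)) has_real_derivative S' (\<sigma> * t)) (at t)"
          using \<sigma> by auto
        then show "((\<lambda>t. \<sigma> * S (\<sigma> * t)) has_vector_derivative S' (\<sigma> * t)) (at t within {1..2})"
          by (simp add: has_real_derivative_iff_has_vector_derivative has_vector_derivative_at_within)
      qed simp
      moreover have "S (\<sigma> * 2) = 1" "S (\<sigma> * 1) = 0" using S(3,4) \<sigma> by auto
      ultimately show ?thesis by (simp add: integral_unique)
    qed
    ultimately show ?thesis by (simp add: integral_unique)
  qed
  have "(\<lambda>n. integral Box (G 1 n) + integral Box (G (-1) n)) \<longlonglongrightarrow>
      1 * integral {a..b} (L 1) + -1 * integral {a..b} (L (-1))"
    by (intro tendsto_add lim) auto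
  ultimately have "(\<lambda>n. integral D (q n)) \<longlonglongrightarrow> integral {a..b} (L 1) - integral {a..b} (L (-1))" by simp
  from LIMSEQ_unique[OF layer this]
  have I: "integral D (\<lambda>x. \<eta> x * divergence F x + g x \<bullet> F x) = integral {a..b} (L (-1)) - integral {a..b} (L 1)"
    by simp
  have eq: "L (-1) s - L 1 s = \<eta> (\<gamma> s) * (jump_vector \<gamma> F s * norm (\<gamma>' s))" if "s \<in> {0..1}" for s
    unfolding jump_vector_def one_sided_value_plus_minus using len(2)[OF that]
    by (simp add: L_def normal_minus_def inner_commute algebra_simps)
  have "((\<lambda>s. L (-1) s - L 1 s) has_integral integral {a..b} (L (-1)) - integral {a..b} (L 1)) {a..b}"
    by (intro has_integral_diff integrable_integral integrable_continuous_interval cL) auto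
  then have "((\<lambda>s. \<eta> (\<gamma> s) * (jump_vector \<gamma> F s * norm (\<gamma>' s))) has_integral
      integral D (\<lambda>x. \<eta> x * divergence F x + g x \<bullet> F x)) {a..b}"
    unfolding I by (rule has_integral_eq[rotated]) (rule eq, rule chart_param(2))
  then have "((\<lambda>s. if s \<in> {a..b} then \<eta> (\<gamma> s) * (jump_vector \<gamma> F s * norm (\<gamma>' s)) else 0) has_integral
      integral D (\<lambda>x. \<eta> x * divergence F x + g x \<bullet> F x)) {0..1}"
    using chart_param(2) by (subst has_integral_restrict) auto
  moreover have "\<eta> (\<gamma> s) = 0" if "s \<in> {0..1}" "s \<notin> {a..b}" for s
  proof -
    have "\<gamma> s \<notin> B" using in_chart[of s] that by auto
    then show ?thesis using sub by (intro e0) blast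
  qed
  then have "(if s \<in> {a..b} then \<eta> (\<gamma> s) * (jump_vector \<gamma> F s * norm (\<gamma>' s)) else 0)
      = \<eta> (\<gamma> s) * (jump_vector \<gamma> F s * norm (\<gamma>' s))" if "s \<in> {0..1}" for s
    using that by simp
  ultimately show ?thesis
    unfolding D_def[symmetric] by (rule has_integral_eq[rotated])
qed

end

section \<open>Insulated smooth boundary\<close>

text \<open>Disjoint translates of a thin layer between two level sets fit into a ball, so that the area of
  the layer is at most proportional to its thickness.\<close>

lemma layer_measure_le:
  fixes \<psi> :: "'a::euclidean_space \<Rightarrow> real"
  assumes \<psi>: "\<And>x. x \<in> ball p R \<Longrightarrow> GDERIV \<psi> x :> g\<psi> x"
    and e: "norm e = 1" and c: "c > 0" "\<And>x. x \<in> ball p R \<Longrightarrow> g\<psi> x \<bullet> e \<ge> c"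
    and r: "r < R" and h: "\<alpha> < \<beta>"
  defines "A \<equiv> {x \<in> cball p r. \<alpha> \<le> \<psi> x \<and> \<psi> x \<le> \<beta>}"
  shows "A \<in> lmeasurable"
    and "measure lebesgue A \<le> 4 * measure lebesgue (ball p R) / (c * (R - r)) * (\<beta> - \<alpha>)"
proof -
  have sub: "cball p r \<subseteq> ball p R" using r by auto
  have c\<psi>: "continuous_on (cball p r) \<psi>"
    by (rule GDERIV_imp_continuous_on[where g=g\<psi>]) (use \<psi> sub in auto)
  have "closed A"
    unfolding A_def using continuous_closed_preimage[OF c\<psi> closed_cball, of "{\<alpha>..\<beta>}"]
    by (simp add: vimage_def Int_def)
  moreover have "A \<subseteq> cball p r" by (auto simp: A_def)
  ultimately have "compact A" by (meson bounded_cball bounded_subset compact_eq_bounded_closed)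
  then show A: "A \<in> lmeasurable" by (rule lmeasurable_compact)
  \<comment> \<open>a translation by \<open>\<delta> e\<close> raises \<open>\<psi>\<close> by at least twice the thickness of the layer\<close>
  define \<delta> where "\<delta> = 2 * (\<beta> - \<alpha>) / c"
  have \<delta>: "\<delta> > 0" using h c by (simp add: \<delta>_def)
  define m where "m = nat \<lfloor>(R - r) / (2 * \<delta>)\<rfloor>"
  have m: "real m \<le> (R - r) / (2 * \<delta>)" "(R - r) / (2 * \<delta>) \<le> real (Suc m)"
  proof -
    have "(R - r) / (2 * \<delta>) \<ge> 0" using r \<delta> by simp
    then have "real m = of_int \<lfloor>(R - r) / (2 * \<delta>)\<rfloor>" by (simp add: m_def)
    then show "real m \<le> (R - r) / (2 * \<delta>)" "(R - r) / (2 * \<delta>) \<le> real (Suc m)"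
      using of_int_floor_le[of "(R - r) / (2 * \<delta>)"] real_of_int_floor_add_one_ge[of "(R - r) / (2 * \<delta>)"]
      by linarith+
  qed
  \<comment> \<open>the disjoint translates; \<open>m\<close> is chosen such that all of them stay in the ball\<close>
  define T where "T j = (+) ((real j * \<delta>) *\<^sub>R e) ` A" for j :: nat
  have shift: "x + (real j * \<delta>) *\<^sub>R e \<in> ball p R" if "x \<in> A" "j \<le> m" for x j
  proof -
    have "real j * \<delta> \<le> real m * \<delta>" using that \<delta> by simp
    also have "\<dots> \<le> (R - r) / 2" using m(1) \<delta> by (simp add: field_simps)
    finally have "real j * \<delta> < R - r" using r by simp
    moreover have "norm (x + (real j * \<delta>) *\<^sub>R e - p) \<le> norm (x - p) + norm ((real j * \<delta>) *\<^sub>R e)"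
      by (metis add_diff_eq add.commute diff_add_eq norm_triangle_ineq)
    moreover have "norm ((real j * \<delta>) *\<^sub>R e) = real j * \<delta>" using e \<delta> by simp
    moreover have "norm (x - p) \<le> r" using that by (auto simp: A_def dist_norm norm_minus_commute)
    ultimately show ?thesis by (simp add: dist_norm norm_minus_commute)
  qed
  have disj: "disjnt (T i) (T j)" if "i < j" "j \<le> m" for i j
    unfolding disjnt_iff
  proof (intro allI notI)
    fix z assume "z \<in> T i \<and> z \<in> T j"
    then obtain x y where xy: "x \<in> A" "y \<in> A" "z = x + (real i * \<delta>) *\<^sub>R e" "z = y + (real j * \<delta>) *\<^sub>R e"
      by (auto simp: T_def add.commute)
    define l where "l = (real j - real i) * \<delta>"
    have l: "l \<ge> \<delta>" using that \<delta> by (simp add: l_def)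
    have "x = z - (real i * \<delta>) *\<^sub>R e" "z = y + (real j * \<delta>) *\<^sub>R e" using xy by (auto simp: algebra_simps)
    then have x: "x = y + l *\<^sub>R e" by (simp add: l_def algebra_simps)
    have xB: "x \<in> ball p R" "y \<in> ball p R" using xy(1,2) sub by (auto simp: A_def)
    have d: "DERIV (\<lambda>t. \<psi> (y + t *\<^sub>R e)) t :> g\<psi> (y + t *\<^sub>R e) \<bullet> e" and inB: "y + t *\<^sub>R e \<in> ball p R"
      if t: "0 \<le> t" "t \<le> l" for t
    proof -
      have "(1 - t / l) *\<^sub>R y + (t / l) *\<^sub>R x \<in> ball p R"
        by (rule convexD_alt[OF convex_ball xB(2,1)]) (use t l \<delta> in auto)
      moreover have "(1 - t / l) *\<^sub>R y + (t / l) *\<^sub>R x = y + t *\<^sub>R e"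
        using l \<delta> by (simp add: x algebra_simps)
      ultimately show inB: "y + t *\<^sub>R e \<in> ball p R" by simp
      have "((\<lambda>t. y + t *\<^sub>R e) has_derivative (\<lambda>h. h *\<^sub>R e)) (at t)"
        by (auto intro!: derivative_eq_intros)
      from has_derivative_compose[OF this \<psi>[OF inB, unfolded gderiv_def]]
      show "DERIV (\<lambda>t. \<psi> (y + t *\<^sub>R e)) t :> g\<psi> (y + t *\<^sub>R e) \<bullet> e"
        by (simp add: has_field_derivative_def mult_commute_abs inner_commute)
    qed
    obtain t where t: "0 < t" "t < l" "\<psi> (y + l *\<^sub>R e) - \<psi> (y + 0 *\<^sub>R e) = (l - 0) * (g\<psi> (y + t *\<^sub>R e) \<bullet> e)"
      using MVT2[of 0 l "\<lambda>t. \<psi> (y + t *\<^sub>R e)" "\<lambda>t. g\<psi> (y + t *\<^sub>R e) \<bullet> e"] d l \<delta> by auto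
    have "l * (g\<psi> (y + t *\<^sub>R e) \<bullet> e) \<ge> \<delta> * c"
      using l \<delta> c(2)[OF inB[of t]] c(1) t by (intro mult_mono) auto
    moreover have "\<delta> * c = 2 * (\<beta> - \<alpha>)" using c by (simp add: \<delta>_def)
    ultimately have "\<psi> x - \<psi> y \<ge> 2 * (\<beta> - \<alpha>)" using t(3) x by simp
    then show False using xy(1,2) h by (auto simp: A_def)
  qed
  have Tm: "T j \<in> lmeasurable" "measure lebesgue (T j) = measure lebesgue A" for j
    unfolding T_def using A by (auto simp: measurable_translation measure_translation)
  have "measure lebesgue (\<Union> (T ` {..m})) = (\<Sum>j\<in>{..m}. measure lebesgue (T j))"
  proof (rule measure_finite_Union)
    show "disjoint_family_on T {..m}"
      unfolding disjoint_family_on_def using disj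
      by (metis atMost_iff disjnt_def inf_commute linorder_neqE_nat)
    show "T ` {..m} \<subseteq> sets lebesgue" using Tm by (auto intro: fmeasurableD)
    show "emeasure lebesgue (T j) \<noteq> \<infinity>" for j
      using Tm(1)[of j] unfolding fmeasurable_def by auto
  qed simp
  also have "\<dots> = real (Suc m) * measure lebesgue A" by (simp add: Tm)
  finally have "real (Suc m) * measure lebesgue A = measure lebesgue (\<Union> (T ` {..m}))" by simp
  also have "\<dots> \<le> measure lebesgue (ball p R)"
    by (rule measure_mono_fmeasurable) (use shift Tm in \<open>auto simp: T_def add.commute intro: fmeasurableD\<close>)
  finally have "real (Suc m) * measure lebesgue A \<le> measure lebesgue (ball p R)" .
  moreover have "(R - r) / (2 * \<delta>) * measure lebesgue A \<le> real (Suc m) * measure lebesgue A"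
    using m(2) by (intro mult_right_mono) auto
  ultimately have "(R - r) / (2 * \<delta>) * measure lebesgue A \<le> measure lebesgue (ball p R)" by linarith
  then have "measure lebesgue A \<le> measure lebesgue (ball p R) * (2 * \<delta>) / (R - r)"
    using r \<delta> by (simp add: field_simps)
  also have "\<dots> = 4 * measure lebesgue (ball p R) / (c * (R - r)) * (\<beta> - \<alpha>)"
    using c by (simp add: \<delta>_def)
  finally show "measure lebesgue A \<le> 4 * measure lebesgue (ball p R) / (c * (R - r)) * (\<beta> - \<alpha>)" .
qed

context flux_field
begin

text \<open>The flux through the layer is at most its supremum in the layer, times \<open>n\<close> for the gradient of the
cutoff, times the area of the layer. The last two factors compensate each other, and the first tends to zero by compactness.\<close>

lemma boundary_flux_identity:
  assumes \<eta>: "C1_with_gradient \<eta> g" and supp: "\<And>x. norm (x - p) > r \<Longrightarrow> \<eta> x = 0" and r: "r < R"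
    and \<psi>: "\<And>x. x \<in> ball p R \<Longrightarrow> GDERIV \<psi> x :> g\<psi> x" "continuous_on (ball p R) g\<psi>"
    and inside: "\<And>x. x \<in> ball p R \<Longrightarrow> x \<in> D \<longleftrightarrow> \<psi> x < 0"
    and e: "norm e = 1" and c: "c > 0" "\<And>x. x \<in> ball p R \<Longrightarrow> g\<psi> x \<bullet> e \<ge> c"
    and flux: "\<And>y. y \<in> ball p R \<Longrightarrow> \<psi> y = 0 \<Longrightarrow> ((\<lambda>x. g\<psi> x \<bullet> F x) \<longlongrightarrow> 0) (at y within D)"
  shows "integral D (\<lambda>x. \<eta> x * divergence F x + g x \<bullet> F x) = 0"
proof -
  obtain S S' :: "real \<Rightarrow> real" where
    S: "\<And>t. (S has_real_derivative S' t) (at t)" "continuous_on UNIV S'"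
    "\<And>t. \<bar>t\<bar> \<le> 1 \<Longrightarrow> S t = 0" "\<And>t. \<bar>t\<bar> \<ge> 2 \<Longrightarrow> S t = 1" "\<And>t. \<bar>S t\<bar> \<le> 1"
    "\<And>t. \<bar>t\<bar> \<le> 1 \<Longrightarrow> S' t = 0" "\<And>t. \<bar>t\<bar> \<ge> 2 \<Longrightarrow> S' t = 0"
    using exists_layer_profile by blast
  define q where "q n x = (if x \<in> ball p R then \<eta> x * (real (Suc n) * S' (real (Suc n) * \<psi> x)) * (g\<psi> x \<bullet> F x) else 0)" for n x
  have layer: "q n integrable_on D"
    "(\<lambda>n. integral D (q n)) \<longlonglongrightarrow> - integral D (\<lambda>x. \<eta> x * divergence F x + g x \<bullet> F x)" for n
    unfolding q_def
    by (rule layer_limit[where S=S and T="{..<0}", OF \<eta> supp r \<psi>]; use inside S in simp)+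
  have c\<psi>: "continuous_on (ball p R) \<psi>"
    by (rule GDERIV_imp_continuous_on[where g=g\<psi>]) (use \<psi> in auto)
  have sub: "cball p r \<subseteq> ball p R" using r by auto
  have e0: "\<eta> x = 0" if "x \<notin> cball p r" for x
    using that by (intro supp) (auto simp: dist_norm norm_minus_commute)
  obtain Smax where Smax: "\<And>t. t \<in> {-2..2} \<Longrightarrow> \<bar>S' t\<bar> \<le> Smax"
  proof -
    have "compact (S' ` {-2..2})" by (intro compact_continuous_image continuous_on_subset[OF S(2)]) auto
    from compact_imp_bounded[OF this] obtain e where "\<forall>y\<in>S' ` {-2..2}. norm y \<le> e"
      unfolding bounded_iff by blast
    then show thesis by (intro that[of e]) auto
  qed
  have Smax0: "Smax \<ge> 0" using Smax[of 0] by auto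
  obtain Emax where Emax: "Emax \<ge> 0" "\<And>x. x \<in> closure D \<Longrightarrow> \<bar>\<eta> x\<bar> \<le> Emax"
    using test_bounded[OF \<eta>] by metis
  define A where "A n = {x \<in> cball p r. - 2 / real (Suc n) \<le> \<psi> x \<and> \<psi> x \<le> - 1 / real (Suc n)}" for n
  have qA: "x \<in> A n" if "x \<in> D" "q n x \<noteq> 0" for n x
  proof -
    have x: "x \<in> ball p R" "x \<in> cball p r" using that e0[of x] by (auto simp: q_def split: if_splits)
    have "\<psi> x < 0" using inside x that by blast
    moreover have "\<not> \<bar>real (Suc n) * \<psi> x\<bar> \<le> 1" "\<not> \<bar>real (Suc n) * \<psi> x\<bar> \<ge> 2"
      using that S(6,7) x by (auto simp: q_def)
    ultimately have "- (real (Suc n) * \<psi> x) \<ge> 1" "- (real (Suc n) * \<psi> x) \<le> 2"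
      by (auto simp: abs_mult simp del: of_nat_Suc)
    then show ?thesis using x by (simp add: A_def field_simps del: of_nat_Suc)
  qed
  define C where "C = 4 * measure lebesgue (ball p R) / (c * (R - r))"
  have A: "A n \<in> lmeasurable" "measure lebesgue (A n) \<le> C * (1 / real (Suc n))" for n
  proof -
    have lt: "- 2 / real (Suc n) < - 1 / real (Suc n)" by (rule divide_strict_right_mono) auto
    have eq: "- 1 / real (Suc n) - - 2 / real (Suc n) = 1 / real (Suc n)"
      by (simp add: diff_divide_distrib[symmetric] del: of_nat_Suc)
    show "A n \<in> lmeasurable"
      unfolding A_def by (rule layer_measure_le(1)[OF \<psi>(1) e c r lt])
    show "measure lebesgue (A n) \<le> C * (1 / real (Suc n))"
      using layer_measure_le(2)[OF \<psi>(1) e c r lt] unfolding eq A_def C_def .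
  qed
  have C0: "C \<ge> 0" using c r by (auto simp: C_def)
  have small: "\<exists>N. \<forall>n\<ge>N. \<forall>x\<in>A n. \<bar>g\<psi> x \<bullet> F x\<bar> \<le> \<epsilon>" if "\<epsilon> > 0" for \<epsilon>
  proof (rule ccontr)
    assume "\<not> ?thesis"
    then have "\<forall>N. \<exists>n\<ge>N. \<exists>x\<in>A n. \<bar>g\<psi> x \<bullet> F x\<bar> > \<epsilon>" by (meson not_le)
    then obtain k x where k: "\<And>N. k N \<ge> N" "\<And>N. x N \<in> A (k N)" "\<And>N. \<bar>g\<psi> (x N) \<bullet> F (x N)\<bar> > \<epsilon>"
      by metis
    have "x N \<in> cball p r" for N using k(2) by (auto simp: A_def)
    then obtain y \<rho> where y: "y \<in> cball p r" "strict_mono \<rho>" "(x \<circ> \<rho>) \<longlonglongrightarrow> y"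
      using compact_cball[of p r] unfolding compact_def by metis
    have yB: "y \<in> ball p R" using y sub by blast
    have xB: "x N \<in> ball p R" for N using k(2)[of N] r by (auto simp: A_def)
    have neg: "\<psi> (x N) < 0" for N
    proof -
      have "\<psi> (x N) \<le> - 1 / real (Suc (k N))" using k(2)[of N] by (simp add: A_def)
      also have "\<dots> < 0" by simp
      finally show ?thesis .
    qed
    have "(\<lambda>N. \<psi> ((x \<circ> \<rho>) N)) \<longlonglongrightarrow> \<psi> y"
      by (rule continuous_on_tendsto_compose[OF c\<psi> y(3) yB]) (simp add: xB[simplified])
    moreover have "(\<lambda>N. \<psi> ((x \<circ> \<rho>) N)) \<longlonglongrightarrow> 0"
    proof (rule Lim_null_comparison)
      show "\<forall>\<^sub>F N in sequentially. norm (\<psi> ((x \<circ> \<rho>) N)) \<le> 2 / real (Suc N)"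
      proof (rule always_eventually, rule allI)
        fix N
        have "\<bar>\<psi> (x (\<rho> N))\<bar> \<le> 2 / real (Suc (k (\<rho> N)))"
          using k(2)[of "\<rho> N"] neg[of "\<rho> N"] by (simp add: A_def)
        also have "\<dots> \<le> 2 / real (Suc N)"
          using k(1)[of "\<rho> N"] seq_suble[OF y(2), of N] by (intro divide_left_mono) auto
        finally show "norm (\<psi> ((x \<circ> \<rho>) N)) \<le> 2 / real (Suc N)" by simp
      qed
      show "(\<lambda>N. 2 / real (Suc N)) \<longlonglongrightarrow> 0" using LIMSEQ_Suc[OF lim_const_over_n[of 2]] by simp
    qed
    ultimately have y0: "\<psi> y = 0" using LIMSEQ_unique by blast
    have "filterlim (x \<circ> \<rho>) (at y within D) sequentially"
      unfolding filterlim_at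
    proof
      show "\<forall>\<^sub>F N in sequentially. (x \<circ> \<rho>) N \<in> D \<and> (x \<circ> \<rho>) N \<noteq> y"
        using inside[OF xB] neg y0 by (intro always_eventually) (metis comp_apply less_irrefl)
    qed (rule y(3))
    from filterlim_compose[OF flux[OF yB y0] this]
    have "(\<lambda>N. g\<psi> (x (\<rho> N)) \<bullet> F (x (\<rho> N))) \<longlonglongrightarrow> 0" by simp
    from tendstoD[OF this \<open>\<epsilon> > 0\<close>] obtain N where "\<bar>g\<psi> (x (\<rho> N)) \<bullet> F (x (\<rho> N))\<bar> < \<epsilon>"
      by (auto simp: eventually_sequentially)
    then show False using k(3)[of "\<rho> N"] by simp
  qed
  have bound: "norm (integral D (q n)) \<le> Emax * Smax * \<epsilon> * C"
    if \<epsilon>: "\<epsilon> > 0" "\<And>x. x \<in> A n \<Longrightarrow> \<bar>g\<psi> x \<bullet> F x\<bar> \<le> \<epsilon>" for n \<epsilon>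
  proof -
    define K where "K = Emax * (real (Suc n) * Smax) * \<epsilon>"
    have K0: "K \<ge> 0" using Emax Smax0 \<epsilon> by (simp add: K_def)
    have iA: "((\<lambda>x. K * indicator (A n) x) has_integral K * measure lebesgue (A n)) UNIV"
      using A(1)[of n] by (intro has_integral_mult_right) (simp add: lmeasurable_iff_has_integral)
    have "norm (integral UNIV (\<lambda>x. if x \<in> D then q n x else 0)) \<le> integral UNIV (\<lambda>x. K * indicator (A n) x)"
    proof (rule Henstock_Kurzweil_Integration.integral_norm_bound_integral)
      show "(\<lambda>x. if x \<in> D then q n x else 0) integrable_on UNIV"
        using layer(1) by (simp add: integrable_restrict_UNIV)
      show "(\<lambda>x. K * indicator (A n) x) integrable_on UNIV"
        using iA by blast
      fix x
      show "norm (if x \<in> D then q n x else 0) \<le> K * indicator (A n) x"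
      proof (cases "x \<in> D \<and> q n x \<noteq> 0")
        case True
        then have xA: "x \<in> A n" using qA by blast
        have xD: "x \<in> closure D" using True closure_subset by blast
        have xB: "x \<in> ball p R" using xA sub by (auto simp: A_def)
        have "real (Suc n) * \<psi> x \<in> {-2..2}"
        proof -
          have "- 2 / real (Suc n) \<le> \<psi> x" "\<psi> x \<le> - 1 / real (Suc n)" using xA by (auto simp: A_def)
          then have "- 2 \<le> real (Suc n) * \<psi> x" "real (Suc n) * \<psi> x \<le> - 1"
            by (simp_all add: field_simps del: of_nat_Suc)
          then show ?thesis by simp
        qed
        then have "norm (q n x) \<le> Emax * (real (Suc n) * Smax) * \<epsilon>"
          using xB Smax[of "real (Suc n) * \<psi> x"] Emax(2)[OF xD] \<epsilon>(2)[OF xA] Emax(1) Smax0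
          unfolding q_def by (auto simp: abs_mult simp del: of_nat_Suc intro!: mult_mono)
        then show ?thesis using True xA by (simp add: K_def)
      next
        case False
        then show ?thesis using K0 by auto
      qed
    qed
    also have "\<dots> = K * measure lebesgue (A n)"
      using iA by (rule integral_unique)
    also have "\<dots> \<le> K * (C * (1 / real (Suc n)))" using A(2) K0 by (intro mult_left_mono)
    also have "\<dots> = Emax * Smax * \<epsilon> * C" by (simp add: K_def field_simps del: of_nat_Suc)
    finally show ?thesis by (simp add: integral_restrict_UNIV)
  qed
  have "(\<lambda>n. integral D (q n)) \<longlonglongrightarrow> 0"
    unfolding tendsto_iff eventually_sequentially
  proof (intro allI impI)
    fix \<epsilon> :: real assume "\<epsilon> > 0"
    define \<epsilon>' where "\<epsilon>' = \<epsilon> / (2 * (Emax * Smax * C + 1))"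
    have pos: "Emax * Smax * C + 1 > 0" using Emax Smax0 C0 by (simp add: add_nonneg_pos)
    then have \<epsilon>': "\<epsilon>' > 0" using \<open>\<epsilon> > 0\<close> by (simp add: \<epsilon>'_def)
    have "Emax * Smax * \<epsilon>' * C \<le> (Emax * Smax * C + 1) * \<epsilon>'" using \<epsilon>' by (simp add: algebra_simps)
    also have "\<dots> = \<epsilon> / 2" using pos unfolding \<epsilon>'_def by (simp add: divide_simps)
    also have "\<dots> < \<epsilon>" using \<open>\<epsilon> > 0\<close> by simp
    finally show "\<exists>N. \<forall>n\<ge>N. dist (integral D (q n)) 0 < \<epsilon>"
      using small[OF \<epsilon>'] bound[OF \<epsilon>'] by (force simp: dist_norm)
  qed
  from LIMSEQ_unique[OF layer(2) this] show ?thesis by simp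
qed

end

section \<open>From local to global flux identities\<close>

lemma exists_bump:
  fixes p :: "'a::euclidean_space"
  assumes "r > 0"
  obtains \<beta> g\<beta> where "C1_with_gradient \<beta> g\<beta>" "\<And>x. 0 \<le> \<beta> x \<and> \<beta> x \<le> 1"
    "\<And>x. norm (x - p) \<le> r / 2 \<Longrightarrow> \<beta> x = 1" "\<And>x. norm (x - p) > r \<Longrightarrow> \<beta> x = 0"
proof -
  obtain S S' :: "real \<Rightarrow> real" where
    S: "\<And>x. (S has_real_derivative S' x) (at x)" "continuous_on UNIV S'"
    "\<And>x. x \<le> 0 \<Longrightarrow> S x = 0" "\<And>x. x \<ge> 1 \<Longrightarrow> S x = 1"
    "\<And>x. 0 \<le> S x" "\<And>x. S x \<le> 1"
    using exists_smooth_step by metis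
  \<comment> \<open>the argument of the step below runs from 0 at distance \<open>r / 2\<close> to 1 at distance \<open>r\<close>\<close>
  define k where "k = 4 / (3 * r\<^sup>2)"
  have k: "k > 0" using assms by (simp add: k_def)
  have C1: "C1_with_gradient (\<lambda>x. k * (norm (x - p))\<^sup>2 - 1 / 3) (\<lambda>x. k *\<^sub>R 2 *\<^sub>R (x - p))"
    using C1_with_gradient_diff[OF C1_with_gradient_mult[OF C1_with_gradient_const[of k]
          C1_with_gradient_dist_square[of p]] C1_with_gradient_const[of "1/3"]] by simp
  let ?\<beta> = "\<lambda>x. 1 - S (k * (norm (x - p))\<^sup>2 - 1 / 3)"
  show thesis
  proof (rule that[of ?\<beta>])
    show "C1_with_gradient ?\<beta> (\<lambda>x. 0 - S' (k * (norm (x - p))\<^sup>2 - 1 / 3) *\<^sub>R k *\<^sub>R 2 *\<^sub>R (x - p))"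
      by (intro C1_with_gradient_diff C1_with_gradient_const C1_with_gradient_compose[OF C1] S)
    show "0 \<le> ?\<beta> x \<and> ?\<beta> x \<le> 1" for x using S by simp
    show "?\<beta> x = 1" if "norm (x - p) \<le> r / 2" for x
    proof -
      have "k * (norm (x - p))\<^sup>2 \<le> k * (r / 2)\<^sup>2" using that k by (intro mult_left_mono power_mono) auto
      also have "\<dots> = 1 / 3" using assms by (simp add: k_def power2_eq_square)
      finally show ?thesis using S by simp
    qed
    show "?\<beta> x = 0" if "norm (x - p) > r" for x
    proof -
      have "k * (norm (x - p))\<^sup>2 \<ge> k * r\<^sup>2" using that k assms by (intro mult_left_mono power_mono) auto
      also have "k * r\<^sup>2 = 4 / 3" using assms by (simp add: k_def)
      finally show ?thesis using S by simp
    qed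
  qed
qed

text \<open>In the plane, a gradient of order \<open>n\<close> on a disc of radius of order \<open>1/n\<close> has bounded square integral; this
  is the property of the following cutoffs on which the removal of single points rests.\<close>

lemma exists_puncture:
  fixes p :: "'a::euclidean_space"
  obtains C \<omega> g\<omega> where "C \<ge> 0" "\<And>n. C1_with_gradient (\<omega> n) (g\<omega> n)" "\<And>n x. 0 \<le> \<omega> n x \<and> \<omega> n x \<le> (1::real)"
    "\<And>n x. norm (x - p) \<le> 1 / real (Suc n) \<Longrightarrow> \<omega> n x = 0"
    "\<And>n x. norm (x - p) \<ge> 2 / real (Suc n) \<Longrightarrow> \<omega> n x = 1"
    "\<And>n x. norm (g\<omega> n x) \<le> C * real (Suc n)"
    "\<And>n x. norm (x - p) \<ge> 2 / real (Suc n) \<Longrightarrow> g\<omega> n x = 0"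
proof -
  obtain S S' :: "real \<Rightarrow> real" where
    S: "\<And>x. (S has_real_derivative S' x) (at x)" "continuous_on UNIV S'"
    "\<And>x. x \<le> 0 \<Longrightarrow> S x = 0" "\<And>x. x \<ge> 1 \<Longrightarrow> S x = 1"
    "\<And>x. 0 \<le> S x" "\<And>x. S x \<le> 1"
    "\<And>x. x \<le> 0 \<Longrightarrow> S' x = 0" "\<And>x. x \<ge> 1 \<Longrightarrow> S' x = 0"
    using exists_smooth_step by metis
  have "compact (S' ` {0..1})" by (intro compact_continuous_image continuous_on_subset[OF S(2)]) auto
  from compact_imp_bounded[OF this] obtain M where M: "\<forall>y\<in>S' ` {0..1}. norm y \<le> M"
    unfolding bounded_iff by blast
  have S'M: "\<bar>S' t\<bar> \<le> \<bar>M\<bar>" for t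
  proof (cases "t \<in> {0..1}")
    case True
    then have "norm (S' t) \<le> M" using M by blast
    then show ?thesis by simp
  next
    case False
    then have "S' t = 0" using S(7)[of t] S(8)[of t] by force
    then show ?thesis by simp
  qed
  define k where "k n = real (Suc n)" for n
  have k: "k n > 0" for n by (simp add: k_def)
  define u where "u n x = (k n)\<^sup>2 * (norm (x - p))\<^sup>2 - 1" for n x
  have C1: "C1_with_gradient (u n) (\<lambda>x. (k n)\<^sup>2 *\<^sub>R 2 *\<^sub>R (x - p))" for n
    unfolding u_def using C1_with_gradient_diff[OF C1_with_gradient_mult[OF C1_with_gradient_const[of "(k n)\<^sup>2"]
          C1_with_gradient_dist_square[of p]] C1_with_gradient_const[of 1]] by simp
  define g\<omega> where "g\<omega> n x = S' (u n x) *\<^sub>R (k n)\<^sup>2 *\<^sub>R 2 *\<^sub>R (x - p)" for n x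
  have ue: "u n x = (k n * norm (x - p))\<^sup>2 - 1" for n x by (simp add: u_def power_mult_distrib)
  have u1: "u n x \<le> 0" if "norm (x - p) \<le> 1 / real (Suc n)" for n x
  proof -
    have "k n * norm (x - p) \<le> 1" using that k[of n] by (simp add: k_def field_simps del: of_nat_Suc)
    then show ?thesis unfolding ue using k[of n] by (simp add: power_le_one)
  qed
  have u2: "u n x \<ge> 1" if "k n * norm (x - p) \<ge> 2" for n x
    using power_mono[OF that, of 2] unfolding ue by simp
  have u2': "u n x \<ge> 1" if "norm (x - p) \<ge> 2 / real (Suc n)" for n x
    by (rule u2) (use that in \<open>simp add: k_def field_simps del: of_nat_Suc\<close>)
  show thesis
  proof (rule that[of "4 * \<bar>M\<bar>" "\<lambda>n x. S (u n x)" g\<omega>])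
    show "C1_with_gradient (\<lambda>x. S (u n x)) (g\<omega> n)" for n
      unfolding g\<omega>_def by (rule C1_with_gradient_compose[OF C1]) (use S in auto)
    show "norm (g\<omega> n x) \<le> 4 * \<bar>M\<bar> * real (Suc n)" for n x
    proof (cases "k n * norm (x - p) \<ge> 2")
      case True
      then show ?thesis using u2[OF True] S(8) by (simp add: g\<omega>_def)
    next
      case False
      have "norm (g\<omega> n x) = \<bar>S' (u n x)\<bar> * (2 * k n * (k n * norm (x - p)))"
        using k[of n] by (simp add: g\<omega>_def power2_eq_square abs_mult)
      also have "\<dots> \<le> \<bar>M\<bar> * (2 * k n * 2)"
        using False k[of n] S'M by (intro mult_mono mult_left_mono) auto
      finally show ?thesis by (simp add: k_def algebra_simps)
    qed
    show "norm (x - p) \<ge> 2 / real (Suc n) \<Longrightarrow> g\<omega> n x = 0" for n x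
      using u2'[of n x] S(8) by (simp add: g\<omega>_def)
  qed (use S u1 u2' in auto)
qed

context flux_field
begin

text \<open>The flux \<open>j\<close> through the curve is an arbitrary function, so that its values at the two ends of the
curve can be chosen freely.\<close>

definition flux_identity :: "(real \<Rightarrow> 'a) \<Rightarrow> (real \<Rightarrow> real) \<Rightarrow> ('a \<Rightarrow> real) \<Rightarrow> ('a \<Rightarrow> 'a) \<Rightarrow> bool" where
  "flux_identity \<gamma> j \<eta> g \<longleftrightarrow>
     ((\<lambda>s. \<eta> (\<gamma> s) * j s) has_integral integral D (\<lambda>x. \<eta> x * divergence F x + g x \<bullet> F x)) {0..1}"

lemma flux_identity_add:
  assumes "C1_with_gradient \<eta> g" "C1_with_gradient \<eta>' g'" "flux_identity \<gamma> j \<eta> g" "flux_identity \<gamma> j \<eta>' g'"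
  shows "flux_identity \<gamma> j (\<lambda>x. \<eta> x + \<eta>' x) (\<lambda>x. g x + g' x)"
proof -
  have "integral D (\<lambda>x. (\<eta> x * divergence F x + g x \<bullet> F x) + (\<eta>' x * divergence F x + g' x \<bullet> F x))
      = integral D (\<lambda>x. \<eta> x * divergence F x + g x \<bullet> F x) + integral D (\<lambda>x. \<eta>' x * divergence F x + g' x \<bullet> F x)"
    using assms(1,2)[THEN test_integrand_absolutely_integrable]
    by (intro integral_add) (auto simp: absolutely_integrable_on_def)
  then show ?thesis
    using has_integral_add[OF assms(3,4)[unfolded flux_identity_def]]
    by (simp add: flux_identity_def algebra_simps inner_add_left)
qed

lemma flux_identity_zero:
  assumes \<eta>: "C1_with_gradient \<eta> g" "\<And>x. x \<in> closure D \<Longrightarrow> \<eta> x = 0" and \<gamma>: "\<gamma> ` {0..1} \<subseteq> closure D"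
  shows "flux_identity \<gamma> j \<eta> g"
proof -
  have "g x = 0" if "x \<in> D" for x
    by (rule C1_with_gradient_zero_outside[OF \<eta>(1) open_D _ that]) (use \<eta>(2) closure_subset in blast)
  then have "integral D (\<lambda>x. \<eta> x * divergence F x + g x \<bullet> F x) = integral D (\<lambda>_. 0)"
    using \<eta>(2) closure_subset by (intro integral_cong) (auto simp: subset_eq)
  moreover have "((\<lambda>s. \<eta> (\<gamma> s) * j s) has_integral 0) {0..1}"
    by (rule has_integral_is_0) (use \<eta>(2) \<gamma> in \<open>auto simp: image_subset_iff\<close>)
  ultimately show ?thesis by (simp add: flux_identity_def)
qed

text \<open>Removing a point costs nothing in the plane: the gradient of the puncture is square integrable with a
  common bound, and the square integral of the field over the shrinking disc tends to zero.\<close>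

lemma puncture_error_tendsto_0:
  assumes dim: "DIM('a) = 2" and F2: "(\<lambda>x. (norm (F x))\<^sup>2) integrable_on D" and p: "p \<notin> D"
    and C: "C \<ge> 0" and \<omega>: "\<And>n. C1_with_gradient (\<omega> n) (g\<omega> n)" and \<eta>: "C1_with_gradient \<eta> g"
    and bound: "\<And>n x. norm (g\<omega> n x) \<le> C * real (Suc n)"
    and supp: "\<And>n x. norm (x - p) \<ge> 2 / real (Suc n) \<Longrightarrow> g\<omega> n x = 0"
  shows "(\<lambda>n. integral D (\<lambda>x. \<eta> x * (g\<omega> n x \<bullet> F x))) \<longlonglongrightarrow> 0"
    and "(\<lambda>x. \<eta> x * (g\<omega> n x \<bullet> F x)) integrable_on D"
proof -
  obtain E where E: "E \<ge> 0" "\<And>x. x \<in> closure D \<Longrightarrow> \<bar>\<eta> x\<bar> \<le> E"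
    using test_bounded[OF \<eta>] by metis
  have cF: "continuous_on D F" using C1_field_continuous[OF C1_F] .
  define U where "U n = ball p (2 / real (Suc n))" for n
  define f where "f n x = \<eta> x * (g\<omega> n x \<bullet> F x)" for n x
  have f_le: "\<bar>f n x\<bar> \<le> E * (C * real (Suc n) * norm (F x))" if "x \<in> D" for n x
  proof -
    have "\<bar>g\<omega> n x \<bullet> F x\<bar> \<le> norm (g\<omega> n x) * norm (F x)" by (rule Cauchy_Schwarz_ineq2)
    also have "\<dots> \<le> C * real (Suc n) * norm (F x)" using bound by (intro mult_right_mono) auto
    finally show ?thesis
      unfolding f_def abs_mult using E that closure_subset by (intro mult_mono) auto
  qed
  have f0: "f n x = 0" if "x \<notin> U n" for n x
    using supp[of n x] that by (auto simp: f_def U_def dist_norm norm_minus_commute)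
  have int_f: "f n integrable_on D" for n
  proof -
    have "f n absolutely_integrable_on D"
    proof (rule continuous_bounded_absolutely_integrable[OF open_D])
      show "continuous_on D (f n)"
        unfolding f_def using \<omega>[of n] C1_with_gradient_continuous[OF \<eta>] cF
        by (intro continuous_on_mult continuous_on_inner) (auto simp: C1_with_gradient_def intro: continuous_on_subset)
      show "(\<lambda>x. E * (C * real (Suc n) * norm (F x))) integrable_on D"
        using int_F by (intro integrable_on_mult_right) (simp add: absolutely_integrable_on_def)
    qed (use f_le in auto)
    then show ?thesis by (simp add: absolutely_integrable_on_def)
  qed
  show "(\<lambda>x. \<eta> x * (g\<omega> n x \<bullet> F x)) integrable_on D" using int_f[of n] unfolding f_def .
  define V where "V = unit_ball_vol (real DIM('a)) * 4"
  have V: "V \<ge> 0" by (simp add: V_def)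
  have mU: "U n \<in> lmeasurable" "measure lebesgue (U n) = V / (real (Suc n))\<^sup>2" for n
    unfolding U_def using content_ball[of "2 / real (Suc n)" p]
    by (auto simp: V_def dim power_divide measure_completion)
  have F2U: "(\<lambda>x. indicator (U n) x * (norm (F x))\<^sup>2) integrable_on D" for n
  proof -
    have "(\<lambda>x. (norm (F x))\<^sup>2) absolutely_integrable_on D"
      using F2 by (intro nonnegative_absolutely_integrable_1) auto
    then have "(\<lambda>x. indicator (U n) x *\<^sub>R (norm (F x))\<^sup>2) absolutely_integrable_on D"
      unfolding set_integrable_def
      using integrable_mult_indicator[of "U n" lebesgue "\<lambda>x. indicator D x *\<^sub>R (norm (F x))\<^sup>2"] mU(1)
      by (simp add: fmeasurableD mult.left_commute)
    then show ?thesis by (simp add: absolutely_integrable_on_def)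
  qed
  have lim: "(\<lambda>n. integral D (\<lambda>x. indicator (U n) x * (norm (F x))\<^sup>2)) \<longlonglongrightarrow> integral D (\<lambda>_. 0)"
  proof (rule dominated_convergence(2)[OF F2U F2])
    show "norm (indicator (U n) x * (norm (F x))\<^sup>2) \<le> (norm (F x))\<^sup>2" for n x
      by (simp add: indicator_def)
    fix x assume "x \<in> D"
    then have "norm (x - p) > 0" using p by auto
    then obtain N where N: "real N > 2 / norm (x - p)" using reals_Archimedean2 by blast
    have "x \<notin> U n" if "n \<ge> N" for n
    proof -
      have "2 / norm (x - p) < real (Suc n)" using N that by linarith
      then have "2 / real (Suc n) < norm (x - p)" using \<open>norm (x - p) > 0\<close> by (simp add: field_simps del: of_nat_Suc)
      then show ?thesis by (simp add: U_def dist_norm norm_minus_commute)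
    qed
    then have "\<forall>\<^sub>F n in sequentially. indicator (U n) x * (norm (F x))\<^sup>2 = 0"
      unfolding eventually_sequentially by force
    then show "(\<lambda>n. indicator (U n) x * (norm (F x))\<^sup>2) \<longlonglongrightarrow> 0" by (rule tendsto_eventually)
  qed
  \<comment> \<open>from \<open>p q \<le> \<mu> p\<^sup>2 + q\<^sup>2 / \<mu>\<close>; the first term is small with \<open>\<mu>\<close>, the second with \<open>1 / n\<close>\<close>
  have est: "\<bar>integral D (f n)\<bar> \<le> E * (C\<^sup>2 * V * \<mu> + integral D (\<lambda>x. indicator (U n) x * (norm (F x))\<^sup>2) / \<mu>)"
    if \<mu>: "\<mu> > 0" for n \<mu>
  proof -
    define k where "k = real (Suc n)"
    have k: "k > 0" by (simp add: k_def)
    have iU: "((\<lambda>x. indicator (U n) x :: real) has_integral measure lebesgue (U n \<inter> D)) D"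
    proof -
      have "U n \<inter> D \<in> lmeasurable" using mU(1) open_D by (intro fmeasurable_Int_fmeasurable) auto
      then have "((\<lambda>x. indicator (U n \<inter> D) x :: real) has_integral measure lebesgue (U n \<inter> D)) UNIV"
        by (simp add: lmeasurable_iff_has_integral)
      moreover have "(\<lambda>x. indicator (U n \<inter> D) x :: real) = (\<lambda>x. if x \<in> D then indicator (U n) x else 0)"
        by (auto simp: indicator_def)
      ultimately show ?thesis by (simp add: has_integral_restrict_UNIV)
    qed
    have mle: "measure lebesgue (U n \<inter> D) \<le> V / k\<^sup>2"
      unfolding k_def mU(2)[symmetric] using mU(1) open_D by (intro measure_mono_fmeasurable) auto
    let ?h = "\<lambda>x. (E * C\<^sup>2 * k\<^sup>2 * \<mu>) * indicator (U n) x + (E / \<mu>) * (indicator (U n) x * (norm (F x))\<^sup>2)"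
    have ih: "(?h has_integral (E * C\<^sup>2 * k\<^sup>2 * \<mu>) * measure lebesgue (U n \<inter> D)
        + (E / \<mu>) * integral D (\<lambda>x. indicator (U n) x * (norm (F x))\<^sup>2)) D"
      by (intro has_integral_add has_integral_mult_right iU integrable_integral F2U)
    have "\<bar>integral D (f n)\<bar> \<le> integral D ?h"
      unfolding real_norm_def[symmetric]
    proof (rule Henstock_Kurzweil_Integration.integral_norm_bound_integral[OF int_f])
      show "?h integrable_on D" using ih by blast
      fix x assume x: "x \<in> D"
      show "norm (f n x) \<le> ?h x"
      proof (cases "x \<in> U n")
        case True
        have "C * k * norm (F x) \<le> C\<^sup>2 * k\<^sup>2 * \<mu> + (norm (F x))\<^sup>2 / \<mu>"
        proof -
          have "0 \<le> (C * k * \<mu> - norm (F x))\<^sup>2 + (C * k * \<mu>) * norm (F x)"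
            using C k \<mu> by (intro add_nonneg_nonneg mult_nonneg_nonneg) auto
          then have "C * k * norm (F x) * \<mu> \<le> C\<^sup>2 * k\<^sup>2 * \<mu> * \<mu> + (norm (F x))\<^sup>2"
            by (simp add: power2_eq_square algebra_simps)
          then show ?thesis using \<mu> by (simp add: field_simps)
        qed
        then have "E * (C * k * norm (F x)) \<le> E * (C\<^sup>2 * k\<^sup>2 * \<mu> + (norm (F x))\<^sup>2 / \<mu>)"
          using E(1) by (rule mult_left_mono)
        then show ?thesis using f_le[OF x, of n] True by (simp add: k_def algebra_simps)
      next
        case False
        then show ?thesis using f0 by simp
      qed
    qed
    also have "\<dots> = (E * C\<^sup>2 * k\<^sup>2 * \<mu>) * measure lebesgue (U n \<inter> D)
        + (E / \<mu>) * integral D (\<lambda>x. indicator (U n) x * (norm (F x))\<^sup>2)"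
      using ih by (rule integral_unique)
    also have "(E * C\<^sup>2 * k\<^sup>2 * \<mu>) * measure lebesgue (U n \<inter> D) \<le> (E * C\<^sup>2 * k\<^sup>2 * \<mu>) * (V / k\<^sup>2)"
      using mle E(1) \<mu> by (intro mult_left_mono) auto
    also have "(E * C\<^sup>2 * k\<^sup>2 * \<mu>) * (V / k\<^sup>2) = E * (C\<^sup>2 * V * \<mu>)" using k by simp
    finally show ?thesis by (simp add: algebra_simps)
  qed
  have "(\<lambda>n. integral D (f n)) \<longlonglongrightarrow> 0"
    unfolding tendsto_iff
  proof (intro allI impI)
    fix \<epsilon> :: real assume \<epsilon>: "\<epsilon> > 0"
    define \<mu> where "\<mu> = \<epsilon> / (2 * (E * C\<^sup>2 * V + 1))"
    have pos: "E * C\<^sup>2 * V + 1 > 0" using E(1) V by (simp add: add_nonneg_pos)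
    have \<mu>: "\<mu> > 0" using pos \<epsilon> by (simp add: \<mu>_def)
    have "E * (C\<^sup>2 * V * \<mu>) \<le> (E * C\<^sup>2 * V + 1) * \<mu>" using \<mu> by (simp add: algebra_simps)
    also have "\<dots> = \<epsilon> / 2" using pos unfolding \<mu>_def by (simp add: divide_simps)
    finally have 1: "E * (C\<^sup>2 * V * \<mu>) \<le> \<epsilon> / 2" .
    have "(\<lambda>n. (E / \<mu>) * integral D (\<lambda>x. indicator (U n) x * (norm (F x))\<^sup>2)) \<longlonglongrightarrow> (E / \<mu>) * integral D (\<lambda>_. 0::real)"
      by (intro tendsto_intros lim)
    from order_tendstoD(2)[OF this, of "\<epsilon> / 2"] \<epsilon>
    have "\<forall>\<^sub>F n in sequentially. (E / \<mu>) * integral D (\<lambda>x. indicator (U n) x * (norm (F x))\<^sup>2) < \<epsilon> / 2"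
      by simp
    then show "\<forall>\<^sub>F n in sequentially. dist (integral D (f n)) 0 < \<epsilon>"
    proof eventually_elim
      case (elim n)
      have "E * (C\<^sup>2 * V * \<mu> + integral D (\<lambda>x. indicator (U n) x * (norm (F x))\<^sup>2) / \<mu>)
          = E * (C\<^sup>2 * V * \<mu>) + E / \<mu> * integral D (\<lambda>x. indicator (U n) x * (norm (F x))\<^sup>2)"
        by (simp add: distrib_left)
      then have "\<bar>integral D (f n)\<bar> < \<epsilon>" using est[OF \<mu>, of n] 1 elim by linarith
      then show ?case by (simp add: dist_norm)
    qed
  qed
  then show "(\<lambda>n. integral D (\<lambda>x. \<eta> x * (g\<omega> n x \<bullet> F x))) \<longlonglongrightarrow> 0" by (simp add: f_def[abs_def])
qed

text \<open>At most one parameter is mapped to the point, so the integral along the curve does not notice the puncture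
in the limit; the error in the domain is \<open>puncture_error_tendsto_0\<close>.\<close>

lemma flux_identity_remove_point:
  assumes dim: "DIM('a) = 2" and F2: "(\<lambda>x. (norm (F x))\<^sup>2) integrable_on D" and p: "p \<notin> D"
    and j: "j absolutely_integrable_on {0..1}"
    and \<gamma>: "continuous_on {0..1} \<gamma>" "inj_on \<gamma> {0..1}" "\<gamma> ` {0..1} \<subseteq> closure D"
    and \<eta>: "C1_with_gradient \<eta> g"
    and *: "\<And>\<omega> g\<omega> \<rho>. C1_with_gradient \<omega> g\<omega> \<Longrightarrow> \<rho> > 0 \<Longrightarrow> (\<And>x. norm (x - p) \<le> \<rho> \<Longrightarrow> \<omega> x = 0) \<Longrightarrow>
        flux_identity \<gamma> j (\<lambda>x. \<eta> x * \<omega> x) (\<lambda>x. \<eta> x *\<^sub>R g\<omega> x + \<omega> x *\<^sub>R g x)"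
  shows "flux_identity \<gamma> j \<eta> g"
proof -
  obtain C \<omega> g\<omega> where \<omega>: "C \<ge> 0" "\<And>n. C1_with_gradient (\<omega> n) (g\<omega> n)" "\<And>n x. 0 \<le> \<omega> n x \<and> \<omega> n x \<le> (1::real)"
    "\<And>n x. norm (x - p) \<le> 1 / real (Suc n) \<Longrightarrow> \<omega> n x = 0"
    "\<And>n x. norm (x - p) \<ge> 2 / real (Suc n) \<Longrightarrow> \<omega> n x = 1"
    "\<And>n x. norm (g\<omega> n x) \<le> C * real (Suc n)"
    "\<And>n x. norm (x - p) \<ge> 2 / real (Suc n) \<Longrightarrow> g\<omega> n x = 0"
    using exists_puncture[of p] by metis
  obtain E where E: "E \<ge> 0" "\<And>x. x \<in> closure D \<Longrightarrow> \<bar>\<eta> x\<bar> \<le> E"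
    using test_bounded[OF \<eta>] by metis
  have \<omega>lim: "(\<lambda>n. \<omega> n x) \<longlonglongrightarrow> 1" if "x \<noteq> p" for x
  proof -
    have "norm (x - p) > 0" using that by simp
    then obtain N where N: "real N > 2 / norm (x - p)" using reals_Archimedean2 by blast
    have "\<omega> n x = 1" if "n \<ge> N" for n
    proof -
      have "2 / norm (x - p) < real (Suc n)" using N that by linarith
      then have "2 / real (Suc n) \<le> norm (x - p)" using \<open>norm (x - p) > 0\<close> by (simp add: field_simps del: of_nat_Suc)
      then show ?thesis by (rule \<omega>(5))
    qed
    then have "\<forall>\<^sub>F n in sequentially. \<omega> n x = 1" unfolding eventually_sequentially by blast
    then show ?thesis by (rule tendsto_eventually)
  qed
  define A where "A x = \<eta> x * divergence F x + g x \<bullet> F x" for x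
  have iA: "A absolutely_integrable_on D"
    unfolding A_def by (rule test_integrand_absolutely_integrable[OF \<eta>])
  define y where "y n = integral D (\<lambda>x. (\<eta> x * \<omega> n x) * divergence F x + (\<eta> x *\<^sub>R g\<omega> n x + \<omega> n x *\<^sub>R g x) \<bullet> F x)" for n
  have y: "((\<lambda>s. (\<eta> (\<gamma> s) * \<omega> n (\<gamma> s)) * j s) has_integral y n) {0..1}" for n
    using *[OF \<omega>(2), of "1 / real (Suc n)" n] \<omega>(4) unfolding flux_identity_def y_def by simp
  have A\<omega>: "(\<lambda>x. \<omega> n x * A x) integrable_on D" for n
  proof -
    have "(\<lambda>x. \<omega> n x * A x) absolutely_integrable_on D"
    proof (rule continuous_bounded_absolutely_integrable[OF open_D])
      show "(\<lambda>x. norm (A x)) integrable_on D" using iA by (simp add: absolutely_integrable_on_def)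
      show "norm (\<omega> n x * A x) \<le> norm (A x)" for x
        using \<omega>(3)[of n x] by (simp add: abs_mult mult_left_le_one_le)
      show "continuous_on D (\<lambda>x. \<omega> n x * A x)"
        unfolding A_def using \<eta> C1_with_gradient_continuous[OF \<eta>] C1_with_gradient_continuous[OF \<omega>(2)[of n]]
        by (intro continuous_on_mult continuous_on_add continuous_on_inner
            C1_field_continuous_divergence[OF C1_F] C1_field_continuous[OF C1_F])
          (auto simp: C1_with_gradient_def intro: continuous_on_subset)
    qed
    then show ?thesis by (simp add: absolutely_integrable_on_def)
  qed
  note err = puncture_error_tendsto_0[OF dim F2 p \<omega>(1,2) \<eta> \<omega>(6,7)]
  have y_eq: "y n = integral D (\<lambda>x. \<omega> n x * A x) + integral D (\<lambda>x. \<eta> x * (g\<omega> n x \<bullet> F x))" for n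
  proof -
    have "y n = integral D (\<lambda>x. \<omega> n x * A x + \<eta> x * (g\<omega> n x \<bullet> F x))"
      unfolding y_def by (intro integral_cong) (simp add: A_def algebra_simps inner_add_left)
    also have "\<dots> = integral D (\<lambda>x. \<omega> n x * A x) + integral D (\<lambda>x. \<eta> x * (g\<omega> n x \<bullet> F x))"
      by (rule integral_add[OF A\<omega> err(2)])
    finally show ?thesis .
  qed
  have "(\<lambda>n. integral D (\<lambda>x. \<omega> n x * A x)) \<longlonglongrightarrow> integral D A"
  proof (rule dominated_convergence(2)[OF A\<omega>])
    show "(\<lambda>x. norm (A x)) integrable_on D" using iA by (simp add: absolutely_integrable_on_def)
    show "norm (\<omega> n x * A x) \<le> norm (A x)" for n x
      using \<omega>(3)[of n x] by (simp add: abs_mult mult_left_le_one_le)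
    fix x assume "x \<in> D"
    then have "x \<noteq> p" using p by blast
    then have "(\<lambda>n. \<omega> n x * A x) \<longlonglongrightarrow> 1 * A x" by (intro tendsto_intros \<omega>lim)
    then show "(\<lambda>n. \<omega> n x * A x) \<longlonglongrightarrow> A x" by simp
  qed
  from tendsto_add[OF this err(1)] have ylim: "y \<longlonglongrightarrow> integral D A" unfolding y_eq[abs_def] by simp
  define Z where "Z = {s \<in> {0..1}. \<gamma> s = p}"
  have "finite Z"
  proof (cases "Z = {}")
    case False
    then obtain s where "s \<in> Z" by blast
    then have "Z \<subseteq> {s}" using \<gamma>(2) unfolding inj_on_def Z_def by blast
    then show ?thesis by (rule finite_subset) simp
  qed simp
  have "((\<lambda>s. \<eta> (\<gamma> s) * (if s \<in> Z then 0 else j s)) has_integral integral D A) {0..1}"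
  proof (rule has_integral_dominated_convergence[OF y _ _ _ ylim])
    show "(\<lambda>s. E * norm (j s)) integrable_on {0..1}"
      using j by (intro integrable_on_mult_right) (simp add: absolutely_integrable_on_def)
    show "\<forall>s\<in>{0..1}. norm (\<eta> (\<gamma> s) * \<omega> n (\<gamma> s) * j s) \<le> E * norm (j s)" for n
    proof
      fix s :: real assume "s \<in> {0..1}"
      then have "\<bar>\<eta> (\<gamma> s)\<bar> \<le> E" using \<gamma>(3) by (intro E(2)) auto
      then have "\<bar>\<eta> (\<gamma> s)\<bar> * \<bar>\<omega> n (\<gamma> s)\<bar> \<le> E * 1" using \<omega>(3)[of n "\<gamma> s"] E(1) by (intro mult_mono) auto
      then show "norm (\<eta> (\<gamma> s) * \<omega> n (\<gamma> s) * j s) \<le> E * norm (j s)"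
        by (simp add: abs_mult mult_right_mono)
    qed
    show "\<forall>s\<in>{0..1}. (\<lambda>n. \<eta> (\<gamma> s) * \<omega> n (\<gamma> s) * j s) \<longlonglongrightarrow> \<eta> (\<gamma> s) * (if s \<in> Z then 0 else j s)"
    proof
      fix s :: real assume s: "s \<in> {0..1}"
      show "(\<lambda>n. \<eta> (\<gamma> s) * \<omega> n (\<gamma> s) * j s) \<longlonglongrightarrow> \<eta> (\<gamma> s) * (if s \<in> Z then 0 else j s)"
      proof (cases "s \<in> Z")
        case True
        then have "\<omega> n (\<gamma> s) = 0" for n by (intro \<omega>(4)) (simp add: Z_def)
        then show ?thesis using True by simp
      next
        case False
        then have "\<gamma> s \<noteq> p" using s by (simp add: Z_def)
        then have "(\<lambda>n. \<eta> (\<gamma> s) * \<omega> n (\<gamma> s) * j s) \<longlonglongrightarrow> \<eta> (\<gamma> s) * 1 * j s" by (intro tendsto_intros \<omega>lim)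
        then show ?thesis using False by simp
      qed
    qed
  qed
  then have "((\<lambda>s. \<eta> (\<gamma> s) * j s) has_integral integral D A) {0..1}"
    by (rule has_integral_spike_finite[OF \<open>finite Z\<close>, rotated]) auto
  then show ?thesis by (simp add: flux_identity_def A_def[abs_def])
qed

text \<open>Away from \<open>P\<close>, a test function is split by the bumps of a finite cover, one ball at a time: \<open>\<beta> \<eta>\<close> is
supported in the ball and \<open>(1 - \<beta>) \<eta>\<close> in the union of the others. The points of \<open>P\<close> are then removed one by one.\<close>

lemma flux_identity_local_to_global:
  assumes dim: "DIM('a) = 2" and F2: "(\<lambda>x. (norm (F x))\<^sup>2) integrable_on D"
    and j: "j absolutely_integrable_on {0..1}"
    and \<gamma>: "continuous_on {0..1} \<gamma>" "inj_on \<gamma> {0..1}" "\<gamma> ` {0..1} \<subseteq> closure D"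
    and P: "finite P" "P \<inter> D = {}"
    and local: "\<And>p. p \<in> closure D - P \<Longrightarrow> \<exists>r>0. \<forall>\<eta> g. C1_with_gradient \<eta> g \<longrightarrow>
        (\<forall>x. norm (x - p) > r \<longrightarrow> \<eta> x = 0) \<longrightarrow> flux_identity \<gamma> j \<eta> g"
  shows "(j has_integral integral D (divergence F)) {0..1}"
proof -
  obtain r where r: "\<And>p. p \<in> closure D - P \<Longrightarrow> r p > 0"
    "\<And>p \<eta> g. p \<in> closure D - P \<Longrightarrow> C1_with_gradient \<eta> g \<Longrightarrow> (\<And>x. norm (x - p) > r p \<Longrightarrow> \<eta> x = 0) \<Longrightarrow>
        flux_identity \<gamma> j \<eta> g"
    using local by metis
  have cover: "flux_identity \<gamma> j \<eta> g"
    if "finite Q" "Q \<subseteq> closure D - P" "C1_with_gradient \<eta> g"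
      "\<And>x. x \<in> closure D \<Longrightarrow> \<eta> x \<noteq> 0 \<Longrightarrow> x \<in> (\<Union>q\<in>Q. ball q (r q / 2))" for Q \<eta> g
    using that
  proof (induction Q arbitrary: \<eta> g rule: finite_induct)
    case empty
    then show ?case by (intro flux_identity_zero \<gamma>(3)) auto
  next
    case (insert q Q)
    have q: "q \<in> closure D - P" using insert.prems by blast
    obtain \<beta> g\<beta> where \<beta>: "C1_with_gradient \<beta> g\<beta>" "\<And>x. 0 \<le> \<beta> x \<and> \<beta> x \<le> 1"
      "\<And>x. norm (x - q) \<le> r q / 2 \<Longrightarrow> \<beta> x = 1" "\<And>x. norm (x - q) > r q \<Longrightarrow> \<beta> x = 0"
      using exists_bump[OF r(1)[OF q], of q] by metis
    note C1 = C1_with_gradient_mult[OF insert.prems(2) \<beta>(1)]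
      C1_with_gradient_mult[OF insert.prems(2) C1_with_gradient_diff[OF C1_with_gradient_const[of 1] \<beta>(1)]]
    have 1: "flux_identity \<gamma> j (\<lambda>x. \<eta> x * \<beta> x) (\<lambda>x. \<eta> x *\<^sub>R g\<beta> x + \<beta> x *\<^sub>R g x)"
      by (rule r(2)[OF q C1(1)]) (simp add: \<beta>(4))
    have 2: "flux_identity \<gamma> j (\<lambda>x. \<eta> x * (1 - \<beta> x)) (\<lambda>x. \<eta> x *\<^sub>R (0 - g\<beta> x) + (1 - \<beta> x) *\<^sub>R g x)"
    proof (rule insert.IH[OF _ C1(2)])
      show "Q \<subseteq> closure D - P" using insert.prems by blast
      fix x assume x: "x \<in> closure D" "\<eta> x * (1 - \<beta> x) \<noteq> 0"
      then have "x \<notin> ball q (r q / 2)" using \<beta>(3)[of x] by (auto simp: dist_norm norm_minus_commute)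
      then show "x \<in> (\<Union>q\<in>Q. ball q (r q / 2))" using insert.prems(3)[OF x(1)] x(2) by auto
    qed
    from flux_identity_add[OF C1 1 2] show ?case by (simp add: algebra_simps)
  qed
  have away: "flux_identity \<gamma> j \<eta> g"
    if \<eta>: "C1_with_gradient \<eta> g" "\<And>p. p \<in> P \<Longrightarrow> \<exists>\<rho>>0. \<forall>x. norm (x - p) \<le> \<rho> \<longrightarrow> \<eta> x = 0" for \<eta> g
  proof -
    obtain \<rho> where \<rho>: "\<And>p. p \<in> P \<Longrightarrow> \<rho> p > 0" "\<And>p x. p \<in> P \<Longrightarrow> norm (x - p) \<le> \<rho> p \<Longrightarrow> \<eta> x = 0"
      using \<eta>(2) by metis
    define K where "K = closure D - (\<Union>p\<in>P. ball p (\<rho> p))"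
    have K: "compact K" unfolding K_def using bounded_D by (intro compact_diff) (auto simp: compact_closure)
    have KP: "K \<subseteq> closure D - P" using \<rho>(1) by (auto simp: K_def)
    have "K \<subseteq> (\<Union>q\<in>K. ball q (r q / 2))" using r(1) KP by force
    then obtain Q where Q: "Q \<subseteq> K" "finite Q" "K \<subseteq> (\<Union>q\<in>Q. ball q (r q / 2))"
      using compactE_image[OF K, of K "\<lambda>q. ball q (r q / 2)"] by (metis open_ball)
    show ?thesis
    proof (rule cover[OF Q(2) _ \<eta>(1)])
      show "Q \<subseteq> closure D - P" using Q KP by blast
      fix x assume x: "x \<in> closure D" "\<eta> x \<noteq> 0"
      have "x \<notin> ball p (\<rho> p)" if "p \<in> P" for p
        using \<rho>(2)[OF that, of x] x(2) by (auto simp: dist_norm norm_minus_commute)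
      then have "x \<in> K" using x(1) by (auto simp: K_def)
      then show "x \<in> (\<Union>q\<in>Q. ball q (r q / 2))" using Q by blast
    qed
  qed
  have "flux_identity \<gamma> j \<eta> g"
    if "P' \<subseteq> P" "C1_with_gradient \<eta> g" "\<And>p. p \<in> P - P' \<Longrightarrow> \<exists>\<rho>>0. \<forall>x. norm (x - p) \<le> \<rho> \<longrightarrow> \<eta> x = 0" for P' \<eta> g
    using finite_subset[OF that(1) P(1)] that
  proof (induction P' arbitrary: \<eta> g rule: finite_induct)
    case empty
    then show ?case by (intro away) auto
  next
    case (insert p P')
    have p: "p \<in> P" "p \<notin> D" using insert.prems P by auto
    show ?case
    proof (rule flux_identity_remove_point[OF dim F2 p(2) j \<gamma> insert.prems(2)])
      fix \<omega> g\<omega> and \<rho> :: real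
      assume \<omega>: "C1_with_gradient \<omega> g\<omega>" "\<rho> > 0" "\<And>x. norm (x - p) \<le> \<rho> \<Longrightarrow> \<omega> x = 0"
      show "flux_identity \<gamma> j (\<lambda>x. \<eta> x * \<omega> x) (\<lambda>x. \<eta> x *\<^sub>R g\<omega> x + \<omega> x *\<^sub>R g x)"
      proof (rule insert.IH)
        show "P' \<subseteq> P" using insert.prems by blast
        show "C1_with_gradient (\<lambda>x. \<eta> x * \<omega> x) (\<lambda>x. \<eta> x *\<^sub>R g\<omega> x + \<omega> x *\<^sub>R g x)"
          by (rule C1_with_gradient_mult[OF insert.prems(2) \<omega>(1)])
        fix p' assume p': "p' \<in> P - P'"
        show "\<exists>\<rho>>0. \<forall>x. norm (x - p') \<le> \<rho> \<longrightarrow> \<eta> x * \<omega> x = 0"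
        proof (cases "p' = p")
          case True
          then show ?thesis using \<omega>(2,3) by auto
        next
          case False
          then show ?thesis using insert.prems(3)[of p'] p' by fastforce
        qed
      qed
    qed
  qed
  from this[of P "\<lambda>_. 1" "\<lambda>_. 0"] have "flux_identity \<gamma> j (\<lambda>_. 1) (\<lambda>_. 0)"
    by (simp add: C1_with_gradient_const)
  then show ?thesis by (simp add: flux_identity_def)
qed

end

section \<open>One-sided values along the slit\<close>

lemma one_sided_value_scaleR:
  fixes f :: "real^2 \<Rightarrow> real" and g :: "real^2 \<Rightarrow> 'b::real_normed_vector"
  assumes "has_side_values \<gamma> f" "has_side_values \<gamma> g"
  shows "has_side_values \<gamma> (\<lambda>x. f x *\<^sub>R g x)"
    and "\<sigma> = 1 \<or> \<sigma> = -1 \<Longrightarrow> s \<in> {0<..<1} \<Longrightarrow>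
      one_sided_value \<gamma> (\<lambda>x. f x *\<^sub>R g x) \<sigma> s = one_sided_value \<gamma> f \<sigma> s *\<^sub>R one_sided_value \<gamma> g \<sigma> s"
proof -
  have *: "side_limit \<gamma> (\<lambda>x. f x *\<^sub>R g x) \<sigma> s (one_sided_value \<gamma> f \<sigma> s *\<^sub>R one_sided_value \<gamma> g \<sigma> s)"
    if "\<sigma> = 1 \<or> \<sigma> = -1" "s \<in> {0<..<1}" for \<sigma> s
    using tendsto_scaleR[OF one_sided_limit_joint[OF assms(1) that] one_sided_limit_joint[OF assms(2) that]]
    by (simp add: side_limit_def case_prod_beta')
  then show "has_side_values \<gamma> (\<lambda>x. f x *\<^sub>R g x)" by (intro has_side_valuesI) blast
  show "\<sigma> = 1 \<or> \<sigma> = -1 \<Longrightarrow> s \<in> {0<..<1} \<Longrightarrow>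
      one_sided_value \<gamma> (\<lambda>x. f x *\<^sub>R g x) \<sigma> s = one_sided_value \<gamma> f \<sigma> s *\<^sub>R one_sided_value \<gamma> g \<sigma> s"
    using * by (rule one_sided_value_eqI)
qed

lemma one_sided_value_inner_const:
  assumes "has_side_values \<gamma> g" "\<sigma> = 1 \<or> \<sigma> = -1" "s \<in> {0<..<1}"
  shows "one_sided_value \<gamma> (\<lambda>x. g x \<bullet> t) \<sigma> s = one_sided_value \<gamma> g \<sigma> s \<bullet> t"
  using tendsto_inner[OF one_sided_limit_joint[OF assms] tendsto_const[of t]]
  by (intro one_sided_value_eqI) (simp add: side_limit_def case_prod_beta')

lemma average_eq: "average \<gamma> g s = (1/2) *\<^sub>R (one_sided_value \<gamma> g (-1) s + one_sided_value \<gamma> g 1 s)"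
  by (simp only: average_def one_sided_value_plus_minus)

lemma tangential_derivative_eq:
  assumes "has_side_values \<gamma> (grad v)" "s \<in> {0<..<1}"
  shows "tangential_derivative \<gamma> v s =
    (one_sided_value \<gamma> (grad v) (-1) s \<bullet> unit_tangent \<gamma> s + one_sided_value \<gamma> (grad v) 1 s \<bullet> unit_tangent \<gamma> s) / 2"
  by (simp add: tangential_derivative_def average_eq one_sided_value_inner_const[OF assms(1) _ assms(2)])

lemma jump_vector_eq: "jump_vector \<gamma> F s = (one_sided_value \<gamma> F (-1) s - one_sided_value \<gamma> F 1 s) \<bullet> normal_plus \<gamma> s"
  by (simp only: jump_vector_def one_sided_value_plus_minus)
    (simp add: normal_minus_def inner_diff_left)

context slit
begin

abbreviation "D \<equiv> \<Omega> - path_image \<gamma>"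

lemma path_image_closed: "closed (path_image \<gamma>)"
  using vasculature unfolding vasculature_def arc_def by (metis closed_path_image)

lemma open_D: "open D"
  using open_\<Omega> path_image_closed by blast

lemma ends_in_frontier: "\<gamma> 0 \<in> frontier \<Omega>" "\<gamma> 1 \<in> frontier \<Omega>"
  using vasculature unfolding vasculature_def by auto

lemma frontier_not_in: "x \<in> frontier \<Omega> \<Longrightarrow> x \<notin> \<Omega>"
  using open_\<Omega> by (simp add: frontier_def interior_open)

lemma path_image_cases: "x \<in> path_image \<gamma> \<Longrightarrow> x = \<gamma> 0 \<or> x = \<gamma> 1 \<or> (\<exists>s\<in>{0<..<1}. x = \<gamma> s)"
  unfolding path_image_def by force

lemma path_image_negligible: "negligible (path_image \<gamma>)"
  unfolding path_image_def
proof (rule negligible_differentiable_image_lowdim)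
  show "\<gamma> differentiable_on {0..1}"
    using vasculature C1_diff_imp_diff unfolding vasculature_def by blast
qed simp

lemma side_limit_continuous:
  assumes f: "continuous_on \<Omega> f" and s: "s \<in> {0<..<1}"
  shows "side_limit \<gamma> f \<sigma> s (f (\<gamma> s))"
proof -
  have s01: "s \<in> interior {0..1}" using s by simp
  have c: "isCont \<gamma> s" "isCont normal s"
    using continuous_on_interior[OF curve_continuous s01] continuous_on_interior[OF normal_continuous s01] .
  let ?F = "at (s, 0::real) within UNIV \<times> {0<..}"
  have f1: "(fst \<longlongrightarrow> s) ?F" and f2: "(snd \<longlongrightarrow> 0) ?F"
    using tendsto_fst[OF tendsto_ident_at[of "(s, 0::real)"]] tendsto_snd[OF tendsto_ident_at[of "(s, 0::real)"]]
    by simp_all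
  have "((\<lambda>z. \<gamma> (fst z) + snd z *\<^sub>R \<sigma> *\<^sub>R normal (fst z)) \<longlongrightarrow> \<gamma> s + 0 *\<^sub>R \<sigma> *\<^sub>R normal s) ?F"
    by (intro tendsto_intros isCont_tendsto_compose[OF c(1) f1] isCont_tendsto_compose[OF c(2) f1] f2)
  then have "((\<lambda>z. \<gamma> (fst z) + snd z *\<^sub>R \<sigma> *\<^sub>R normal (fst z)) \<longlongrightarrow> \<gamma> s) ?F" by simp
  moreover have "isCont f (\<gamma> s)"
    using f open_\<Omega> curve_interior[OF s] by (simp add: continuous_on_eq_continuous_at)
  ultimately have "((\<lambda>z. f (\<gamma> (fst z) + snd z *\<^sub>R \<sigma> *\<^sub>R normal (fst z))) \<longlongrightarrow> f (\<gamma> s)) ?F"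
    by (rule isCont_tendsto_compose[rotated])
  then show ?thesis by (simp add: side_limit_def case_prod_beta')
qed

lemma one_sided_value_in_closed:
  fixes g :: "real^2 \<Rightarrow> 'b::t2_space"
  assumes g: "has_side_values \<gamma> g" and \<sigma>: "\<sigma> = 1 \<or> \<sigma> = -1" and s: "s \<in> {0<..<1}"
    and U: "open U" "\<gamma> s \<in> U" and C: "closed C" "\<And>x. x \<in> D \<Longrightarrow> x \<in> U \<Longrightarrow> g x \<in> C"
  shows "osv g \<sigma> s \<in> C"
proof -
  obtain a b R \<psi> \<tau> where "slit_chart \<Omega> \<gamma> s a b R \<psi> \<tau>" using exists_chart[OF s] .
  then interpret slit_chart \<Omega> \<gamma> s a b R \<psi> \<tau> .
  define h where "h n = 1 / real (Suc n)" for n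
  have h: "h \<longlonglongrightarrow> 0" "\<forall>\<^sub>F n in sequentially. h n > 0"
    unfolding h_def using LIMSEQ_inverse_real_of_nat by (auto simp: inverse_eq_divide)
  have l: "(\<lambda>n. \<gamma> s + (\<sigma> * h n) *\<^sub>R N\<^sub>0) \<longlonglongrightarrow> \<gamma> s"
    using h(1) by (auto intro!: tendsto_eq_intros)
  show ?thesis
  proof (rule Lim_in_closed_set[OF C(1) _ _ one_sided_limit_vertical[OF g \<sigma> s0_in(2,3) h]])
    have "\<forall>\<^sub>F n in sequentially. \<gamma> s + (\<sigma> * h n) *\<^sub>R N\<^sub>0 \<in> U \<inter> B"
      by (rule topological_tendstoD[OF l]) (use U s0_in in auto)
    then show "\<forall>\<^sub>F n in sequentially. g (\<gamma> s + (\<sigma> * h n) *\<^sub>R N\<^sub>0) \<in> C"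
      using h(2)
    proof eventually_elim
      case (elim n)
      have "\<psi> (\<gamma> s + (\<sigma> * h n) *\<^sub>R N\<^sub>0) \<noteq> 0"
        using chart_unique(2)[OF s0_in(1), of "\<sigma> * h n"] elim \<sigma> by auto
      then have "\<gamma> s + (\<sigma> * h n) *\<^sub>R N\<^sub>0 \<in> D"
        using mem_slit_iff[of "\<gamma> s + (\<sigma> * h n) *\<^sub>R N\<^sub>0"] elim(1) ball_sub by auto
      then show ?case using C(2) elim by blast
    qed
  qed simp
qed

lemma closure_D: "\<Omega> \<subseteq> closure D" "closure D \<subseteq> closure \<Omega>" "path_image \<gamma> \<subseteq> closure D"
proof -
  show 1: "\<Omega> \<subseteq> closure D"
  proof
    fix x assume x: "x \<in> \<Omega>"
    show "x \<in> closure D"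
    proof (rule ccontr)
      assume "x \<notin> closure D"
      then have "x \<in> \<Omega> \<inter> - closure D" using x by blast
      moreover have "open (\<Omega> \<inter> - closure D)" using open_\<Omega> by auto
      moreover have "\<Omega> \<inter> - closure D \<subseteq> path_image \<gamma>" using closure_subset[of D] by blast
      ultimately show False
        using open_not_negligible[of "\<Omega> \<inter> - closure D"] negligible_subset[OF path_image_negligible] by blast
    qed
  qed
  show "closure D \<subseteq> closure \<Omega>" by (rule closure_mono) blast
  have "closure \<Omega> \<subseteq> closure D" using 1 by (simp add: closure_minimal)
  moreover have "path_image \<gamma> \<subseteq> closure \<Omega>"
  proof
    fix x assume "x \<in> path_image \<gamma>"
    then consider "x \<in> frontier \<Omega>" | "x \<in> \<Omega>"
      using path_image_cases[of x] ends_in_frontier curve_interior by blast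
    then show "x \<in> closure \<Omega>" using closure_subset[of \<Omega>] by cases (auto simp: frontier_def)
  qed
  ultimately show "path_image \<gamma> \<subseteq> closure D" by blast
qed

text \<open>On the shifted curves \<open>\<gamma> + \<sigma> t N\<^sub>0\<close> the field is differentiable, and close to \<open>s\<close> its derivative along them is
uniformly close to the claimed one. The mean value theorem gives an estimate that survives the limit \<open>t \<rightarrow> 0\<close>.\<close>

lemma one_sided_value_has_derivative:
  assumes v: "has_side_values \<gamma> v" "has_side_values \<gamma> (grad v)" "C1_field v D"
    and \<sigma>: "\<sigma> = 1 \<or> \<sigma> = -1" and s: "s \<in> {0<..<1}"
  shows "(osv v \<sigma> has_real_derivative osv (grad v) \<sigma> s \<bullet> \<gamma>' s) (at s)"
proof -
  obtain a b R \<psi> \<tau> where "slit_chart \<Omega> \<gamma> s a b R \<psi> \<tau>" using exists_chart[OF s] .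
  then interpret slit_chart \<Omega> \<gamma> s a b R \<psi> \<tau> .
  let ?c = "osv (grad v) \<sigma> s \<bullet> \<gamma>' s"
  have s01: "s \<in> interior {0..1}" using s by simp
  have c\<gamma>: "isCont \<gamma> s" "isCont \<gamma>' s"
    using continuous_on_interior[OF curve_continuous s01] continuous_on_interior[OF curve_deriv_continuous s01] .
  have D_iff: "x \<in> D \<longleftrightarrow> \<psi> x \<noteq> 0" if "x \<in> B" for x
    using mem_slit_iff[OF that] ball_sub that by auto
  \<comment> \<open>differentiability at \<open>s\<close> in its \<open>\<epsilon>\<close>-\<open>\<delta>\<close> form\<close>
  have "\<exists>\<delta>>0. \<forall>y. \<bar>y - s\<bar> < \<delta> \<longrightarrow> \<bar>osv v \<sigma> y - osv v \<sigma> s - ?c * (y - s)\<bar> \<le> e * \<bar>y - s\<bar>" if e: "e > 0" for e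
  proof -
    let ?F = "at (\<gamma> s) within {x \<in> B. \<sigma> * \<psi> x > 0}"
    have "((\<lambda>z. grad v (fst z) \<bullet> snd z) \<longlongrightarrow> ?c) (?F \<times>\<^sub>F nhds (\<gamma>' s))"
      by (intro tendsto_inner filterlim_compose[OF one_sided_limit[OF v(2) \<sigma> s0_in(2,3)] filterlim_fst]
          filterlim_snd)
    from tendstoD[OF this e]
    obtain P Q where PQ: "eventually P ?F" "eventually Q (nhds (\<gamma>' s))"
      "\<And>x y. P x \<Longrightarrow> Q y \<Longrightarrow> dist (grad v x \<bullet> y) ?c < e"
      unfolding eventually_prod_filter by auto
    obtain \<delta>1 where \<delta>1: "\<delta>1 > 0" "\<And>x. x \<in> B \<Longrightarrow> \<sigma> * \<psi> x > 0 \<Longrightarrow> dist x (\<gamma> s) < \<delta>1 \<Longrightarrow> x \<noteq> \<gamma> s \<Longrightarrow> P x"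
      using PQ(1) unfolding eventually_at by auto
    have "\<forall>\<^sub>F y in nhds s. Q (\<gamma>' y)"
      by (rule eventually_compose_filterlim[OF PQ(2)])
        (rule tendsto_at_iff_tendsto_nhds[THEN iffD1, OF c\<gamma>(2)[unfolded isCont_def]])
    moreover have "\<forall>\<^sub>F y in nhds s. \<gamma> y \<in> ball (\<gamma> s) (min (R / 2) (\<delta>1 / 2)) \<and> y \<in> {a<..<b}"
    proof (rule eventually_conj)
      have "filterlim \<gamma> (nhds (\<gamma> s)) (nhds s)"
        by (rule tendsto_at_iff_tendsto_nhds[THEN iffD1, OF c\<gamma>(1)[unfolded isCont_def]])
      then show "\<forall>\<^sub>F y in nhds s. \<gamma> y \<in> ball (\<gamma> s) (min (R / 2) (\<delta>1 / 2))"
        by (rule topological_tendstoD) (use R \<delta>1 in auto)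
      show "\<forall>\<^sub>F y in nhds s. y \<in> {a<..<b}"
        by (rule eventually_nhds_in_open) (use ab in auto)
    qed
    ultimately obtain \<delta> where \<delta>: "\<delta> > 0" "\<And>y. dist y s < \<delta> \<Longrightarrow> Q (\<gamma>' y)"
      "\<And>y. dist y s < \<delta> \<Longrightarrow> \<gamma> y \<in> ball (\<gamma> s) (min (R / 2) (\<delta>1 / 2))"  "\<And>y. dist y s < \<delta> \<Longrightarrow> y \<in> {a<..<b}"
      unfolding eventually_nhds_metric by (metis dist_self min_less_iff_conj)
    define t0 where "t0 = min (R / 2) (\<delta>1 / 2)"
    have t0: "t0 > 0" using R \<delta>1 by (simp add: t0_def)
    have NN: "norm N\<^sub>0 = 1" by (rule norm_normal[OF s0_in(2)])
    have pt: "\<gamma> y + (\<sigma> * t) *\<^sub>R N\<^sub>0 \<in> D \<and> P (\<gamma> y + (\<sigma> * t) *\<^sub>R N\<^sub>0)" if "dist y s < \<delta>" "0 < t" "t < t0" for y t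
    proof -
      let ?x = "\<gamma> y + (\<sigma> * t) *\<^sub>R N\<^sub>0"
      have "dist ?x (\<gamma> y) = t" using \<sigma> that NN by (auto simp: dist_norm abs_mult)
      moreover have "dist (\<gamma> y) (\<gamma> s) < t0" using \<delta>(3)[OF that(1)] by (simp add: t0_def dist_commute)
      ultimately have d: "dist ?x (\<gamma> s) < 2 * t0"
        using that dist_triangle[of ?x "\<gamma> s" "\<gamma> y"] by linarith
      have inB: "?x \<in> B" using d by (simp add: t0_def dist_commute)
      have y: "y \<in> {a..b}" using \<delta>(4)[OF that(1)] by auto
      have \<psi>x: "\<psi> ?x = \<sigma> * t" by (rule chart_unique(2)[OF y inB])
      have "\<sigma> * \<psi> ?x > 0" "\<psi> ?x \<noteq> 0" unfolding \<psi>x using \<sigma> that by auto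
      moreover from this have "?x \<noteq> \<gamma> s" using mem_slit_iff[OF s0_in(3)] s0_in(2) by (auto simp: path_image_def)
      ultimately show ?thesis using D_iff[OF inB] \<delta>1(2)[OF inB] d by (simp add: t0_def)
    qed
    have est: "\<bar>v (\<gamma> y + (\<sigma> * t) *\<^sub>R N\<^sub>0) - v (\<gamma> s + (\<sigma> * t) *\<^sub>R N\<^sub>0) - ?c * (y - s)\<bar> \<le> e * \<bar>y - s\<bar>"
      if y: "dist y s < \<delta>" and t: "0 < t" "t < t0" for y t
    proof -
      define w where "w z = v (\<gamma> z + (\<sigma> * t) *\<^sub>R N\<^sub>0) - ?c * z" for z
      have dw: "(w has_real_derivative grad v (\<gamma> z + (\<sigma> * t) *\<^sub>R N\<^sub>0) \<bullet> \<gamma>' z - ?c) (at z)" if z: "dist z s < \<delta>" for z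
      proof -
        have z01: "z \<in> {0..1}" using \<delta>(4)[OF z] ab by auto
        have 1: "((\<lambda>z. \<gamma> z + (\<sigma> * t) *\<^sub>R N\<^sub>0) has_derivative (\<lambda>h. h *\<^sub>R \<gamma>' z)) (at z)"
          using curve_deriv[OF z01] unfolding has_vector_derivative_def
          by (auto intro!: derivative_eq_intros)
        have 2: "GDERIV v (\<gamma> z + (\<sigma> * t) *\<^sub>R N\<^sub>0) :> grad v (\<gamma> z + (\<sigma> * t) *\<^sub>R N\<^sub>0)"
          using pt[OF z t] v(3) by (intro GDERIV_grad) (simp add: C1_field_def)
        from has_derivative_compose[OF 1 2[unfolded gderiv_def]]
        have "((\<lambda>z. v (\<gamma> z + (\<sigma> * t) *\<^sub>R N\<^sub>0)) has_real_derivative grad v (\<gamma> z + (\<sigma> * t) *\<^sub>R N\<^sub>0) \<bullet> \<gamma>' z) (at z)"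
          by (simp add: has_field_derivative_def mult_commute_abs inner_commute)
        then show ?thesis unfolding w_def by (auto intro!: derivative_eq_intros)
      qed
      have "norm (w y - w s) \<le> e * norm (y - s)"
      proof (rule field_differentiable_bound[of "ball s \<delta>" w "\<lambda>z. grad v (\<gamma> z + (\<sigma> * t) *\<^sub>R N\<^sub>0) \<bullet> \<gamma>' z - ?c"])
        show "(w has_field_derivative grad v (\<gamma> z + (\<sigma> * t) *\<^sub>R N\<^sub>0) \<bullet> \<gamma>' z - ?c) (at z within ball s \<delta>)"
          if "z \<in> ball s \<delta>" for z
          using dw[of z] that by (auto simp: dist_commute intro: has_field_derivative_at_within)
        show "norm (grad v (\<gamma> z + (\<sigma> * t) *\<^sub>R N\<^sub>0) \<bullet> \<gamma>' z - ?c) \<le> e" if "z \<in> ball s \<delta>" for z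
          using PQ(3)[of "\<gamma> z + (\<sigma> * t) *\<^sub>R N\<^sub>0" "\<gamma>' z"] pt[of z t] \<delta>(2)[of z] that t
          by (simp add: dist_commute dist_real_def abs_minus_commute less_imp_le)
      qed (use y \<delta> in \<open>auto simp: dist_commute\<close>)
      then show ?thesis by (simp add: w_def algebra_simps)
    qed
    show ?thesis
    proof (intro exI conjI allI impI)
      show "\<delta> > 0" by (rule \<delta>(1))
      fix y assume "\<bar>y - s\<bar> < \<delta>"
      then have y: "dist y s < \<delta>" by (simp add: dist_real_def)
      have y01: "y \<in> {0..1}" using \<delta>(4)[OF y] ab by auto
      have yB: "\<gamma> y \<in> B" using \<delta>(3)[OF y] R by auto
      \<comment> \<open>distances that stay strictly below \<open>t0\<close>, where the estimate holds\<close>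
      define h where "h n = t0 / real (Suc (Suc n))" for n
      have h: "h \<longlonglongrightarrow> 0" "\<And>n. 0 < h n" "\<And>n. h n < t0"
        unfolding h_def using t0 LIMSEQ_Suc[OF LIMSEQ_Suc[OF lim_const_over_n[of t0]]]
        by (auto simp: divide_less_eq)
      have hp: "\<forall>\<^sub>F n in sequentially. h n > 0" using h(2) by simp
      have "(\<lambda>n. \<bar>v (\<gamma> y + (\<sigma> * h n) *\<^sub>R N\<^sub>0) - v (\<gamma> s + (\<sigma> * h n) *\<^sub>R N\<^sub>0) - ?c * (y - s)\<bar>)
          \<longlonglongrightarrow> \<bar>osv v \<sigma> y - osv v \<sigma> s - ?c * (y - s)\<bar>"
        by (intro tendsto_intros one_sided_limit_vertical[OF v(1) \<sigma> y01 yB h(1) hp]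
            one_sided_limit_vertical[OF v(1) \<sigma> s0_in(2,3) h(1) hp])
      then show "\<bar>osv v \<sigma> y - osv v \<sigma> s - ?c * (y - s)\<bar> \<le> e * \<bar>y - s\<bar>"
        by (rule LIMSEQ_le_const2) (use est[OF y h(2,3)] in blast)
    qed
  qed
  then show ?thesis
    unfolding has_field_derivative_def has_derivative_at_alt real_norm_def
    by (simp add: bounded_linear_mult_right)
qed

end

section \<open>Traces of regular fields on the slit\<close>

lemma locally_bounded_imp_bounded:
  fixes f :: "'a::metric_space \<Rightarrow> 'b::real_normed_vector"
  assumes "compact K" "\<And>p. p \<in> K \<Longrightarrow> \<exists>r>0. \<exists>M. \<forall>x\<in>A \<inter> ball p r. norm (f x) \<le> M" "A \<subseteq> K"
  shows "\<exists>M. \<forall>x\<in>A. norm (f x) \<le> M"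
proof -
  obtain r M where r: "\<And>p. p \<in> K \<Longrightarrow> r p > 0" "\<And>p x. p \<in> K \<Longrightarrow> x \<in> A \<inter> ball p (r p) \<Longrightarrow> norm (f x) \<le> M p"
    using assms(2) by metis
  have "K \<subseteq> (\<Union>p\<in>K. ball p (r p))" using r(1) by force
  then obtain Q where Q: "Q \<subseteq> K" "finite Q" "K \<subseteq> (\<Union>q\<in>Q. ball q (r q))"
    using compactE_image[OF assms(1), of K "\<lambda>q. ball q (r q)"] by (metis open_ball)
  have "norm (f x) \<le> (\<Sum>q\<in>Q. \<bar>M q\<bar>)" if x: "x \<in> A" for x
  proof -
    obtain q where q: "q \<in> Q" "x \<in> ball q (r q)" using Q(3) assms(3) x by blast
    then have "norm (f x) \<le> M q" using r(2)[of q x] Q(1) x by blast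
    then have "norm (f x) \<le> \<bar>M q\<bar>" by simp
    also have "\<dots> \<le> (\<Sum>q\<in>Q. \<bar>M q\<bar>)" by (rule member_le_sum[OF q(1)]) (use Q(2) in auto)
    finally show ?thesis .
  qed
  then show ?thesis by blast
qed

lemma tendsto_imp_bounded_near:
  fixes f :: "'a::metric_space \<Rightarrow> 'b::real_normed_vector"
  assumes "(f \<longlongrightarrow> l) (at p within A)"
  shows "\<exists>r>0. \<exists>M. \<forall>x\<in>A \<inter> ball p r. norm (f x) \<le> M"
proof -
  from tendstoD[OF assms zero_less_one] obtain r where r: "r > 0"
    "\<And>x. x \<in> A \<Longrightarrow> x \<noteq> p \<Longrightarrow> dist x p < r \<Longrightarrow> dist (f x) l < 1"
    unfolding eventually_at by blast
  have "norm (f x) \<le> max (norm (f p)) (norm l + 1)" if "x \<in> A \<inter> ball p r" for x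
  proof (cases "x = p")
    case False
    then have "dist (f x) l < 1" using r(2)[of x] that by (auto simp: dist_commute)
    then have "norm (f x) \<le> norm l + 1"
      using norm_triangle_ineq2[of "f x" l] by (simp add: dist_norm)
    then show ?thesis by simp
  qed simp
  then show ?thesis using r(1) by blast
qed

context slit
begin

lemma side_values_imp_bounded_near:
  fixes g :: "real^2 \<Rightarrow> 'b::real_normed_vector"
  assumes g: "has_side_values \<gamma> g" and s: "s \<in> {0<..<1}"
  shows "\<exists>r>0. \<exists>M. \<forall>x\<in>D \<inter> ball (\<gamma> s) r. norm (g x) \<le> M"
proof -
  obtain a b R \<psi> \<tau> where "slit_chart \<Omega> \<gamma> s a b R \<psi> \<tau>" using exists_chart[OF s] .
  then interpret slit_chart \<Omega> \<gamma> s a b R \<psi> \<tau> .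
  have "\<exists>r>0. \<exists>M. \<forall>x\<in>{x \<in> B. \<sigma> * \<psi> x > 0} \<inter> ball (\<gamma> s) r. norm (g x) \<le> M" if "\<sigma> = 1 \<or> \<sigma> = -1" for \<sigma>
    by (rule tendsto_imp_bounded_near[OF one_sided_limit[OF g that s0_in(2,3)]])
  from this[of 1] this[of "-1"] obtain r1 M1 r2 M2 where *:
    "r1 > 0" "\<forall>x\<in>{x \<in> B. 1 * \<psi> x > 0} \<inter> ball (\<gamma> s) r1. norm (g x) \<le> M1"
    "r2 > 0" "\<forall>x\<in>{x \<in> B. -1 * \<psi> x > 0} \<inter> ball (\<gamma> s) r2. norm (g x) \<le> M2"
    by auto
  have b: "norm (g x) \<le> max M1 M2" if "x \<in> D \<inter> ball (\<gamma> s) (min R (min r1 r2))" for x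
  proof -
    have x: "x \<in> B" "x \<in> ball (\<gamma> s) r1" "x \<in> ball (\<gamma> s) r2" using that by auto
    have "\<psi> x \<noteq> 0" using mem_slit_iff[OF x(1)] that by auto
    then have "\<psi> x > 0 \<or> - \<psi> x > 0" by linarith
    then show ?thesis using * x by (auto simp: le_max_iff_disj)
  qed
  show ?thesis
    using R * by (intro exI[of _ "min R (min r1 r2)"] conjI exI[of _ "max M1 M2"] ballI b) auto
qed

end

locale slit_domain = slit +
  fixes \<kappa> :: "real^2 \<Rightarrow> real"
  assumes bounded_\<Omega>: "bounded \<Omega>" and corners: "piecewise_smooth_boundary \<Omega>"
    and \<kappa>_continuous: "continuous_on (closure \<Omega>) \<kappa>"
begin

abbreviation "regular \<equiv> regular_field \<Omega> \<gamma> \<kappa>"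

lemma regularD:
  assumes "regular v"
  shows "continuous_on (closure \<Omega> - \<gamma> ` {0<..<1}) v" "C1_field v D"
    "C1_field (\<lambda>x. \<kappa> x *\<^sub>R grad v x) D" "has_side_values \<gamma> v" "has_side_values \<gamma> (grad v)"
    "(x, n) \<in> smooth_boundary \<Omega> \<gamma> \<Longrightarrow> \<exists>l. (grad v \<longlongrightarrow> l) (at x within D)"
    "(\<lambda>x. (norm (grad v x))\<^sup>2) integrable_on D"
    "(\<lambda>s. tangential_derivative \<gamma> v s * norm (\<gamma>' s)) absolutely_integrable_on {0..1}"
  using assms unfolding regular_field_def by auto

lemma compact_closure_\<Omega>: "compact (closure \<Omega>)"
  using bounded_\<Omega> by (simp add: compact_closure)

lemma D_subset: "D \<subseteq> closure \<Omega> - \<gamma> ` {0<..<1}"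
  using closure_subset[of \<Omega>] by (auto simp: path_image_def)

lemma bounded_D: "bounded D"
  using bounded_\<Omega> by (rule bounded_subset) blast

lemma regular_bounded:
  assumes "regular v"
  shows "\<exists>M. \<forall>x\<in>D. \<bar>v x\<bar> \<le> M"
proof -
  have "\<exists>M. \<forall>x\<in>D. norm (v x) \<le> M"
  proof (rule locally_bounded_imp_bounded[OF compact_closure_\<Omega>])
    show "D \<subseteq> closure \<Omega>" using D_subset by blast
    fix p assume p: "p \<in> closure \<Omega>"
    show "\<exists>r>0. \<exists>M. \<forall>x\<in>D \<inter> ball p r. norm (v x) \<le> M"
    proof (cases "p \<in> \<gamma> ` {0<..<1}")
      case True
      then show ?thesis using side_values_imp_bounded_near[OF regularD(4)[OF assms]] by blast
    next
      case False
      then have "(v \<longlongrightarrow> v p) (at p within closure \<Omega> - \<gamma> ` {0<..<1})"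
        using regularD(1)[OF assms] p by (simp add: continuous_on)
      then have "(v \<longlongrightarrow> v p) (at p within D)" by (rule tendsto_within_subset) (rule D_subset)
      then show ?thesis by (rule tendsto_imp_bounded_near)
    qed
  qed
  then show ?thesis by simp
qed

text \<open>At the two ends the normal line need not meet the domain. There the average gives way to the value of the
  field, which is its limit along the slit.\<close>

definition trace :: "(real^2 \<Rightarrow> real) \<Rightarrow> real \<Rightarrow> real" where
  "trace v s = (if s \<in> {0<..<1} then average \<gamma> v s else v (\<gamma> s))"

definition tangential :: "(real^2 \<Rightarrow> real) \<Rightarrow> real \<Rightarrow> real" where
  "tangential v s = tangential_derivative \<gamma> v s * norm (\<gamma>' s)"

lemma tangential_absolutely_integrable: "regular v \<Longrightarrow> tangential v absolutely_integrable_on {0..1}"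
  using regularD(8) unfolding tangential_def[abs_def] by blast

lemma average_tendsto_end:
  assumes v: "regular v" and e: "e \<in> {0, 1}"
  shows "(average \<gamma> v \<longlongrightarrow> v (\<gamma> e)) (at e within {0<..<1})"
  unfolding tendsto_iff
proof (intro allI impI)
  fix \<epsilon> :: real assume \<epsilon>: "\<epsilon> > 0"
  have e01: "e \<in> {0..1}" using e by auto
  have "\<gamma> e \<in> closure \<Omega> - \<gamma> ` {0<..<1}"
  proof -
    have "\<gamma> e \<in> frontier \<Omega>" using e ends_in_frontier by auto
    then show ?thesis using frontier_not_in curve_interior by (fastforce simp: frontier_def)
  qed
  then have "\<exists>\<delta>>0. \<forall>x\<in>closure \<Omega> - \<gamma> ` {0<..<1}. dist x (\<gamma> e) < \<delta> \<longrightarrow> dist (v x) (v (\<gamma> e)) < \<epsilon> / 2"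
    using regularD(1)[OF v] \<epsilon> unfolding continuous_on_iff by (meson half_gt_zero)
  then obtain \<delta> where \<delta>: "\<delta> > 0" "\<And>x. x \<in> D \<Longrightarrow> dist x (\<gamma> e) < \<delta> \<Longrightarrow> dist (v x) (v (\<gamma> e)) < \<epsilon> / 2"
    using D_subset by blast
  have "(\<gamma> \<longlongrightarrow> \<gamma> e) (at e within {0..1})" using curve_continuous e01 by (simp add: continuous_on)
  then have "(\<gamma> \<longlongrightarrow> \<gamma> e) (at e within {0<..<1})" by (rule tendsto_within_subset) auto
  then have "\<forall>\<^sub>F s in at e within {0<..<1}. \<gamma> s \<in> ball (\<gamma> e) \<delta>"
    by (rule topological_tendstoD) (use \<delta> in auto)
  moreover have "\<forall>\<^sub>F s in at e within {0<..<1}. s \<in> {0<..<1}" by (auto simp: eventually_at intro: exI[of _ 1])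
  ultimately show "\<forall>\<^sub>F s in at e within {0<..<1}. dist (average \<gamma> v s) (v (\<gamma> e)) < \<epsilon>"
  proof eventually_elim
    case (elim s)
    have "osv v \<sigma> s \<in> cball (v (\<gamma> e)) (\<epsilon> / 2)" if "\<sigma> = 1 \<or> \<sigma> = -1" for \<sigma>
      by (rule one_sided_value_in_closed[OF regularD(4)[OF v] that elim(2) _ elim(1)])
        (use \<delta>(2) in \<open>auto simp: dist_commute less_imp_le\<close>)
    from this[of 1] this[of "-1"]
    have "\<bar>osv v 1 s - v (\<gamma> e)\<bar> \<le> \<epsilon> / 2" "\<bar>osv v (-1) s - v (\<gamma> e)\<bar> \<le> \<epsilon> / 2"
      by (auto simp: dist_real_def abs_minus_commute)
    moreover have "\<bar>(y + x) / 2 - z\<bar> < \<epsilon>" if "\<bar>x - z\<bar> \<le> \<epsilon> / 2" "\<bar>y - z\<bar> \<le> \<epsilon> / 2" for x y z :: real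
      using that \<epsilon> unfolding abs_le_iff abs_less_iff by (simp add: field_simps)
    ultimately have "\<bar>(osv v (-1) s + osv v 1 s) / 2 - v (\<gamma> e)\<bar> < \<epsilon>" by blast
    then show ?case by (simp add: average_eq dist_real_def)
  qed
qed

lemma trace_continuous:
  assumes v: "regular v"
  shows "continuous_on {0..1} (trace v)"
  unfolding continuous_on
proof
  fix s :: real assume s: "s \<in> {0..1}"
  have eq: "at s within {0..1} = sup (at s within {0<..<1}) (at s within {0, 1})"
    unfolding at_within_union[symmetric] by (rule arg_cong[where f="at_within s"]) auto
  have "at s within {0, 1} = bot"
    using trivial_limit_within[of s "{0, 1}"] islimpt_finite[of "{0, 1}" s] by simp
  then have "(trace v \<longlongrightarrow> trace v s) (at s within {0, 1})" by simp
  moreover have "(average \<gamma> v \<longlongrightarrow> trace v s) (at s within {0<..<1})"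
  proof (cases "s \<in> {0<..<1}")
    case True
    have "continuous_on {0<..<1} (average \<gamma> v)"
      unfolding average_eq[abs_def]
      by (intro continuous_intros one_sided_value_continuous[OF regularD(4)[OF v]]) auto
    then show ?thesis using True by (simp add: continuous_on trace_def)
  next
    case False
    then have "s \<in> {0, 1}" using s by auto
    then show ?thesis using average_tendsto_end[OF v] by (auto simp: trace_def)
  qed
  then have "(trace v \<longlongrightarrow> trace v s) (at s within {0<..<1})"
    by (rule Lim_transform_eventually) (auto simp: eventually_at trace_def intro: exI[of _ 1])
  ultimately show "(trace v \<longlongrightarrow> trace v s) (at s within {0..1})"
    unfolding eq by (rule filterlim_sup[rotated])
qed

text \<open>Equivalent to a vanishing \<open>jump_scalar\<close>, since the normals do not vanish.\<close>

definition continuous_across :: "(real^2 \<Rightarrow> real) \<Rightarrow> bool" where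
  "continuous_across v \<longleftrightarrow> (\<forall>s\<in>{0<..<1}. osv v (-1) s = osv v 1 s)"

lemma trace_eq:
  assumes "continuous_across v" "s \<in> {0<..<1}" "\<sigma> = 1 \<or> \<sigma> = -1"
  shows "trace v s = osv v \<sigma> s"
  using assms by (auto simp: trace_def average_eq continuous_across_def)

text \<open>Both sides have the same trace, hence the same tangential derivative, so the average in
\<open>tangential_derivative\<close> is harmless.\<close>

lemma trace_has_derivative:
  assumes v: "regular v" "continuous_across v" and s: "s \<in> {0<..<1}"
  shows "(trace v has_real_derivative tangential v s) (at s)"
proof -
  have d: "(trace v has_real_derivative osv (grad v) \<sigma> s \<bullet> \<gamma>' s) (at s)" if \<sigma>: "\<sigma> = 1 \<or> \<sigma> = -1" for \<sigma>
    by (rule has_field_derivative_transform_within_open[OF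
          one_sided_value_has_derivative[OF regularD(4,5,2)[OF v(1)] \<sigma> s], of "{0<..<1}"])
      (use s trace_eq[OF v(2) _ \<sigma>] in auto)
  have "osv (grad v) (-1) s \<bullet> \<gamma>' s = osv (grad v) 1 s \<bullet> \<gamma>' s"
    by (rule DERIV_unique[OF d d]) auto
  moreover have "\<gamma>' s = norm (\<gamma>' s) *\<^sub>R tangent s" using curve_deriv_eq[of s] len(2)[of s] s by simp
  then have "tangential v s = (osv (grad v) (-1) s \<bullet> \<gamma>' s + osv (grad v) 1 s \<bullet> \<gamma>' s) / 2"
    unfolding tangential_def tangential_derivative_eq[OF regularD(5)[OF v(1)] s]
    by (metis (no_types, lifting) add_divide_distrib inner_scaleR_right mult.commute ring_class.ring_distribs(1) times_divide_eq_right)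
  ultimately show ?thesis using d[of 1] by simp
qed

lemma trace_times_absolutely_integrable:
  assumes "regular v" "j absolutely_integrable_on {0..1}"
  shows "(\<lambda>s. trace v s * j s) absolutely_integrable_on {0..1}"
proof (rule absolutely_integrable_bounded_measurable_product_real[OF _ _ _ assms(2)])
  show "trace v \<in> borel_measurable (lebesgue_on {0..1})"
    by (rule continuous_imp_measurable_on_sets_lebesgue[OF trace_continuous[OF assms(1)]]) simp
  show "bounded (trace v ` {0..1})"
    by (rule compact_imp_bounded[OF compact_continuous_image[OF trace_continuous[OF assms(1)]]]) simp
qed simp

lemma trace_integration_by_parts:
  assumes v: "regular v" "continuous_across v" and w: "regular w" "continuous_across w"
  shows "integral {0..1} (\<lambda>s. trace v s * tangential w s) + integral {0..1} (\<lambda>s. trace w s * tangential v s)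
      = v (\<gamma> 1) * w (\<gamma> 1) - v (\<gamma> 0) * w (\<gamma> 0)"
proof -
  have "((\<lambda>s. trace v s * tangential w s + trace w s * tangential v s) has_integral
      trace v 1 * trace w 1 - trace v 0 * trace w 0) {0..1}"
  proof (rule fundamental_theorem_of_calculus_interior)
    show "continuous_on {0..1} (\<lambda>s. trace v s * trace w s)"
      by (intro continuous_intros trace_continuous v w)
    fix s :: real assume s: "s \<in> {0<..<1}"
    from DERIV_mult[OF trace_has_derivative[OF v s] trace_has_derivative[OF w s]]
    show "((\<lambda>s. trace v s * trace w s) has_vector_derivative
        trace v s * tangential w s + trace w s * tangential v s) (at s)"
      by (simp add: has_real_derivative_iff_has_vector_derivative algebra_simps)
  qed simp
  moreover have "(\<lambda>s. trace v s * tangential w s) integrable_on {0..1}"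
    "(\<lambda>s. trace w s * tangential v s) integrable_on {0..1}"
    using trace_times_absolutely_integrable[OF v(1) tangential_absolutely_integrable[OF w(1)]]
      trace_times_absolutely_integrable[OF w(1) tangential_absolutely_integrable[OF v(1)]]
    by (auto simp: absolutely_integrable_on_def)
  ultimately show ?thesis by (simp add: integral_add[symmetric] integral_unique trace_def)
qed

end

section \<open>Green's identity for regular fields\<close>

context slit
begin

text \<open>Near \<open>p\<close> the defining function of the boundary grows in the direction \<open>e\<close> of its gradient at \<open>p\<close>, and its zeros
in the closure of the domain are again smooth boundary points, so the normal flux tends to zero there.\<close>

lemma smooth_boundary_local_identity:
  assumes F: "flux_field D F" and p: "p \<in> frontier \<Omega>" "p \<noteq> \<gamma> 0" "p \<noteq> \<gamma> 1" "outward_normal \<Omega> p n"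
    and flux: "\<And>y n. (y, n) \<in> smooth_boundary \<Omega> \<gamma> \<Longrightarrow> \<exists>l. (F \<longlongrightarrow> l) (at y within D) \<and> n \<bullet> l = 0"
  shows "\<exists>r>0. \<forall>\<eta> g. C1_with_gradient \<eta> g \<longrightarrow> (\<forall>x. norm (x - p) > r \<longrightarrow> \<eta> x = 0) \<longrightarrow>
     integral D (\<lambda>x. \<eta> x * divergence F x + g x \<bullet> F x) = 0 \<and> (\<forall>x\<in>path_image \<gamma>. \<eta> x = 0)"
proof -
  obtain U \<psi> where U: "open U" "p \<in> U" "C1_field \<psi> U" "\<Omega> \<inter> U = {y \<in> U. \<psi> y < (0::real)}"
    "\<psi> p = 0" "grad \<psi> p \<noteq> 0"
    using p(4) unfolding outward_normal_def by blast
  define e where "e = sgn (grad \<psi> p)"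
  define c where "c = norm (grad \<psi> p) / 2"
  have e: "norm e = 1" using U(6) by (simp add: e_def norm_sgn)
  have c: "c > 0" using U(6) by (simp add: c_def)
  have cg: "continuous_on U (grad \<psi>)" by (rule C1_field_continuous_grad[OF U(3)])
  have "continuous_on U (\<lambda>x. grad \<psi> x \<bullet> e)" by (intro continuous_intros cg)
  then have "((\<lambda>x. grad \<psi> x \<bullet> e) \<longlongrightarrow> grad \<psi> p \<bullet> e) (at p)"
    using U(1,2) by (metis continuous_on_eq_continuous_at isCont_def)
  moreover have "grad \<psi> p \<bullet> e = 2 * c"
    using U(6) by (simp add: e_def c_def sgn_div_norm dot_square_norm power2_eq_square)
  then have pe: "grad \<psi> p \<bullet> e > c" using c by simp
  ultimately have "\<forall>\<^sub>F x in at p. grad \<psi> x \<bullet> e > c" by (metis order_tendstoD(1))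
  then obtain R1 where R1: "R1 > 0" "\<And>x. x \<noteq> p \<Longrightarrow> dist x p < R1 \<Longrightarrow> grad \<psi> x \<bullet> e > c"
    unfolding eventually_at by auto
  obtain R2 where R2: "R2 > 0" "ball p R2 \<subseteq> U" using U(1,2) open_contains_ball by blast
  have "p \<notin> path_image \<gamma>"
    using path_image_cases[of p] p frontier_not_in curve_interior by blast
  then obtain R3 where R3: "R3 > 0" "ball p R3 \<subseteq> - path_image \<gamma>"
    using path_image_closed open_contains_ball[of "- path_image \<gamma>"] by auto
  define R where "R = min R1 (min R2 R3)"
  have R: "R > 0" using R1 R2 R3 by (simp add: R_def)
  have sub: "ball p R \<subseteq> U" "x \<in> ball p R \<Longrightarrow> x \<notin> path_image \<gamma>" for x
    using R2(2) R3(2) by (auto simp: R_def subset_eq)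
  have ce: "grad \<psi> x \<bullet> e \<ge> c" if "x \<in> ball p R" for x
    using R1(2)[of x] pe that by (cases "x = p") (auto simp: R_def dist_commute)
  have inside: "x \<in> D \<longleftrightarrow> \<psi> x < 0" if "x \<in> ball p R" for x
    using sub that U(4) by blast
  have grad: "GDERIV \<psi> x :> grad \<psi> x" if "x \<in> ball p R" for x
    using sub(1) that U(3) by (intro GDERIV_grad) (auto simp: C1_field_def)
  have cgB: "continuous_on (ball p R) (grad \<psi>)" by (rule continuous_on_subset[OF cg sub(1)])
  have fl: "((\<lambda>x. grad \<psi> x \<bullet> F x) \<longlongrightarrow> 0) (at y within D)" if y: "y \<in> ball p R" "\<psi> y = 0" for y
  proof (cases "y \<in> closure D")
    case False
    then have "at y within D = bot"
      using trivial_limit_within[of y D] by (auto simp: closure_def)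
    then show ?thesis by simp
  next
    case True
    have yU: "y \<in> U" using sub y by blast
    have gy: "grad \<psi> y \<noteq> 0" using ce[OF y(1)] c by auto
    have "y \<notin> \<Omega>"
    proof
      assume "y \<in> \<Omega>"
      then have "\<psi> y < 0" using U(4) yU by blast
      then show False using y(2) by simp
    qed
    moreover have "y \<in> closure \<Omega>" using True closure_D by blast
    ultimately have "y \<in> frontier \<Omega>" using interior_subset by (auto simp: frontier_def)
    moreover have "outward_normal \<Omega> y (sgn (grad \<psi> y))"
      unfolding outward_normal_def using U yU y(2) gy by blast
    moreover have "y \<noteq> \<gamma> 0" "y \<noteq> \<gamma> 1" using sub(2)[OF y(1)] by (auto simp: path_image_def)
    ultimately have "(y, sgn (grad \<psi> y)) \<in> smooth_boundary \<Omega> \<gamma>" by (simp add: smooth_boundary_def)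
    from flux[OF this] obtain l where l: "(F \<longlongrightarrow> l) (at y within D)" "sgn (grad \<psi> y) \<bullet> l = 0" by blast
    have "(grad \<psi> \<longlongrightarrow> grad \<psi> y) (at y)"
      using cg U(1) yU by (metis continuous_on_eq_continuous_at isCont_def)
    then have "(grad \<psi> \<longlongrightarrow> grad \<psi> y) (at y within D)" by (rule tendsto_within_subset) simp
    then have "((\<lambda>x. grad \<psi> x \<bullet> F x) \<longlongrightarrow> grad \<psi> y \<bullet> l) (at y within D)"
      using l(1) by (rule tendsto_inner)
    moreover have "grad \<psi> y \<bullet> l = 0" using l(2) gy by (simp add: sgn_div_norm)
    ultimately show ?thesis by simp
  qed
  show ?thesis
  proof (intro exI conjI allI impI)
    show "R / 2 > 0" using R by simp
    fix \<eta> g assume \<eta>: "C1_with_gradient \<eta> g" "\<forall>x. norm (x - p) > R / 2 \<longrightarrow> \<eta> x = 0"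
    show "integral D (\<lambda>x. \<eta> x * divergence F x + g x \<bullet> F x) = 0"
      by (rule flux_field.boundary_flux_identity[OF F \<eta>(1), where p=p and r="R / 2" and R=R
            and \<psi>=\<psi> and g\<psi>="grad \<psi>" and e=e and c=c])
        (use \<eta>(2) R grad cgB inside e c ce fl in auto)
    show "\<forall>x\<in>path_image \<gamma>. \<eta> x = 0"
    proof
      fix x assume "x \<in> path_image \<gamma>"
      then have "x \<notin> ball p R" using sub(2) by blast
      then have "norm (x - p) > R / 2" using R by (auto simp: dist_norm norm_minus_commute)
      then show "\<eta> x = 0" using \<eta>(2) by blast
    qed
  qed
qed

end

context slit_domain
begin

lemma D_lmeasurable: "D \<in> lmeasurable"
  using open_D bounded_D by (simp add: lmeasurable_open)

lemma \<kappa>_bounded: "\<exists>M\<ge>0. \<forall>x\<in>D. \<bar>\<kappa> x\<bar> \<le> M"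
proof -
  have "compact (\<kappa> ` closure \<Omega>)" by (rule compact_continuous_image[OF \<kappa>_continuous compact_closure_\<Omega>])
  from compact_imp_bounded[OF this] obtain M where M: "\<And>y. y \<in> \<kappa> ` closure \<Omega> \<Longrightarrow> norm y \<le> M"
    unfolding bounded_iff by blast
  have "\<bar>\<kappa> x\<bar> \<le> max 0 M" if "x \<in> D" for x
    using M[of "\<kappa> x"] that closure_subset[of \<Omega>] by fastforce
  then show ?thesis by (intro exI[of _ "max 0 M"]) auto
qed

lemma \<kappa>_continuous_D: "continuous_on D \<kappa>"
  by (rule continuous_on_subset[OF \<kappa>_continuous]) (use closure_subset[of \<Omega>] in blast)

lemma energy_absolutely_integrable:
  assumes v: "regular v" and w: "regular w"
  shows "(\<lambda>x. \<kappa> x * (grad v x \<bullet> grad w x)) absolutely_integrable_on D"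
proof -
  obtain M where M: "M \<ge> 0" "\<And>x. x \<in> D \<Longrightarrow> \<bar>\<kappa> x\<bar> \<le> M" using \<kappa>_bounded by blast
  show ?thesis
  proof (rule continuous_bounded_absolutely_integrable[OF open_D])
    show "continuous_on D (\<lambda>x. \<kappa> x * (grad v x \<bullet> grad w x))"
      by (intro continuous_on_mult continuous_on_inner \<kappa>_continuous_D
          C1_field_continuous_grad regularD(2)[OF v] regularD(2)[OF w])
    show "(\<lambda>x. M * ((norm (grad v x))\<^sup>2 + (norm (grad w x))\<^sup>2)) integrable_on D"
      by (intro integrable_on_mult_right integrable_add regularD(7)[OF v] regularD(7)[OF w])
    fix x assume x: "x \<in> D"
    have "\<bar>grad v x \<bullet> grad w x\<bar> \<le> norm (grad v x) * norm (grad w x)" by (rule Cauchy_Schwarz_ineq2)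
    also have "\<dots> \<le> (norm (grad v x))\<^sup>2 + (norm (grad w x))\<^sup>2"
      using sum_squares_bound[of "norm (grad v x)" "norm (grad w x)"]
        mult_nonneg_nonneg[OF norm_ge_zero[of "grad v x"] norm_ge_zero[of "grad w x"]]
      by linarith
    finally show "norm (\<kappa> x * (grad v x \<bullet> grad w x)) \<le> M * ((norm (grad v x))\<^sup>2 + (norm (grad w x))\<^sup>2)"
      unfolding real_norm_def abs_mult using M x by (intro mult_mono) auto
  qed
qed

lemma regular_bounded_integrable:
  assumes v: "continuous_on D v" and f: "continuous_on D f" and b: "\<exists>M. \<forall>x\<in>D. \<bar>v x\<bar> \<le> M" "\<exists>M. \<forall>x\<in>D. \<bar>f x\<bar> \<le> M"
  shows "(\<lambda>x. v x * f x :: real) absolutely_integrable_on D"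
proof -
  obtain M1 M2 where M: "\<And>x. x \<in> D \<Longrightarrow> \<bar>v x\<bar> \<le> M1" "\<And>x. x \<in> D \<Longrightarrow> \<bar>f x\<bar> \<le> M2" using b by blast
  show ?thesis
  proof (rule continuous_bounded_absolutely_integrable[OF open_D])
    show "continuous_on D (\<lambda>x. v x * f x)" by (intro continuous_intros v f)
    show "(\<lambda>_. \<bar>M1\<bar> * \<bar>M2\<bar>) integrable_on D" using D_lmeasurable by (rule integrable_on_const)
    show "norm (v x * f x) \<le> \<bar>M1\<bar> * \<bar>M2\<bar>" if "x \<in> D" for x
      unfolding real_norm_def abs_mult using M[OF that] by (intro mult_mono) auto
  qed
qed

definition conductive_flux :: "(real^2 \<Rightarrow> real) \<Rightarrow> real^2 \<Rightarrow> real^2" where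
  "conductive_flux w x = \<kappa> x *\<^sub>R grad w x"

lemma conductive_flux_side_values:
  assumes w: "regular w"
  shows "has_side_values \<gamma> (conductive_flux w)"
    and "\<sigma> = 1 \<or> \<sigma> = -1 \<Longrightarrow> s \<in> {0<..<1} \<Longrightarrow> osv (conductive_flux w) \<sigma> s = \<kappa> (\<gamma> s) *\<^sub>R osv (grad w) \<sigma> s"
proof -
  have c: "continuous_on \<Omega> \<kappa>" by (rule continuous_on_subset[OF \<kappa>_continuous closure_subset])
  have s\<kappa>: "has_side_values \<gamma> \<kappa>" using side_limit_continuous[OF c] by (intro has_side_valuesI) blast
  show "has_side_values \<gamma> (conductive_flux w)"
    unfolding conductive_flux_def[abs_def] by (rule one_sided_value_scaleR(1)[OF s\<kappa> regularD(5)[OF w]])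
  show "\<sigma> = 1 \<or> \<sigma> = -1 \<Longrightarrow> s \<in> {0<..<1} \<Longrightarrow> osv (conductive_flux w) \<sigma> s = \<kappa> (\<gamma> s) *\<^sub>R osv (grad w) \<sigma> s"
    unfolding conductive_flux_def[abs_def]
    using one_sided_value_scaleR(2)[OF s\<kappa> regularD(5)[OF w]] one_sided_value_eqI[OF side_limit_continuous[OF c]]
    by simp
qed

lemma boundary_limit:
  assumes w: "regular w" and y: "(y, n) \<in> smooth_boundary \<Omega> \<gamma>"
  shows "at y within D \<noteq> bot"
    and "(grad w \<longlongrightarrow> boundary_value \<Omega> \<gamma> y (grad w)) (at y within D)"
    and "(conductive_flux w \<longlongrightarrow> boundary_value \<Omega> \<gamma> y (conductive_flux w)) (at y within D)"
    and "boundary_value \<Omega> \<gamma> y (conductive_flux w) = \<kappa> y *\<^sub>R boundary_value \<Omega> \<gamma> y (grad w)"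
proof -
  have yf: "y \<in> frontier \<Omega>" using y by (simp add: smooth_boundary_def)
  have "y \<in> closure \<Omega>" using yf by (simp add: frontier_def)
  then have "y \<in> closure D" using closure_D(1) closure_minimal[OF closure_D(1) closed_closure] by blast
  then show nb: "at y within D \<noteq> bot"
    using frontier_not_in[OF yf] by (auto simp: closure_def trivial_limit_within)
  obtain l where l: "(grad w \<longlongrightarrow> l) (at y within D)" using regularD(6)[OF w y] by blast
  then show g: "(grad w \<longlongrightarrow> boundary_value \<Omega> \<gamma> y (grad w)) (at y within D)"
    unfolding boundary_value_def using tendsto_Lim[OF nb l] by simp
  have "(\<kappa> \<longlongrightarrow> \<kappa> y) (at y within closure \<Omega>)"
    using \<kappa>_continuous \<open>y \<in> closure \<Omega>\<close> by (simp add: continuous_on)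
  then have "(\<kappa> \<longlongrightarrow> \<kappa> y) (at y within D)"
    by (rule tendsto_within_subset) (use closure_subset[of \<Omega>] in blast)
  then have f: "(conductive_flux w \<longlongrightarrow> \<kappa> y *\<^sub>R boundary_value \<Omega> \<gamma> y (grad w)) (at y within D)"
    unfolding conductive_flux_def[abs_def] by (intro tendsto_scaleR g)
  then show eq: "boundary_value \<Omega> \<gamma> y (conductive_flux w) = \<kappa> y *\<^sub>R boundary_value \<Omega> \<gamma> y (grad w)"
    unfolding boundary_value_def[of _ _ _ "conductive_flux w"] by (rule tendsto_Lim[OF nb])
  show "(conductive_flux w \<longlongrightarrow> boundary_value \<Omega> \<gamma> y (conductive_flux w)) (at y within D)"
    using f unfolding eq .
qed

definition insulated :: "(real^2 \<Rightarrow> real) \<Rightarrow> bool" where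
  "insulated w \<longleftrightarrow> (\<forall>(x, n)\<in>smooth_boundary \<Omega> \<gamma>. n \<bullet> boundary_value \<Omega> \<gamma> x (conductive_flux w) = 0)"

text \<open>The flux identity for \<open>F = v \<kappa> grad w\<close>. As \<open>v\<close> is bounded and \<open>grad w\<close> square integrable, \<open>F\<close> is square integrable,
and the integrable terms \<open>v div (\<kappa> grad w)\<close> and \<open>\<kappa> grad v \<bullet> grad w\<close> make up its divergence.\<close>

lemma green_identity:
  assumes v: "regular v" "continuous_across v" and w: "regular w" "insulated w"
    and div: "\<exists>M. \<forall>x\<in>D. \<bar>divergence (conductive_flux w) x\<bar> \<le> M"
    and j: "j absolutely_integrable_on {0..1}"
      "\<And>s. s \<in> {0<..<1} \<Longrightarrow> jump_vector \<gamma> (conductive_flux w) s * norm (\<gamma>' s) = j s"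
  shows "integral D (\<lambda>x. v x * divergence (conductive_flux w) x)
      + integral D (\<lambda>x. \<kappa> x * (grad v x \<bullet> grad w x)) = integral {0..1} (\<lambda>s. trace v s * j s)"
proof -
  define F where "F x = v x *\<^sub>R conductive_flux w x" for x
  have C1w: "C1_field (conductive_flux w) D"
    unfolding conductive_flux_def[abs_def] by (rule regularD(3)[OF w(1)])
  have C1v: "C1_field v D" by (rule regularD(2)[OF v(1)])
  have gv: "GDERIV v x :> grad v x" if "x \<in> D" for x
    using C1v that by (intro GDERIV_grad) (simp add: C1_field_def)
  have divF: "divergence F x = v x * divergence (conductive_flux w) x + \<kappa> x * (grad v x \<bullet> grad w x)" if "x \<in> D" for x
    using divergence_scaleR_field[OF gv[OF that], of "conductive_flux w"] C1w that
    by (simp add: F_def[abs_def] C1_field_def conductive_flux_def)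
  have i1: "(\<lambda>x. v x * divergence (conductive_flux w) x) absolutely_integrable_on D"
    by (rule regular_bounded_integrable[OF C1_field_continuous[OF C1v] C1_field_continuous_divergence[OF C1w]
          regular_bounded[OF v(1)] div])
  have i2: "(\<lambda>x. \<kappa> x * (grad v x \<bullet> grad w x)) absolutely_integrable_on D"
    by (rule energy_absolutely_integrable[OF v(1) w(1)])
  obtain Bv where Bv: "\<And>x. x \<in> D \<Longrightarrow> \<bar>v x\<bar> \<le> Bv" using regular_bounded[OF v(1)] by blast
  obtain B\<kappa> where B\<kappa>: "B\<kappa> \<ge> 0" "\<And>x. x \<in> D \<Longrightarrow> \<bar>\<kappa> x\<bar> \<le> B\<kappa>" using \<kappa>_bounded by blast
  have F_le: "norm (F x) \<le> (\<bar>Bv\<bar> * B\<kappa>) * norm (grad w x)" if "x \<in> D" for x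
    unfolding F_def conductive_flux_def norm_scaleR mult.assoc[symmetric]
    using Bv[OF that] B\<kappa>(1) B\<kappa>(2)[OF that] by (intro mult_right_mono mult_mono) auto
  have C1F: "C1_field F D"
    unfolding F_def[abs_def] by (rule C1_field_scaleR[OF gv C1_field_continuous_grad[OF C1v] C1w])
  have cF: "continuous_on D F" by (rule C1_field_continuous[OF C1F])
  have F2: "(\<lambda>x. (norm (F x))\<^sup>2) absolutely_integrable_on D"
  proof (rule continuous_bounded_absolutely_integrable[OF open_D])
    show "continuous_on D (\<lambda>x. (norm (F x))\<^sup>2)" by (intro continuous_intros cF)
    show "(\<lambda>x. (\<bar>Bv\<bar> * B\<kappa>)\<^sup>2 * (norm (grad w x))\<^sup>2) integrable_on D"
      by (intro integrable_on_mult_right regularD(7)[OF w(1)])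
    show "norm ((norm (F x))\<^sup>2) \<le> (\<bar>Bv\<bar> * B\<kappa>)\<^sup>2 * (norm (grad w x))\<^sup>2" if "x \<in> D" for x
      using power_mono[OF F_le[OF that], of 2] by (simp add: power_mult_distrib)
  qed
  have F1: "F absolutely_integrable_on D"
  proof (rule continuous_bounded_absolutely_integrable[OF open_D cF])
    show "(\<lambda>x. 1 + (norm (F x))\<^sup>2) integrable_on D"
      using F2 D_lmeasurable by (intro integrable_add integrable_on_const) (simp_all add: absolutely_integrable_on_def)
    show "norm (F x) \<le> 1 + (norm (F x))\<^sup>2" for x
      using sum_squares_bound[of 1 "norm (F x)"] norm_ge_zero[of "F x"] by (simp del: norm_ge_zero)
  qed
  have "divergence F absolutely_integrable_on D"
    using set_integral_add(1)[OF i1 i2] by (subst set_integrable_cong[OF refl refl divF]) auto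
  then have FF: "flux_field D F"
    using open_D bounded_D C1F F1 by unfold_locales
  then interpret FF: flux_field D F .
  have sideF: "has_side_values \<gamma> F"
    unfolding F_def[abs_def]
    by (rule one_sided_value_scaleR(1)[OF regularD(4)[OF v(1)] conductive_flux_side_values(1)[OF w(1)]])
  have jumpF: "jump_vector \<gamma> F s = trace v s * jump_vector \<gamma> (conductive_flux w) s" if s: "s \<in> {0<..<1}" for s
  proof -
    have o: "osv F \<sigma> s = trace v s *\<^sub>R osv (conductive_flux w) \<sigma> s" if \<sigma>: "\<sigma> = 1 \<or> \<sigma> = -1" for \<sigma>
      unfolding F_def[abs_def] trace_eq[OF v(2) s \<sigma>]
      by (rule one_sided_value_scaleR(2)[OF regularD(4)[OF v(1)] conductive_flux_side_values(1)[OF w(1)] \<sigma> s])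
    show ?thesis by (simp add: jump_vector_eq o inner_diff_left right_diff_distrib)
  qed
  define J where "J s = trace v s * j s" for s
  have iJ: "J absolutely_integrable_on {0..1}"
    unfolding J_def by (rule trace_times_absolutely_integrable[OF v(1) j(1)])
  have JF: "J s = jump_vector \<gamma> F s * norm (\<gamma>' s)" if "s \<in> {0<..<1}" for s
    by (simp add: J_def jumpF[OF that] j(2)[OF that, symmetric])
  \<comment> \<open>corners and the two ends of the slit: the gradient may be unbounded at these points\<close>
  define P where "P = {x \<in> frontier \<Omega>. \<nexists>n. outward_normal \<Omega> x n} \<union> {\<gamma> 0, \<gamma> 1}"
  have "(J has_integral integral D (divergence F)) {0..1}"
  proof (rule FF.flux_identity_local_to_global[where P=P])
    show "DIM(real^2) = 2" by simp
    show "(\<lambda>x. (norm (F x))\<^sup>2) integrable_on D" using F2 by (simp add: absolutely_integrable_on_def)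
    show "finite P" using corners by (simp add: P_def piecewise_smooth_boundary_def)
    show "P \<inter> D = {}" using frontier_not_in ends_in_frontier by (auto simp: P_def)
    show "\<gamma> ` {0..1} \<subseteq> closure D" using closure_D(3) by (simp add: path_image_def)
    fix p assume p: "p \<in> closure D - P"
    have "p \<in> closure \<Omega>" using p closure_D(2) by blast
    then have "p \<in> \<Omega> \<or> p \<in> frontier \<Omega>" using open_\<Omega> by (simp add: frontier_def interior_open)
    moreover have "\<exists>s\<in>{0<..<1}. p = \<gamma> s" if "p \<in> path_image \<gamma>"
      using path_image_cases[OF that] p by (auto simp: P_def)
    ultimately consider "p \<in> D" | s where "s \<in> {0<..<1}" "p = \<gamma> s" | "p \<in> frontier \<Omega>"
      by blast
    then show "\<exists>r>0. \<forall>\<eta> g. C1_with_gradient \<eta> g \<longrightarrow> (\<forall>x. norm (x - p) > r \<longrightarrow> \<eta> x = 0) \<longrightarrow> FF.flux_identity \<gamma> J \<eta> g"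
    proof cases
      case 1
      then obtain r where r: "r > 0" "cball p r \<subseteq> D" using open_D open_contains_cball by blast
      show ?thesis
      proof (intro exI conjI allI impI)
        show "r > 0" by (rule r(1))
        fix \<eta> g assume \<eta>: "C1_with_gradient \<eta> g" "\<forall>x. norm (x - p) > r \<longrightarrow> \<eta> x = 0"
        have out: "\<eta> x = 0" if "x \<notin> cball p r" for x
          using \<eta>(2) that by (auto simp: dist_norm norm_minus_commute)
        have "integral D (\<lambda>x. \<eta> x * divergence F x + g x \<bullet> F x) = 0"
          by (rule integral_unique, rule FF.integral_test_compact_support[OF \<eta>(1) compact_cball r(2)]) (simp add: out[simplified])
        moreover have "\<eta> (\<gamma> s) = 0" if "s \<in> {0..1}" for s
          using that r(2) by (intro out) (auto simp: path_image_def)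
        then have "((\<lambda>s. \<eta> (\<gamma> s) * J s) has_integral 0) {0..1}" by (intro has_integral_is_0) simp
        ultimately show "FF.flux_identity \<gamma> J \<eta> g" by (simp add: FF.flux_identity_def)
      qed
    next
      case (2 s)
      obtain a b R \<psi> \<tau> where "slit_chart \<Omega> \<gamma> s a b R \<psi> \<tau>" using exists_chart[OF 2(1)] .
      then interpret C: slit_chart \<Omega> \<gamma> s a b R \<psi> \<tau> .
      obtain r0 M where M: "r0 > 0" "\<And>x. x \<in> D \<inter> ball (\<gamma> s) r0 \<Longrightarrow> norm (F x) \<le> M"
        using side_values_imp_bounded_near[OF sideF 2(1)] by blast
      define r where "r = min (R / 2) (r0 / 2)"
      show ?thesis
      proof (intro exI conjI allI impI)
        show "r > 0" using C.R M by (simp add: r_def)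
        fix \<eta> g assume \<eta>: "C1_with_gradient \<eta> g" "\<forall>x. norm (x - p) > r \<longrightarrow> \<eta> x = 0"
        have "((\<lambda>s. \<eta> (\<gamma> s) * (jump_vector \<gamma> F s * norm (\<gamma>' s))) has_integral
            integral D (\<lambda>x. \<eta> x * divergence F x + g x \<bullet> F x)) {0..1}"
        proof (rule C.slit_flux_identity[OF FF sideF \<eta>(1)])
          show "norm (x - \<gamma> s) > r \<Longrightarrow> \<eta> x = 0" for x using \<eta>(2) 2(2) by blast
          show "r < R" using C.R M by (simp add: r_def)
          show "norm (F x) \<le> M" if "x \<in> ball (\<gamma> s) R" "norm (x - \<gamma> s) \<le> r" "\<psi> x \<noteq> 0" for x
          proof (rule M(2))
            have "x \<in> D" using C.mem_slit_iff[OF that(1)] C.ball_sub that by auto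
            moreover have "x \<in> ball (\<gamma> s) r0" using that(2) M(1) by (simp add: r_def dist_norm norm_minus_commute)
            ultimately show "x \<in> D \<inter> ball (\<gamma> s) r0" by blast
          qed
        qed
        then have "((\<lambda>s. \<eta> (\<gamma> s) * J s) has_integral
            integral D (\<lambda>x. \<eta> x * divergence F x + g x \<bullet> F x)) {0..1}"
          by (rule has_integral_spike_finite[of "{0, 1}", rotated 2]) (auto simp: JF)
        then show "FF.flux_identity \<gamma> J \<eta> g" by (simp add: FF.flux_identity_def)
      qed
    next
      case 3
      then obtain n where n: "outward_normal \<Omega> p n" "p \<noteq> \<gamma> 0" "p \<noteq> \<gamma> 1" using p by (auto simp: P_def)
      have flux: "\<exists>l. (F \<longlongrightarrow> l) (at y within D) \<and> m \<bullet> l = 0" if y: "(y, m) \<in> smooth_boundary \<Omega> \<gamma>" for y m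
      proof (intro exI conjI)
        have yf: "y \<in> frontier \<Omega>" using y by (simp add: smooth_boundary_def)
        then have "y \<in> closure \<Omega> - \<gamma> ` {0<..<1}"
          using frontier_not_in curve_interior by (fastforce simp: frontier_def)
        then have "(v \<longlongrightarrow> v y) (at y within closure \<Omega> - \<gamma> ` {0<..<1})"
          using regularD(1)[OF v(1)] by (simp add: continuous_on)
        then have "(v \<longlongrightarrow> v y) (at y within D)" by (rule tendsto_within_subset) (rule D_subset)
        then show "(F \<longlongrightarrow> v y *\<^sub>R boundary_value \<Omega> \<gamma> y (conductive_flux w)) (at y within D)"
          unfolding F_def[abs_def] by (intro tendsto_scaleR boundary_limit(3)[OF w(1) y])
        show "m \<bullet> (v y *\<^sub>R boundary_value \<Omega> \<gamma> y (conductive_flux w)) = 0"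
          using w(2) y unfolding insulated_def by auto
      qed
      from smooth_boundary_local_identity[OF FF 3 n(2,3,1) flux]
      obtain r where r: "r > 0" "\<And>\<eta> g. C1_with_gradient \<eta> g \<Longrightarrow> (\<forall>x. norm (x - p) > r \<longrightarrow> \<eta> x = 0) \<Longrightarrow>
         integral D (\<lambda>x. \<eta> x * divergence F x + g x \<bullet> F x) = 0 \<and> (\<forall>x\<in>path_image \<gamma>. \<eta> x = 0)"
        by blast
      show ?thesis
      proof (intro exI conjI allI impI)
        show "r > 0" by (rule r(1))
        fix \<eta> g assume \<eta>: "C1_with_gradient \<eta> g" "\<forall>x. norm (x - p) > r \<longrightarrow> \<eta> x = 0"
        note r(2)[OF \<eta>]
        moreover from this have "((\<lambda>s. \<eta> (\<gamma> s) * J s) has_integral 0) {0..1}"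
          by (intro has_integral_is_0) (auto simp: path_image_def)
        ultimately show "FF.flux_identity \<gamma> J \<eta> g" by (simp add: FF.flux_identity_def)
      qed
    qed
  qed (use iJ curve_continuous curve_inj in auto)
  then have "integral {0..1} J = integral D (divergence F)" by (rule integral_unique)
  also have "\<dots> = integral D (\<lambda>x. v x * divergence (conductive_flux w) x + \<kappa> x * (grad v x \<bullet> grad w x))"
    by (rule integral_cong) (rule divF)
  also have "\<dots> = integral D (\<lambda>x. v x * divergence (conductive_flux w) x)
      + integral D (\<lambda>x. \<kappa> x * (grad v x \<bullet> grad w x))"
    using i1 i2 by (intro integral_add) (simp_all add: absolutely_integrable_on_def)
  finally show ?thesis by (simp add: J_def[abs_def])
qed

lemma regular_const: "regular (\<lambda>_. k)"
proof -
  have g: "grad (\<lambda>_::real^2. k) = (\<lambda>_. 0)" by (rule ext) (rule grad_eq[OF GDERIV_const])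
  have fd: "frechet_derivative (\<lambda>_. c) (at x) = (\<lambda>_. 0)" for c :: "'b::real_normed_vector" and x :: "real^2"
    using frechet_derivative_at[OF has_derivative_const] by metis
  have C: "C1_field (\<lambda>_. c) D" for c :: "'b::real_normed_vector"
    unfolding C1_field_def fd by auto
  have S: "has_side_values \<gamma> (\<lambda>_. c)" for c :: "'b::real_normed_vector"
    by (rule has_side_valuesI) (auto simp: side_limit_def case_prod_beta' intro: tendsto_const)
  have t: "tangential_derivative \<gamma> (\<lambda>_. k) s = 0" for s
  proof -
    have "Lim (at 0) (\<lambda>\<epsilon>::real. 0::real) = 0" by (rule tendsto_Lim) auto
    then show ?thesis by (simp add: tangential_derivative_def average_def side_value_def g)
  qed
  show ?thesis
    unfolding regular_field_def g using C[of k] C[of 0] S[of k] S[of 0]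
    by (auto simp: t intro: tendsto_const integrable_0)
qed

lemma continuous_across_const: "continuous_across (\<lambda>_. k)"
proof -
  have "osv (\<lambda>_. k) \<sigma> s = k" for \<sigma> s
    by (rule one_sided_value_eqI) (simp add: side_limit_def case_prod_beta')
  then show ?thesis by (simp add: continuous_across_def)
qed

lemma grad_const: "grad (\<lambda>_. k) x = 0"
  by (rule grad_eq[OF GDERIV_const])

end

section \<open>Weak forms and the sensitivity\<close>

context slit_domain
begin

definition energy :: "(real^2 \<Rightarrow> real) \<Rightarrow> (real^2 \<Rightarrow> real) \<Rightarrow> real" where
  "energy v w = integral D (\<lambda>x. \<kappa> x * (grad v x \<bullet> grad w x))"

definition mass :: "(real^2 \<Rightarrow> real) \<Rightarrow> (real^2 \<Rightarrow> real) \<Rightarrow> real" where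
  "mass v w = integral D (\<lambda>x. v x * w x)"

definition advection :: "(real^2 \<Rightarrow> real) \<Rightarrow> (real^2 \<Rightarrow> real) \<Rightarrow> real" where
  "advection v w = integral {0..1} (\<lambda>s. trace v s * tangential w s)"

lemma regular_continuous: "regular v \<Longrightarrow> continuous_on D v"
  using C1_field_continuous regularD(2) by blast

lemma mass_integrable: "regular v \<Longrightarrow> regular w \<Longrightarrow> (\<lambda>x. v x * w x) integrable_on D"
  using regular_bounded_integrable[OF regular_continuous regular_continuous regular_bounded regular_bounded]
  by (simp add: absolutely_integrable_on_def)

lemma regular_integrable: "regular v \<Longrightarrow> v integrable_on D"
  using mass_integrable[OF regular_const[of 1]] by simp

lemma energy_integrable: "regular v \<Longrightarrow> regular w \<Longrightarrow> (\<lambda>x. \<kappa> x * (grad v x \<bullet> grad w x)) integrable_on D"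
  using energy_absolutely_integrable by (simp add: absolutely_integrable_on_def)

lemma advection_integrable:
  "regular v \<Longrightarrow> regular w \<Longrightarrow> (\<lambda>s. trace v s * tangential w s) integrable_on {0..1}"
  using trace_times_absolutely_integrable[OF _ tangential_absolutely_integrable]
  by (simp add: absolutely_integrable_on_def)

lemma energy_commute: "energy v w = energy w v"
  by (simp add: energy_def inner_commute)

lemma mass_commute: "mass v w = mass w v"
  by (simp add: mass_def mult.commute)

lemma energy_difference_nonneg:
  assumes "regular v" "regular w" "\<And>x. x \<in> \<Omega> \<Longrightarrow> \<kappa> x > 0"
  shows "energy v v - 2 * energy v w + energy w w \<ge> 0"
proof -
  have "((\<lambda>x. \<kappa> x * (grad v x \<bullet> grad v x) - 2 * (\<kappa> x * (grad v x \<bullet> grad w x)) + \<kappa> x * (grad w x \<bullet> grad w x))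
      has_integral energy v v - 2 * energy v w + energy w w) D"
    unfolding energy_def
    by (intro has_integral_add has_integral_diff has_integral_mult_right integrable_integral
        energy_integrable assms)
  moreover have "\<kappa> x * (grad v x \<bullet> grad v x) - 2 * (\<kappa> x * (grad v x \<bullet> grad w x)) + \<kappa> x * (grad w x \<bullet> grad w x)
      = \<kappa> x * ((grad v x - grad w x) \<bullet> (grad v x - grad w x))" for x
    by (simp add: inner_diff_left inner_diff_right inner_commute[of "grad w x" "grad v x"] algebra_simps)
  ultimately have "((\<lambda>x. \<kappa> x * ((grad v x - grad w x) \<bullet> (grad v x - grad w x)))
      has_integral energy v v - 2 * energy v w + energy w w) D" by simp
  then show ?thesis
  proof (rule has_integral_nonneg)
    fix x assume "x \<in> D"
    then have "\<kappa> x > 0" using assms(3) by blast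
    then show "\<kappa> x * ((grad v x - grad w x) \<bullet> (grad v x - grad w x)) \<ge> 0" by simp
  qed
qed

lemma mass_difference_nonneg:
  assumes "regular v" "regular w"
  shows "mass v v - 2 * mass v w + mass w w \<ge> 0"
proof -
  have "((\<lambda>x. v x * v x - 2 * (v x * w x) + w x * w x) has_integral mass v v - 2 * mass v w + mass w w) D"
    unfolding mass_def
    by (intro has_integral_add has_integral_diff has_integral_mult_right integrable_integral
        mass_integrable assms)
  moreover have "v x * v x - 2 * (v x * w x) + w x * w x = (v x - w x)\<^sup>2" for x
    by (simp add: power2_eq_square algebra_simps)
  ultimately have "((\<lambda>x. (v x - w x)\<^sup>2) has_integral mass v v - 2 * mass v w + mass w w) D" by simp
  then show ?thesis by (rule has_integral_nonneg) simp
qed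

lemma advection_sum:
  assumes "regular v" "continuous_across v" "regular w" "continuous_across w"
  shows "advection v w + advection w v = v (\<gamma> 1) * w (\<gamma> 1) - v (\<gamma> 0) * w (\<gamma> 0)"
  unfolding advection_def by (rule trace_integration_by_parts[OF assms])

lemma trace_const: "trace (\<lambda>_. k) s = k"
  using trace_eq[OF continuous_across_const, of s 1 k] one_sided_value_eqI[of \<gamma> "\<lambda>_. k" 1 s k]
  by (cases "s \<in> {0<..<1}") (auto simp: trace_def side_limit_def case_prod_beta')

lemma tangential_integral:
  assumes "regular v" "continuous_across v"
  shows "integral {0..1} (tangential v) = v (\<gamma> 1) - v (\<gamma> 0)"
proof -
  have "((tangential v) has_integral trace v 1 - trace v 0) {0..1}"
    by (rule fundamental_theorem_of_calculus_interior)
      (use trace_has_derivative[OF assms] trace_continuous[OF assms(1)]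
        in \<open>auto simp: has_real_derivative_iff_has_vector_derivative\<close>)
  then show ?thesis by (simp add: integral_unique trace_def)
qed

text \<open>Green's identity with the equations inserted: the divergence of the flux is an affine function of \<open>w\<close>,
  and the transport \<open>k\<close> prescribes the jump of the flux at the slit.\<close>

lemma weak_form:
  assumes v: "regular v" "continuous_across v" and w: "regular w" "insulated w" and d: "d > 0"
    and pde: "\<And>x. x \<in> D \<Longrightarrow> - d * divergence (conductive_flux w) x = f - h * (w x - \<theta>\<^sub>0)"
    and k: "k absolutely_integrable_on {0..1}"
      "\<And>s. s \<in> {0<..<1} \<Longrightarrow> - d * jump_vector \<gamma> (conductive_flux w) s * norm (\<gamma>' s) = k s"
  shows "d * energy v w + h * mass v w - (f + h * \<theta>\<^sub>0) * integral D v = - integral {0..1} (\<lambda>s. trace v s * k s)"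
proof -
  have div: "divergence (conductive_flux w) x = (h * w x - (f + h * \<theta>\<^sub>0)) / d" if "x \<in> D" for x
    using pde[OF that] d by (simp add: field_simps)
  have divb: "\<exists>M. \<forall>x\<in>D. \<bar>divergence (conductive_flux w) x\<bar> \<le> M"
  proof -
    obtain M where M: "\<And>x. x \<in> D \<Longrightarrow> \<bar>w x\<bar> \<le> M" using regular_bounded[OF w(1)] by blast
    have "\<bar>divergence (conductive_flux w) x\<bar> \<le> (\<bar>h\<bar> * \<bar>M\<bar> + \<bar>f + h * \<theta>\<^sub>0\<bar>) / d" if "x \<in> D" for x
    proof -
      have "\<bar>h * w x - (f + h * \<theta>\<^sub>0)\<bar> \<le> \<bar>h\<bar> * \<bar>w x\<bar> + \<bar>f + h * \<theta>\<^sub>0\<bar>"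
        by (metis abs_mult abs_triangle_ineq4)
      also have "\<dots> \<le> \<bar>h\<bar> * \<bar>M\<bar> + \<bar>f + h * \<theta>\<^sub>0\<bar>"
        using M[OF that] by (intro add_right_mono mult_left_mono) auto
      finally show ?thesis using d by (simp add: div[OF that] abs_divide divide_right_mono)
    qed
    then show ?thesis by blast
  qed
  define j where "j s = - (1 / d) * k s" for s
  have j: "j absolutely_integrable_on {0..1}" unfolding j_def using k(1) by (rule set_integrable_mult_right)
  have "jump_vector \<gamma> (conductive_flux w) s * norm (\<gamma>' s) = j s" if "s \<in> {0<..<1}" for s
    using k(2)[OF that] d by (simp add: j_def field_simps)
  from green_identity[OF v w divb j this]
  have "integral D (\<lambda>x. v x * divergence (conductive_flux w) x) + energy v w = integral {0..1} (\<lambda>s. trace v s * j s)"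
    by (simp add: energy_def)
  moreover have "integral D (\<lambda>x. v x * divergence (conductive_flux w) x) = (h * mass v w - (f + h * \<theta>\<^sub>0) * integral D v) / d"
  proof -
    have "((\<lambda>x. (h * (v x * w x) - (f + h * \<theta>\<^sub>0) * v x) / d) has_integral
        (h * mass v w - (f + h * \<theta>\<^sub>0) * integral D v) / d) D"
      unfolding mass_def
      by (intro has_integral_divide has_integral_diff has_integral_mult_right integrable_integral
          mass_integrable regular_integrable v w)
    then have "((\<lambda>x. v x * divergence (conductive_flux w) x) has_integral
        (h * mass v w - (f + h * \<theta>\<^sub>0) * integral D v) / d) D"
      by (rule has_integral_eq[rotated]) (simp add: div algebra_simps)
    then show ?thesis by (rule integral_unique)
  qed
  moreover have "integral {0..1} (\<lambda>s. trace v s * j s) = - (1 / d) * integral {0..1} (\<lambda>s. trace v s * k s)"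
    unfolding integral_mult_right[symmetric] j_def by (simp add: algebra_simps)
  ultimately show ?thesis using d by (simp add: field_simps)
qed

lemma continuous_acrossI:
  assumes "\<And>s. s \<in> {0<..<1} \<Longrightarrow> jump_scalar \<gamma> v s = 0"
  shows "continuous_across v"
  unfolding continuous_across_def
proof
  fix s :: real assume s: "s \<in> {0<..<1}"
  then have s01: "s \<in> {0..1}" by simp
  have "jump_scalar \<gamma> v s = (osv v (-1) s - osv v 1 s) *\<^sub>R normal s"
    by (simp only: jump_scalar_def one_sided_value_plus_minus)
      (simp add: normal_minus_def scaleR_diff_left)
  moreover have "normal s \<noteq> 0" using norm_normal[OF s01] by force
  ultimately show "osv v (-1) s = osv v 1 s" using assms[OF s] by simp
qed

lemma inlet_value:
  assumes "regular v" "(average \<gamma> v \<longlongrightarrow> l) (at_right 0)"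
  shows "v (\<gamma> 0) = l"
proof (rule tendsto_unique)
  show "at (0::real) within {0<..<1} \<noteq> bot"
    using islimpt_greaterThanLessThan1[of 0 "1::real"] by (simp add: trivial_limit_within)
  show "(average \<gamma> v \<longlongrightarrow> v (\<gamma> 0)) (at 0 within {0<..<1})" by (rule average_tendsto_end[OF assms(1)]) simp
  show "(average \<gamma> v \<longlongrightarrow> l) (at 0 within {0<..<1})"
    by (rule tendsto_within_subset[OF assms(2)]) auto
qed

lemma outlet_value:
  assumes "regular v" "(average \<gamma> v \<longlongrightarrow> l) (at_left 1)"
  shows "v (\<gamma> 1) = l"
proof (rule tendsto_unique)
  show "at (1::real) within {0<..<1} \<noteq> bot"
    using islimpt_greaterThanLessThan2[of 0 "1::real"] by (simp add: trivial_limit_within)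
  show "(average \<gamma> v \<longlongrightarrow> v (\<gamma> 1)) (at 1 within {0<..<1})" by (rule average_tendsto_end[OF assms(1)]) simp
  show "(average \<gamma> v \<longlongrightarrow> l) (at 1 within {0<..<1})"
    by (rule tendsto_within_subset[OF assms(2)]) auto
qed

lemma conductive_flux_eq: "(\<lambda>y. \<kappa> y *\<^sub>R grad w y) = conductive_flux w"
  by (simp add: conductive_flux_def fun_eq_iff)

lemma forward_solutionD:
  assumes "forward_solution \<Omega> \<gamma> d \<kappa> h \<theta>\<^sub>0 \<theta>\<^sub>0 f c w" "d > 0"
  shows "regular w" "continuous_across w" "insulated w" "w (\<gamma> 0) = \<theta>\<^sub>0"
    "\<And>x. x \<in> D \<Longrightarrow> - d * divergence (conductive_flux w) x = f x - h * (w x - \<theta>\<^sub>0)"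
    "\<And>s. s \<in> {0<..<1} \<Longrightarrow> - d * jump_vector \<gamma> (conductive_flux w) s = c * tangential_derivative \<gamma> w s"
  using assms inlet_value[of w \<theta>\<^sub>0] continuous_acrossI[of w]
  unfolding forward_solution_def conductive_flux_eq insulated_def by (auto split: prod.splits)

lemma reverse_solutionD:
  assumes "reverse_solution \<Omega> \<gamma> d \<kappa> h \<theta>\<^sub>0 \<theta>\<^sub>0 f c w" "d > 0"
  shows "regular w" "continuous_across w" "insulated w" "w (\<gamma> 1) = \<theta>\<^sub>0"
    "\<And>x. x \<in> D \<Longrightarrow> - d * divergence (conductive_flux w) x = f x - h * (w x - \<theta>\<^sub>0)"
    "\<And>s. s \<in> {0<..<1} \<Longrightarrow> - d * jump_vector \<gamma> (conductive_flux w) s = - c * tangential_derivative \<gamma> w s"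
  using assms outlet_value[of w \<theta>\<^sub>0] continuous_acrossI[of w]
  unfolding reverse_solution_def conductive_flux_eq insulated_def by (auto split: prod.splits)

text \<open>Differentiating the forward problem in the rate. The transport term \<open>a \<theta>\<^sub>a'\<close> contributes the source
\<open>\<theta>\<^sub>c'\<close> on the slit; the other relations are affine in the temperature, and their constants drop out.\<close>

lemma sensitivity_problem:
  assumes d: "d > 0" and c: "c > 0"
    and \<theta>: "\<And>a. a > 0 \<Longrightarrow> forward_solution \<Omega> \<gamma> d \<kappa> h \<theta>\<^sub>0 \<theta>\<^sub>0 (\<lambda>_. f) a (\<theta> a)"
    and rate: "rate_differentiable \<Omega> \<gamma> \<kappa> \<theta> c"
  obtains u where "regular u" "continuous_across u" "insulated u" "u (\<gamma> 0) = 0"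
    "\<And>x. x \<in> D \<Longrightarrow> - d * divergence (conductive_flux u) x = 0 - h * (u x - 0)"
    "\<And>s. s \<in> {0<..<1} \<Longrightarrow> - d * jump_vector \<gamma> (conductive_flux u) s
        = tangential_derivative \<gamma> (\<theta> c) s + c * tangential_derivative \<gamma> u s"
    "((\<lambda>a. integral \<Omega> (\<theta> a)) has_real_derivative integral \<Omega> u) (at c)"
proof -
  obtain u where u: "regular u"
    "\<And>x. x \<in> closure \<Omega> - \<gamma> ` {0<..<1} \<Longrightarrow> ((\<lambda>a. \<theta> a x) has_real_derivative u x) (at c)"
    "\<And>x. x \<in> D \<Longrightarrow> ((\<lambda>a. divergence (conductive_flux (\<theta> a)) x) has_real_derivative
           divergence (conductive_flux u) x) (at c)"
    "\<And>s n. s \<in> {0<..<1} \<Longrightarrow> n \<in> {normal_plus \<gamma> s, normal_minus \<gamma> s} \<Longrightarrow>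
        ((\<lambda>a. side_value (\<gamma> s) n (\<theta> a)) has_real_derivative side_value (\<gamma> s) n u) (at c)"
    "\<And>s n. s \<in> {0<..<1} \<Longrightarrow> n \<in> {normal_plus \<gamma> s, normal_minus \<gamma> s} \<Longrightarrow>
        ((\<lambda>a. side_value (\<gamma> s) n (grad (\<theta> a))) has_vector_derivative side_value (\<gamma> s) n (grad u)) (at c)"
    "\<And>x n. (x, n) \<in> smooth_boundary \<Omega> \<gamma> \<Longrightarrow>
        ((\<lambda>a. boundary_value \<Omega> \<gamma> x (grad (\<theta> a))) has_vector_derivative boundary_value \<Omega> \<gamma> x (grad u)) (at c)"
    "((\<lambda>a. integral \<Omega> (\<theta> a)) has_real_derivative integral \<Omega> u) (at c)"
    using rate unfolding rate_differentiable_def conductive_flux_eq by fast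
  note \<theta>D = forward_solutionD[OF \<theta> d]
  \<comment> \<open>a relation that holds at all positive rates may be differentiated in the rate\<close>
  have uniq: "p = q" if "(f has_real_derivative p) (at c)" "(g has_real_derivative q) (at c)"
    "\<And>a. a > 0 \<Longrightarrow> f a = g a" for f g p q
  proof -
    have "(g has_real_derivative p) (at c)"
      by (rule has_field_derivative_transform_within_open[OF that(1), of "{0<..}"]) (use c that(3) in auto)
    then show ?thesis using that(2) by (rule DERIV_unique)
  qed
  have osv_u: "((\<lambda>a. osv (\<theta> a) \<sigma> s) has_real_derivative osv u \<sigma> s) (at c)"
    and osv_gu: "((\<lambda>a. osv (grad (\<theta> a)) \<sigma> s) has_vector_derivative osv (grad u) \<sigma> s) (at c)"
    if s: "s \<in> {0<..<1}" and \<sigma>: "\<sigma> = 1 \<or> \<sigma> = -1" for \<sigma> s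
    using u(4,5)[OF s, of "normal_plus \<gamma> s"] u(4,5)[OF s, of "normal_minus \<gamma> s"] \<sigma>
    by (auto simp only: one_sided_value_plus_minus insert_iff)
  have inner_deriv: "((\<lambda>a. F a \<bullet> z) has_real_derivative F' \<bullet> z) (at c)"
    if "(F has_vector_derivative F') (at c)" for F :: "real \<Rightarrow> real^2" and F' z
    using has_derivative_inner_left[OF that[unfolded has_vector_derivative_def], of z]
    by (simp add: has_field_derivative_def mult_commute_abs)
  show thesis
  proof (rule that[OF u(1)])
    show "continuous_across u"
      unfolding continuous_across_def
    proof
      fix s :: real assume s: "s \<in> {0<..<1}"
      show "osv u (-1) s = osv u 1 s"
        by (rule uniq[OF osv_u[OF s] osv_u[OF s]]) (use \<theta>D(2) s in \<open>auto simp: continuous_across_def\<close>)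
    qed
    show "insulated u"
      unfolding insulated_def
    proof safe
      fix x n assume x: "(x, n) \<in> smooth_boundary \<Omega> \<gamma>"
      have "((\<lambda>a. \<kappa> x * (boundary_value \<Omega> \<gamma> x (grad (\<theta> a)) \<bullet> n)) has_real_derivative
          \<kappa> x * (boundary_value \<Omega> \<gamma> x (grad u) \<bullet> n)) (at c)"
        by (intro DERIV_cmult inner_deriv u(6)[OF x])
      moreover have "\<kappa> x * (boundary_value \<Omega> \<gamma> x (grad (\<theta> a)) \<bullet> n) = 0" if "a > 0" for a
        using \<theta>D(3)[OF that] x boundary_limit(4)[OF \<theta>D(1)[OF that] x]
        by (auto simp: insulated_def inner_commute)
      ultimately have "\<kappa> x * (boundary_value \<Omega> \<gamma> x (grad u) \<bullet> n) = 0"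
        using uniq[OF _ DERIV_const] by blast
      then show "n \<bullet> boundary_value \<Omega> \<gamma> x (conductive_flux u) = 0"
        unfolding boundary_limit(4)[OF u(1) x] by (simp add: inner_commute)
    qed
    have "\<gamma> 0 \<in> closure \<Omega> - \<gamma> ` {0<..<1}"
      using ends_in_frontier(1) frontier_not_in curve_interior by (fastforce simp: frontier_def)
    then show "u (\<gamma> 0) = 0"
      by (rule uniq[OF u(2) DERIV_const]) (rule \<theta>D(4))
    show "- d * divergence (conductive_flux u) x = 0 - h * (u x - 0)" if x: "x \<in> D" for x
    proof (rule uniq)
      show "((\<lambda>a. - d * divergence (conductive_flux (\<theta> a)) x) has_real_derivative
          - d * divergence (conductive_flux u) x) (at c)"
        by (rule DERIV_cmult[OF u(3)[OF x]])
      have "x \<in> closure \<Omega> - \<gamma> ` {0<..<1}" using x D_subset by blast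
      then show "((\<lambda>a. f - h * (\<theta> a x - \<theta>\<^sub>0)) has_real_derivative 0 - h * (u x - 0)) (at c)"
        by (intro DERIV_diff DERIV_const DERIV_cmult u(2))
    qed (rule \<theta>D(5)[OF _ x])
    show "- d * jump_vector \<gamma> (conductive_flux u) s
        = tangential_derivative \<gamma> (\<theta> c) s + c * tangential_derivative \<gamma> u s" if s: "s \<in> {0<..<1}" for s
    proof (rule uniq)
      have jump: "jump_vector \<gamma> (conductive_flux w) s
          = \<kappa> (\<gamma> s) * (osv (grad w) (-1) s \<bullet> normal s - osv (grad w) 1 s \<bullet> normal s)" if "regular w" for w
        unfolding jump_vector_eq using conductive_flux_side_values(2)[OF that _ s]
        by (simp add: inner_diff_left right_diff_distrib)
      show "((\<lambda>a. - d * (\<kappa> (\<gamma> s) * (osv (grad (\<theta> a)) (-1) s \<bullet> normal s - osv (grad (\<theta> a)) 1 s \<bullet> normal s)))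
          has_real_derivative - d * jump_vector \<gamma> (conductive_flux u) s) (at c)"
        unfolding jump[OF u(1)]
        by (intro DERIV_cmult DERIV_diff inner_deriv osv_gu s) auto
      show "((\<lambda>a. a * ((osv (grad (\<theta> a)) (-1) s \<bullet> tangent s + osv (grad (\<theta> a)) 1 s \<bullet> tangent s) / 2))
          has_real_derivative tangential_derivative \<gamma> (\<theta> c) s + c * tangential_derivative \<gamma> u s) (at c)"
      proof -
        have "((\<lambda>a. (osv (grad (\<theta> a)) (-1) s \<bullet> tangent s + osv (grad (\<theta> a)) 1 s \<bullet> tangent s) / 2)
            has_real_derivative tangential_derivative \<gamma> u s) (at c)"
          unfolding tangential_derivative_eq[OF regularD(5)[OF u(1)] s]
          by (intro DERIV_cdivide DERIV_add inner_deriv osv_gu s) auto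
        from DERIV_mult[OF DERIV_ident this] show ?thesis
          unfolding tangential_derivative_eq[OF regularD(5)[OF \<theta>D(1)[OF c]] s] by (simp add: algebra_simps)
      qed
      show "- d * (\<kappa> (\<gamma> s) * (osv (grad (\<theta> a)) (-1) s \<bullet> normal s - osv (grad (\<theta> a)) 1 s \<bullet> normal s))
          = a * ((osv (grad (\<theta> a)) (-1) s \<bullet> tangent s + osv (grad (\<theta> a)) 1 s \<bullet> tangent s) / 2)"
        if a: "a > 0" for a
        using \<theta>D(6)[OF a s] unfolding jump[OF \<theta>D(1)[OF a]]
          tangential_derivative_eq[OF regularD(5)[OF \<theta>D(1)[OF a]] s] .
    qed
  qed (rule u(7))
qed

text \<open>The weak forms are tested with the temperatures themselves; the ambient temperature then enters through the heat
balance that the test function 1 yields for \<open>u\<close>.\<close>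

lemma sensitivity:
  assumes d: "d > 0" and h: "h > 0" and c: "c > 0" and f: "f > 0"
    and \<kappa>: "\<And>x. x \<in> \<Omega> \<Longrightarrow> \<kappa> x > 0"
    and \<theta>: "\<And>a. a > 0 \<Longrightarrow> forward_solution \<Omega> \<gamma> d \<kappa> h \<theta>\<^sub>0 \<theta>\<^sub>0 (\<lambda>_. f) a (\<theta> a)"
    and rate: "rate_differentiable \<Omega> \<gamma> \<kappa> \<theta> c"
    and r: "reverse_solution \<Omega> \<gamma> d \<kappa> h \<theta>\<^sub>0 \<theta>\<^sub>0 (\<lambda>_. f) c r"
  defines "X \<equiv> curve_integral \<gamma> (\<lambda>s. (average \<gamma> r s - \<theta>\<^sub>0) * tangential_derivative \<gamma> (\<theta> c) s)"
  shows "((\<lambda>a. integral \<Omega> (\<theta> a)) has_real_derivative - (1 / f) * X) (at c)" and "X \<ge> 0"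
proof -
  define t where "t = \<theta> c"
  obtain u where u: "regular u" "continuous_across u" "insulated u" "u (\<gamma> 0) = 0"
    "\<And>x. x \<in> D \<Longrightarrow> - d * divergence (conductive_flux u) x = 0 - h * (u x - 0)"
    "\<And>s. s \<in> {0<..<1} \<Longrightarrow> - d * jump_vector \<gamma> (conductive_flux u) s
        = tangential_derivative \<gamma> t s + c * tangential_derivative \<gamma> u s"
    "((\<lambda>a. integral \<Omega> (\<theta> a)) has_real_derivative integral \<Omega> u) (at c)"
    using sensitivity_problem[OF d c \<theta> rate] unfolding t_def by metis
  note tD = forward_solutionD[OF \<theta>[OF c] d, folded t_def]
  note rD = reverse_solutionD[OF r d]
  note ti = tangential_absolutely_integrable
  have X: "X = advection r t - \<theta>\<^sub>0 * (t (\<gamma> 1) - \<theta>\<^sub>0)"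
  proof -
    have "((\<lambda>s. trace r s * tangential t s - \<theta>\<^sub>0 * tangential t s) has_integral
        advection r t - \<theta>\<^sub>0 * (t (\<gamma> 1) - \<theta>\<^sub>0)) {0..1}"
      unfolding advection_def tD(4)[symmetric, unfolded t_def[symmetric]] tangential_integral[OF tD(1,2), symmetric]
      using ti[OF tD(1)]
      by (intro has_integral_diff has_integral_mult_right integrable_integral advection_integrable rD(1) tD(1))
        (simp add: absolutely_integrable_on_def)
    then have "((\<lambda>s. ((average \<gamma> r s - \<theta>\<^sub>0) * tangential_derivative \<gamma> t s) * norm (\<gamma>' s)) has_integral
        advection r t - \<theta>\<^sub>0 * (t (\<gamma> 1) - \<theta>\<^sub>0)) {0..1}"
      by (rule has_integral_spike_finite[of "{0, 1}", rotated 2])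
        (auto simp: trace_def tangential_def algebra_simps)
    then show ?thesis by (simp add: X_def curve_integral_def t_def integral_unique)
  qed
  have fwd: "d * energy v t + h * mass v t - (f + h * \<theta>\<^sub>0) * integral D v = - (c * advection v t)"
    if v: "regular v" "continuous_across v" for v
  proof -
    have k1: "(\<lambda>s. c * tangential t s) absolutely_integrable_on {0..1}" using ti[OF tD(1)] by simp
    have k2: "- d * jump_vector \<gamma> (conductive_flux t) s * norm (\<gamma>' s) = c * tangential t s"
      if "s \<in> {0<..<1}" for s
      unfolding tD(6)[OF that] tangential_def by simp
    have "d * energy v t + h * mass v t - (f + h * \<theta>\<^sub>0) * integral D v
        = - integral {0..1} (\<lambda>s. trace v s * (c * tangential t s))"
      by (rule weak_form[OF v tD(1,3) d tD(5) k1 k2])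
    also have "(\<lambda>s. trace v s * (c * tangential t s)) = (\<lambda>s. c * (trace v s * tangential t s))"
      by (simp add: mult.left_commute)
    finally show ?thesis by (simp add: advection_def)
  qed
  have rev: "d * energy v r + h * mass v r - (f + h * \<theta>\<^sub>0) * integral D v = c * advection v r"
    if v: "regular v" "continuous_across v" for v
  proof -
    have k1: "(\<lambda>s. - c * tangential r s) absolutely_integrable_on {0..1}" by (rule set_integrable_mult_right) (use ti[OF rD(1)] in simp)
    have k2: "- d * jump_vector \<gamma> (conductive_flux r) s * norm (\<gamma>' s) = - c * tangential r s"
      if "s \<in> {0<..<1}" for s
      unfolding rD(6)[OF that] tangential_def by simp
    have "d * energy v r + h * mass v r - (f + h * \<theta>\<^sub>0) * integral D v
        = - integral {0..1} (\<lambda>s. trace v s * (- c * tangential r s))"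
      by (rule weak_form[OF v rD(1,3) d rD(5) k1 k2])
    also have "(\<lambda>s. trace v s * (- c * tangential r s)) = (\<lambda>s. - c * (trace v s * tangential r s))"
      by (simp add: mult.left_commute)
    finally show ?thesis by (simp add: advection_def)
  qed
  have sens: "d * energy v u + h * mass v u = - (advection v t + c * advection v u)"
    if v: "regular v" "continuous_across v" for v
  proof -
    have k: "(\<lambda>s. tangential t s + c * tangential u s) absolutely_integrable_on {0..1}"
      using ti[OF tD(1)] ti[OF u(1)] by (intro set_integral_add) auto
    have k': "- d * jump_vector \<gamma> (conductive_flux u) s * norm (\<gamma>' s) = tangential t s + c * tangential u s"
      if "s \<in> {0<..<1}" for s
      unfolding u(6)[OF that] tangential_def by (simp add: algebra_simps)
    have "integral {0..1} (\<lambda>s. trace v s * (tangential t s + c * tangential u s))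
        = advection v t + c * advection v u"
    proof (rule integral_unique)
      have "((\<lambda>s. trace v s * tangential t s + c * (trace v s * tangential u s)) has_integral
          advection v t + c * advection v u) {0..1}"
        unfolding advection_def
        by (intro has_integral_add has_integral_mult_right integrable_integral advection_integrable v tD(1) u(1))
      then show "((\<lambda>s. trace v s * (tangential t s + c * tangential u s)) has_integral
          advection v t + c * advection v u) {0..1}"
        by (simp add: algebra_simps)
    qed
    with weak_form[OF v u(1,3) d u(5) k k'] show ?thesis by simp
  qed
  note B = advection_sum[OF tD(1,2) tD(1,2)] advection_sum[OF rD(1,2) rD(1,2)]
    advection_sum[OF tD(1,2) rD(1,2)] advection_sum[OF u(1,2) rD(1,2)]
  \<comment> \<open>heat balance: surface loss against the heat that leaves through the outlet\<close>
  have one: "h * integral D u = - (t (\<gamma> 1) - \<theta>\<^sub>0 + c * u (\<gamma> 1))"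
    using sens[OF regular_const[of 1] continuous_across_const] tangential_integral[OF tD(1,2)]
      tangential_integral[OF u(1,2)]
    by (simp add: energy_def mass_def advection_def trace_const grad_const tD(4) u(4))
  have "integral D u * f = - X"
  proof -
    \<comment> \<open>the symmetric form cancels between the reverse problem tested with \<open>u\<close> and the sensitivity problem tested with \<open>r\<close>\<close>
    have "- (f + h * \<theta>\<^sub>0) * integral D u = c * (advection u r + advection r u) + advection r t"
      using rev[OF u(1,2)] sens[OF rD(1,2)] energy_commute[of u r] mass_commute[of u r]
      by (simp add: algebra_simps)
    also have "advection u r + advection r u = u (\<gamma> 1) * \<theta>\<^sub>0" using B(4) by (simp add: rD(4) u(4))
    finally have "- f * integral D u - \<theta>\<^sub>0 * (h * integral D u) = c * (u (\<gamma> 1) * \<theta>\<^sub>0) + advection r t"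
      by (simp add: algebra_simps)
    then show ?thesis unfolding one X by (simp add: algebra_simps)
  qed
  moreover have "integral \<Omega> u = integral D u"
    by (rule integral_spike_set) (auto intro: negligible_subset[OF path_image_negligible])
  ultimately have "integral \<Omega> u = - (1 / f) * X" using f by (simp add: field_simps)
  then show "((\<lambda>a. integral \<Omega> (\<theta> a)) has_real_derivative - (1 / f) * X) (at c)" using u(7) by simp
  have "d * (energy t t - 2 * energy t r + energy r r) + h * (mass t t - 2 * mass t r + mass r r) \<ge> 0"
    using energy_difference_nonneg[OF tD(1) rD(1) \<kappa>] mass_difference_nonneg[OF tD(1) rD(1)] d h by simp
  \<comment> \<open>the symmetric form of \<open>t - r\<close> with itself, by the weak forms tested with \<open>t\<close> and with \<open>r\<close>\<close>
  moreover have "d * (energy t t - 2 * energy t r + energy r r) + h * (mass t t - 2 * mass t r + mass r r)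
      = c * (advection r t - advection t r - advection t t + advection r r)"
    using fwd[OF tD(1,2)] fwd[OF rD(1,2)] rev[OF tD(1,2)] rev[OF rD(1,2)]
      energy_commute[of r t] mass_commute[of r t] by (simp add: algebra_simps)
  ultimately have "c * (advection r t - advection t r - advection t t + advection r r) \<ge> 0" by simp
  then have "advection r t - advection t r - advection t t + advection r r \<ge> 0"
    using c by (simp add: zero_le_mult_iff)
  \<comment> \<open>integration by parts leaves squares of the temperature excess at the outlet (forward) and at the inlet (reverse)\<close>
  moreover have "4 * X = 2 * (advection r t - advection t r - advection t t + advection r r)
      + ((t (\<gamma> 1) - \<theta>\<^sub>0)\<^sup>2 + (r (\<gamma> 0) - \<theta>\<^sub>0)\<^sup>2)"
    using B(1-3) unfolding X tD(4) rD(4) by (simp add: power2_eq_square algebra_simps)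
  ultimately show "X \<ge> 0" by (smt (verit) zero_le_power2)
qed

end

theorem theorem4p1:
  fixes \<Omega> :: "(real^2) set" and \<gamma> :: "real \<Rightarrow> real^2"
    and d h\<^sub>T \<theta>amb \<theta>inlet f\<^sub>0 c :: real
    and \<kappa> :: "real^2 \<Rightarrow> real"
    and \<theta> :: "real \<Rightarrow> real^2 \<Rightarrow> real" and \<theta>r :: "real^2 \<Rightarrow> real"
  assumes "open \<Omega>" and "connected \<Omega>" and "bounded \<Omega>" and "piecewise_smooth_boundary \<Omega>"
    and "vasculature \<Omega> \<gamma>"
    and "d > 0" and "h\<^sub>T > 0"
    and "continuous_on (closure \<Omega>) \<kappa>" and "\<forall>x\<in>\<Omega>. \<kappa> x > 0"
    and "\<theta>inlet = \<theta>amb"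
    and "f\<^sub>0 > 0" and "c > 0"
    and "\<forall>a>0. forward_solution \<Omega> \<gamma> d \<kappa> h\<^sub>T \<theta>amb \<theta>inlet (\<lambda>_. f\<^sub>0) a (\<theta> a)"
    and "rate_differentiable \<Omega> \<gamma> \<kappa> \<theta> c"
    and "reverse_solution \<Omega> \<gamma> d \<kappa> h\<^sub>T \<theta>amb \<theta>inlet (\<lambda>_. f\<^sub>0) c \<theta>r"
  shows "((\<lambda>a. integral \<Omega> (\<theta> a)) has_real_derivative
            - (1 / f\<^sub>0) * curve_integral \<gamma>
                (\<lambda>s. (average \<gamma> \<theta>r s - \<theta>amb) * tangential_derivative \<gamma> (\<theta> c) s)) (at c) \<and>
         - (1 / f\<^sub>0) * curve_integral \<gamma>
           (\<lambda>s. (average \<gamma> \<theta>r s - \<theta>amb) * tangential_derivative \<gamma> (\<theta> c) s) \<le> 0"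
proof -
  interpret slit_domain \<Omega> \<gamma> \<kappa>
    using assms by unfold_locales auto
  note S = sensitivity[OF assms(6,7,12,11), of \<theta>amb \<theta> \<theta>r]
  have "\<And>a. a > 0 \<Longrightarrow> forward_solution \<Omega> \<gamma> d \<kappa> h\<^sub>T \<theta>amb \<theta>amb (\<lambda>_. f\<^sub>0) a (\<theta> a)"
    "reverse_solution \<Omega> \<gamma> d \<kappa> h\<^sub>T \<theta>amb \<theta>amb (\<lambda>_. f\<^sub>0) c \<theta>r"
    using assms(10,13,15) by auto
  from S(1)[OF _ this(1) assms(14) this(2)] S(2)[OF _ this(1) assms(14) this(2)] show ?thesis
    using assms(9,11) by (auto simp: mult_le_0_iff)
qed

end
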